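(* Let $p>1$ and assume that $V,\Gamma\in L^\infty_{loc}(\mathbb{R}^3)$ and $0\le V\Gamma^{-1}\in L^{\frac{p}{p-1}}_{loc}(\mathbb{R}^3)$. Additionally suppose the full radial symmetry of $V$ and $\Gamma$ in $\mathbb{R}^3$, i.e. $V(x)=\tilde V(|x|)$ and $\Gamma(x)=\tilde\Gamma(|x|)$ for almost all $x\in\mathbb{R}^3$, with $\tilde V,\tilde\Gamma\in L^\infty_{loc}([0,\infty))$. Under the full radial symmetry condition $U(x)=M^TU(Mx)$ for a.a. $x\in\mathbb{R}^3$ and all $M\in O(3)$, all distributional solutions $U\in L^p_{loc}(\mathbb{R}^3)$ of $$\nabla\times\nabla\times U+V(x)U=\Gamma(x)|U|^{p-1}U\quad\text{in }\mathbb{R}^3$$ satisfy $\nabla\times U=0$ and have the form $$U(x)=s(|x|)\left(\frac{V(x)}{\Gamma(x)}\right)^{\frac{1}{p-1}}\frac{x}{|x|},$$ where $s:(0,\infty)\to\{-1,1\}$ is an arbitrary measurable function. If additionally $(V\Gamma^{-1})^{\frac{2}{p-1}}\in L^1(\mathbb{R}^3)$ and $(V\Gamma^{-1})^{\frac{p+1}{p-1}}\Gamma\in L^1(\mathbb{R}^3)$, then $U\in X$ and hence it is a critical point of $J$.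
   Context: The functions $V,\Gamma$ are real-valued and the fields $U$ are vector fields $U:\mathbb{R}^3\to\mathbb{R}^3$. A field $U\in L^p_{loc}(\mathbb{R}^3;\mathbb{R}^3)$ is a distributional solution if $\int_{\mathbb{R}^3}U\cdot(\nabla\times\nabla\times\phi+V\phi)-\Gamma|U|^{p-1}U\cdot\phi\,dx=0$ for all $\phi\in C_0^\infty(\mathbb{R}^3;\mathbb{R}^3)$; $\nabla\times U=0$ is understood in the sense of distributions. $H(\mathrm{curl};\mathbb{R}^3)$ is the space of $U\in L^2(\mathbb{R}^3;\mathbb{R}^3)$ whose distributional curl lies in $L^2(\mathbb{R}^3;\mathbb{R}^3)$; $L^{p+1}_{|\Gamma|}(\mathbb{R}^3)$ is the space of $L^{p+1}$-functions $U:\mathbb{R}^3\to\mathbb{R}^3$ with respect to the measure $|\Gamma|\,dx$, i.e. with $\int_{\mathbb{R}^3}|\Gamma||U|^{p+1}\,dx<\infty$; $X=H(\mathrm{curl};\mathbb{R}^3)\cap L^{p+1}_{|\Gamma|}(\mathbb{R}^3)$; and $$J[U]=\int_{\mathbb{R}^3}\frac12\left(|\nabla\times U|^2+V(x)|U|^2\right)-\frac{\Gamma(x)}{p+1}|U|^{p+1}\,dx,\qquad U\in X.$$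
   Formalization: Since U=0 is a solution, s takes values in {-1,0,1} in general, and in {-1,1} when U does not vanish a.e. where V≠0; Γ≠0 a.e. is made explicit, and critical point of J means zero directional derivative along all φ in X for which J[U+tφ] is defined for all t. *)

theory Defs
  imports "HOL-Analysis.Analysis"
begin

text \<open>Elements of the function spaces below are representatives, not classes modulo null sets;
  measurability is Lebesgue measurability.\<close>

definition Linf_loc :: "'a::euclidean_space set \<Rightarrow> ('a \<Rightarrow> 'b::euclidean_space) set" where
  "Linf_loc S = {f. f \<in> borel_measurable (lebesgue_on S) \<and>
     (\<forall>K. compact K \<and> K \<subseteq> S \<longrightarrow> (\<exists>C. AE x in lebesgue_on K. norm (f x) \<le> C))}"

definition Lp_loc :: "real \<Rightarrow> ('a::euclidean_space \<Rightarrow> 'b::euclidean_space) set" where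
  "Lp_loc q = {f. f \<in> borel_measurable lebesgue \<and>
     (\<forall>K. compact K \<longrightarrow> integrable (lebesgue_on K) (\<lambda>x. norm (f x) powr q))}"

definition L2 :: "('a::euclidean_space \<Rightarrow> 'b::euclidean_space) set" where
  "L2 = {f. f \<in> borel_measurable lebesgue \<and> integrable lebesgue (\<lambda>x. (norm (f x))\<^sup>2)}"

definition Lp_weighted :: "real \<Rightarrow> ('a::euclidean_space \<Rightarrow> real) \<Rightarrow> ('a \<Rightarrow> 'b::euclidean_space) set" where
  "Lp_weighted q w = {f. f \<in> borel_measurable lebesgue \<and>
     integrable lebesgue (\<lambda>x. w x * norm (f x) powr q)}"

definition partial_deriv :: "'n::finite \<Rightarrow> (real^'n \<Rightarrow> 'b::real_normed_vector) \<Rightarrow> real^'n \<Rightarrow> 'b" where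
  "partial_deriv i f x = frechet_derivative f (at x) (axis i 1)"

primrec Ck :: "nat \<Rightarrow> (real^'n::finite \<Rightarrow> 'b::real_normed_vector) \<Rightarrow> bool" where
  "Ck 0 f \<longleftrightarrow> continuous_on UNIV f"
| "Ck (Suc k) f \<longleftrightarrow> f differentiable_on UNIV \<and> (\<forall>i. Ck k (partial_deriv i f))"

definition test_fields :: "(real^3 \<Rightarrow> real^3) set" where
  "test_fields = {\<phi>. (\<forall>k. Ck k \<phi>) \<and> compact (closure {x. \<phi> x \<noteq> 0})}"

definition curl :: "(real^3 \<Rightarrow> real^3) \<Rightarrow> real^3 \<Rightarrow> real^3" where
  "curl F x = vector
     [partial_deriv 2 F x $ 3 - partial_deriv 3 F x $ 2,
      partial_deriv 3 F x $ 1 - partial_deriv 1 F x $ 3,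
      partial_deriv 1 F x $ 2 - partial_deriv 2 F x $ 1]"

definition has_weak_curl :: "(real^3 \<Rightarrow> real^3) \<Rightarrow> (real^3 \<Rightarrow> real^3) \<Rightarrow> bool" where
  "has_weak_curl U W \<longleftrightarrow> U \<in> Lp_loc 1 \<and> W \<in> Lp_loc 1 \<and>
     (\<forall>\<phi>\<in>test_fields. (\<integral>x. U x \<bullet> curl \<phi> x \<partial>lebesgue) = (\<integral>x. W x \<bullet> \<phi> x \<partial>lebesgue))"

definition Hcurl :: "(real^3 \<Rightarrow> real^3) set" where
  "Hcurl = {U. U \<in> L2 \<and> (\<exists>W\<in>L2. has_weak_curl U W)}"

text \<open>The choice is immaterial: a weak curl is unique up to null sets.\<close>

definition weak_curl :: "(real^3 \<Rightarrow> real^3) \<Rightarrow> real^3 \<Rightarrow> real^3" where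
  "weak_curl U = (SOME W. W \<in> L2 \<and> has_weak_curl U W)"

definition distributional_solution ::
  "real \<Rightarrow> (real^3 \<Rightarrow> real) \<Rightarrow> (real^3 \<Rightarrow> real) \<Rightarrow> (real^3 \<Rightarrow> real^3) \<Rightarrow> bool" where
  "distributional_solution p V \<Gamma> U \<longleftrightarrow> U \<in> Lp_loc p \<and>
     (\<forall>\<phi>\<in>test_fields. has_bochner_integral lebesgue
        (\<lambda>x. U x \<bullet> (curl (curl \<phi>) x + V x *\<^sub>R \<phi> x)
             - \<Gamma> x * norm (U x) powr (p - 1) * (U x \<bullet> \<phi> x)) 0)"

definition O3_symmetric :: "(real^3 \<Rightarrow> real^3) \<Rightarrow> bool" where
  "O3_symmetric U \<longleftrightarrow> (\<forall>M::real^3^3. orthogonal_matrix M \<longrightarrow>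
     (AE x in lebesgue. U x = transpose M *v U (M *v x)))"

definition radial_field ::
  "real \<Rightarrow> (real^3 \<Rightarrow> real) \<Rightarrow> (real^3 \<Rightarrow> real) \<Rightarrow> (real \<Rightarrow> real) \<Rightarrow> real^3 \<Rightarrow> real^3" where
  "radial_field p V \<Gamma> s x =
     (s (norm x) * (V x / \<Gamma> x) powr (1 / (p - 1))) *\<^sub>R (x /\<^sub>R norm x)"

text \<open>Measurable functions from the open half-line to \<open>A\<close>; values off the half-line are
  irrelevant.\<close>

definition measurable_profiles :: "real set \<Rightarrow> (real \<Rightarrow> real) set" where
  "measurable_profiles A = {s. s \<in> borel_measurable (lebesgue_on {0<..}) \<and> (\<forall>r>0. s r \<in> A)}"

definition X_space :: "real \<Rightarrow> (real^3 \<Rightarrow> real) \<Rightarrow> (real^3 \<Rightarrow> real^3) set" where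
  "X_space p \<Gamma> = Hcurl \<inter> Lp_weighted (p + 1) (\<lambda>x. \<bar>\<Gamma> x\<bar>)"

definition J_density ::
  "real \<Rightarrow> (real^3 \<Rightarrow> real) \<Rightarrow> (real^3 \<Rightarrow> real) \<Rightarrow> (real^3 \<Rightarrow> real^3) \<Rightarrow> real^3 \<Rightarrow> real" where
  "J_density p V \<Gamma> U x =
     1/2 * ((norm (weak_curl U x))\<^sup>2 + V x * (norm (U x))\<^sup>2)
     - \<Gamma> x / (p + 1) * norm (U x) powr (p + 1)"

definition J_functional ::
  "real \<Rightarrow> (real^3 \<Rightarrow> real) \<Rightarrow> (real^3 \<Rightarrow> real) \<Rightarrow> (real^3 \<Rightarrow> real^3) \<Rightarrow> real" where
  "J_functional p V \<Gamma> U = (\<integral>x. J_density p V \<Gamma> U x \<partial>lebesgue)"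

text \<open>For an unbounded potential \<open>V\<close> the integral defining the functional need not converge on all
  of \<open>X_space\<close>, so the functional lives on the subset where it does (all of \<open>X_space\<close> if
  \<open>V\<close> is bounded). A critical point is a point of vanishing Gateaux derivative, taken in
  all directions of \<open>X_space\<close> along which the functional is defined.\<close>

definition J_domain ::
  "real \<Rightarrow> (real^3 \<Rightarrow> real) \<Rightarrow> (real^3 \<Rightarrow> real) \<Rightarrow> (real^3 \<Rightarrow> real^3) set" where
  "J_domain p V \<Gamma> = {U \<in> X_space p \<Gamma>. integrable lebesgue (J_density p V \<Gamma> U)}"

definition critical_point_J ::
  "real \<Rightarrow> (real^3 \<Rightarrow> real) \<Rightarrow> (real^3 \<Rightarrow> real) \<Rightarrow> (real^3 \<Rightarrow> real^3) \<Rightarrow> bool" where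
  "critical_point_J p V \<Gamma> U \<longleftrightarrow> U \<in> J_domain p V \<Gamma> \<and>
     (\<forall>\<phi>\<in>X_space p \<Gamma>. (\<forall>t. (\<lambda>x. U x + t *\<^sub>R \<phi> x) \<in> J_domain p V \<Gamma>) \<longrightarrow>
        ((\<lambda>t. J_functional p V \<Gamma> (\<lambda>x. U x + t *\<^sub>R \<phi> x)) has_real_derivative 0) (at 0))"

end

theory Submission
  imports Defs "HOL-Computational_Algebra.Polynomial" "HOL-Real_Asymp.Real_Asymp"
begin

text \<open>A field with full \<open>O(3)\<close> symmetry is of the form \<open>f (|x|) x / |x|\<close>: averages over balls of
  radius \<open>\<epsilon>\<close> are equivariant at every point, so evaluating at a multiple of a fixed unit vector
  and using the rotation by \<open>\<pi>\<close> about it shows that they are radial, and they converge to the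
  field almost everywhere along a subsequence. Such a field has vanishing weak curl: for a test
  field \<open>\<phi>\<close> the image of the signed measure \<open>x \<bullet> curl \<phi> x dx\<close> under \<open>x \<mapsto> |x|\<^sup>2\<close> is zero, since
  integrating smooth functions against it amounts to integrating a divergence. Hence the curl term
  drops out of the equation, which becomes the pointwise identity
  \<open>V U = \<Gamma> |U|\<^bsup>p-1\<^esup> U\<close> and leaves only the sign (or zero) of \<open>f\<close> undetermined. The same identity
  cancels the derivatives of the two non-curl terms of the functional at \<open>U\<close>, and the curl term
  is quadratic in the variation because the curl of \<open>U\<close> vanishes.\<close>

section \<open>Classes of smooth functions and test fields\<close>

text \<open>Each orthogonal map comes with its own null set on which equivariance may fail, and
  uncountably many such sets cannot be united; a representative therefore cannot simply be evaluated
  along one axis. An average at a point turns an almost everywhere identity into an identity at that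
  point, and only countably many averages are needed to return to the field. The second obstacle is
  that the profile \<open>f\<close> is merely measurable and x / |x| is singular at the origin, so
  the radial field itself cannot be integrated by parts. All smoothness is put on the test side
  instead: the vanishing integrals are first obtained for smooth functions of |x|^2, which are
  smooth at the origin too, and then for indicators of half-lines. The resulting equality of two
  finite measures admits any Borel weight with a convergent integral, including one that is
  unbounded near 0.\<close>

lemma partial_deriv_eqI:
  "(f has_derivative f') (at x) \<Longrightarrow> partial_deriv i f x = f' (axis i 1)"
  unfolding partial_deriv_def by (metis frechet_derivative_at)

lemma Ck_Suc_imp_Ck: "Ck (Suc k) f \<Longrightarrow> Ck k f"
proof (induction k arbitrary: f)
  case 0
  then show ?case by (auto intro: differentiable_imp_continuous_on)
qed auto

lemma Ck_Suc_has_derivative: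
  assumes "Ck (Suc k) f"
  shows "(f has_derivative frechet_derivative f (at x)) (at x)"
  using assms by (auto simp: differentiable_on_def frechet_derivative_works)

lemma Ck_add: "Ck k f \<Longrightarrow> Ck k g \<Longrightarrow> Ck k (\<lambda>x. f x + g x)"
proof (induction k arbitrary: f g)
  case 0
  then show ?case by (auto intro: continuous_on_add)
next
  case (Suc k)
  have "partial_deriv i (\<lambda>x. f x + g x) = (\<lambda>x. partial_deriv i f x + partial_deriv i g x)" for i
    using partial_deriv_eqI[OF has_derivative_add[OF Ck_Suc_has_derivative[OF Suc.prems(1)] Ck_Suc_has_derivative[OF Suc.prems(2)]]]
    by (auto simp: partial_deriv_def)
  with Suc show ?case by (auto simp: differentiable_on_def)
qed

lemma Ck_bilinear:
  assumes "bounded_bilinear h"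
  shows "Ck k f \<Longrightarrow> Ck k g \<Longrightarrow> Ck k (\<lambda>x. h (f x) (g x))"
proof (induction k arbitrary: f g)
  case 0
  then show ?case using bounded_bilinear.continuous_on[OF assms] by auto
next
  case (Suc k)
  note d = bounded_bilinear.FDERIV[OF assms Ck_Suc_has_derivative[OF Suc.prems(1)] Ck_Suc_has_derivative[OF Suc.prems(2)]]
  have "partial_deriv i (\<lambda>x. h (f x) (g x)) = (\<lambda>x. h (f x) (partial_deriv i g x) + h (partial_deriv i f x) (g x))" for i
    using partial_deriv_eqI[OF d] by (auto simp: partial_deriv_def)
  moreover have "(\<lambda>x. h (f x) (g x)) differentiable_on UNIV"
    using d by (auto simp: differentiable_on_def differentiable_def)
  moreover have "Ck k f" "Ck k g"
    using Suc.prems Ck_Suc_imp_Ck by blast+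
  moreover have "Ck k (partial_deriv i f)" "Ck k (partial_deriv i g)" for i
    using Suc.prems by auto
  ultimately show ?case using Suc.IH by (auto intro!: Ck_add)
qed

lemma Ck_bounded_linear:
  assumes "bounded_linear L"
  shows "Ck k f \<Longrightarrow> Ck k (\<lambda>x. L (f x))"
proof (induction k arbitrary: f)
  case 0
  then show ?case using assms by (auto intro: bounded_linear.continuous_on)
next
  case (Suc k)
  note d = bounded_linear.has_derivative[OF assms Ck_Suc_has_derivative[OF Suc.prems]]
  have "partial_deriv i (\<lambda>x. L (f x)) = (\<lambda>x. L (partial_deriv i f x))" for i
    using partial_deriv_eqI[OF d] by (auto simp: partial_deriv_def)
  moreover have "(\<lambda>x. L (f x)) differentiable_on UNIV"
    using d by (auto simp: differentiable_on_def differentiable_def)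
  ultimately show ?case using Suc by auto
qed

text \<open>The sequence \<open>b\<close> lists the successive derivatives of one function, so the
  induction runs over all its members at once: a partial derivative only shifts the index, up to the
  factor \<open>axis j 1 $ i\<close>, which is 0 or 1.\<close>

lemma Ck_coordinate:
  fixes b :: "nat \<Rightarrow> real \<Rightarrow> real"
  assumes "\<And>n t. (b n has_real_derivative b (Suc n) t) (at t)"
  shows "Ck k (\<lambda>x::real^'n::finite. b n (x $ i))"
proof (induction k arbitrary: n)
  case 0
  have "continuous_on UNIV (b n)"
    using assms by (meson DERIV_isCont continuous_at_imp_continuous_on)
  then show ?case
    by (auto intro!: continuous_on_compose2[of UNIV "b n"] continuous_intros)
next
  case (Suc k)
  have d: "((\<lambda>x. b n (x $ i)) has_derivative (\<lambda>h. h $ i * b (Suc n) (x $ i))) (at x)" for x :: "real^'n"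
  proof -
    have "(b n has_derivative (*) (b (Suc n) (x $ i))) (at (x $ i))"
      using assms by (simp add: has_field_derivative_def)
    from has_derivative_compose[OF bounded_linear_imp_has_derivative[OF bounded_linear_vec_nth] this]
    show ?thesis by (simp add: mult.commute)
  qed
  have "partial_deriv j (\<lambda>x. b n (x $ i)) = (\<lambda>x. axis j 1 $ i * b (Suc n) (x $ i))" for j
    using partial_deriv_eqI[OF d] by auto
  moreover have "(\<lambda>x::real^'n. b n (x $ i)) differentiable_on UNIV"
    using d by (auto simp: differentiable_on_def differentiable_def)
  moreover have "Ck k (\<lambda>x. axis j 1 $ i * b (Suc n) (x $ i))" for j
    by (rule Ck_bounded_linear[OF bounded_linear_mult_right Suc.IH])
  ultimately show ?case by auto
qed

text \<open>For \<open>q = 1\<close> this is the classical smooth function exp(-1/t) extended by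
  zero. The polynomial is there because derivatives create powers of 1/t: the family is closed under
  differentiation.\<close>

definition exp_cutoff :: "real poly \<Rightarrow> real \<Rightarrow> real" where
  "exp_cutoff q t = (if t > 0 then poly q (1 / t) * exp (- (1 / t)) else 0)"

lemma poly_times_exp_minus_tendsto_0:
  "((\<lambda>u. poly q u * exp (- u)) \<longlongrightarrow> (0::real)) at_top"
proof -
  have "((\<lambda>u. \<Sum>i\<le>degree q. coeff q i * (u ^ i / exp u)) \<longlongrightarrow> (\<Sum>i\<le>degree q. coeff q i * 0)) at_top"
    by (intro tendsto_sum tendsto_mult tendsto_const tendsto_power_div_exp_0)
  moreover have "(\<lambda>u. \<Sum>i\<le>degree q. coeff q i * (u ^ i / exp u)) = (\<lambda>u. poly q u * exp (- u))"
    unfolding poly_altdef sum_distrib_right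
    by (intro ext sum.cong refl) (simp add: exp_minus divide_inverse)
  ultimately show ?thesis by simp
qed

text \<open>With u = 1/t, the derivative of q(u) exp(-u) with respect to t is u^2 (q(u) - q'(u))
  exp(-u), and \<open>[:0, 0, 1:]\<close> is the polynomial u^2. At t = 0 the exponential decay
  beats every power of 1/t.\<close>

lemma exp_cutoff_has_derivative:
  "(exp_cutoff q has_real_derivative exp_cutoff ([:0, 0, 1:] * (q - pderiv q)) t) (at t)"
proof -
  consider "t > 0" | "t < 0" | "t = 0" by linarith
  then show ?thesis
  proof cases
    case 1
    have "((\<lambda>t. poly q (1 / t) * exp (- (1 / t))) has_real_derivative
       (poly (pderiv q) (1/t) * (- 1 / t^2) * exp (- (1/t)) + poly q (1/t) * (exp (- (1/t)) * (1 / t^2)))) (at t)"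
      using 1
      by (auto intro!: derivative_eq_intros DERIV_chain2[OF poly_DERIV] simp: power2_eq_square)
    moreover have "\<forall>\<^sub>F s in nhds t. exp_cutoff q s = poly q (1 / s) * exp (- (1 / s))"
      using eventually_nhds_in_open[of "{0<..}" t] 1
      by (auto simp: exp_cutoff_def elim!: eventually_mono)
    ultimately have "(exp_cutoff q has_real_derivative
       (poly (pderiv q) (1/t) * (- 1 / t^2) * exp (- (1/t)) + poly q (1/t) * (exp (- (1/t)) * (1 / t^2)))) (at t)"
      by (subst DERIV_cong_ev) auto
    moreover have "poly (pderiv q) (1/t) * (- 1 / t^2) * exp (- (1/t)) + poly q (1/t) * (exp (- (1/t)) * (1 / t^2))
      = exp_cutoff ([:0, 0, 1:] * (q - pderiv q)) t"
      using 1 by (simp add: exp_cutoff_def field_simps power2_eq_square)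
    ultimately show ?thesis by simp
  next
    case 2
    have "\<forall>\<^sub>F s in nhds t. exp_cutoff q s = 0"
      using eventually_nhds_in_open[of "{..<0}" t] 2
      by (auto simp: exp_cutoff_def elim!: eventually_mono)
    then have "(exp_cutoff q has_real_derivative 0) (at t)"
      by (subst DERIV_cong_ev[where g="\<lambda>_. 0"]) auto
    with 2 show ?thesis by (simp add: exp_cutoff_def)
  next
    case 3
    have l: "((\<lambda>h. exp_cutoff q h / h) \<longlongrightarrow> 0) (at_left 0)"
      by (rule tendsto_eventually) (auto simp: eventually_at_filter exp_cutoff_def)
    \<comment> \<open>For h = 1/u the quotient \<open>exp_cutoff q h / h\<close> is u q(u) exp(-u);
      \<open>pCons 0 q\<close> absorbs the extra factor u.\<close>
    have "((\<lambda>u. poly (pCons 0 q) u * exp (- u)) \<longlongrightarrow> 0) at_top"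
      by (rule poly_times_exp_minus_tendsto_0)
    then have "((\<lambda>u. exp_cutoff q (inverse u) / inverse u) \<longlongrightarrow> 0) at_top"
      by (rule Lim_transform_eventually)
         (use eventually_gt_at_top[of 0] in eventually_elim, simp add: exp_cutoff_def field_simps)
    then have r: "((\<lambda>h. exp_cutoff q h / h) \<longlongrightarrow> 0) (at_right 0)"
      by (simp add: filterlim_at_right_to_top)
    from l r have "((\<lambda>h. exp_cutoff q h / h) \<longlongrightarrow> 0) (at 0)"
      by (simp add: filterlim_at_split)
    with 3 show ?thesis
      by (simp add: has_field_derivative_iff exp_cutoff_def)
  qed
qed

lemma Ck_exp_cutoff:
  "Ck k (\<lambda>x::real^'n::finite. exp_cutoff q (c * x $ i + d))"
proof -
  define D :: "real poly \<Rightarrow> real poly" where "D q = [:0, 0, 1:] * (q - pderiv q)" for q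
  \<comment> \<open>The iterates of \<open>D\<close> produce the n-th derivative of the cutoff; the
    powers of \<open>c\<close> come from the affine inner function.\<close>
  define b where "b n t = c ^ n * exp_cutoff ((D ^^ n) q) (c * t + d)" for n t
  have "(b n has_real_derivative b (Suc n) t) (at t)" for n t
  proof -
    have "((\<lambda>t. exp_cutoff ((D ^^ n) q) (c * t + d)) has_real_derivative exp_cutoff ((D ^^ Suc n) q) (c * t + d) * c) (at t)"
      using exp_cutoff_has_derivative[of "(D ^^ n) q"]
      by (intro DERIV_chain2[where f="exp_cutoff ((D ^^ n) q)"]) (auto intro!: derivative_eq_intros simp: D_def)
    from DERIV_cmult[OF this, of "c^n"] show ?thesis
      by (simp add: b_def[abs_def] mult_ac)
  qed
  from Ck_coordinate[of b, OF this, of k 0 i] show ?thesis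
    by (simp add: b_def)
qed

section \<open>Supports and curls of test fields\<close>

lemma test_fields_Ck: "\<phi> \<in> test_fields \<Longrightarrow> Ck k \<phi>"
  unfolding test_fields_def by blast

lemma test_fields_supportE:
  assumes "\<phi> \<in> test_fields"
  obtains K where "compact K" "\<And>x. x \<notin> K \<Longrightarrow> \<phi> x = 0"
    "\<And>x i. x \<notin> K \<Longrightarrow> partial_deriv i \<phi> x = 0"
proof -
  obtain K where K: "compact K" and z: "\<And>x. x \<notin> K \<Longrightarrow> \<phi> x = 0"
    using assms closure_subset[of "{x. \<phi> x \<noteq> 0}"] unfolding test_fields_def by blast
  have "partial_deriv i \<phi> x = 0" if "x \<notin> K" for x i
  proof -
    have "((\<lambda>_. 0) has_derivative (\<lambda>_. 0)) (at x)" by simp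
    then have "(\<phi> has_derivative (\<lambda>_. 0)) (at x)"
      by (rule has_derivative_transform_within_open[of _ _ _ _ "- K"])
         (use that z K in \<open>auto simp: compact_imp_closed open_Compl\<close>)
    then show ?thesis by (simp add: partial_deriv_eqI)
  qed
  with K z show ?thesis by (rule that)
qed

text \<open>As a sum of fixed linear maps applied to partial derivatives, the curl inherits
  smoothness and support at once, and it can be integrated by parts one direction at a time.\<close>

lemma curl_eq_sum_cross:
  "curl F x = (\<Sum>j\<in>UNIV. cross3 (axis j 1) (partial_deriv j F x))"
  unfolding curl_def sum_3 vec_eq_iff forall_3
  by (simp add: cross3_def vector_3 axis_def)

lemma curl_test_fields:
  assumes "\<phi> \<in> test_fields"
  shows "curl \<phi> \<in> test_fields"
proof -
  have "Ck k (curl \<phi>)" for k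
  proof -
    have "Ck k (partial_deriv j \<phi>)" for j
      using test_fields_Ck[OF assms, of "Suc k"] by simp
    moreover have l: "bounded_linear (cross3 a)" for a
      unfolding linear_conv_bounded_linear[symmetric]
      by (rule linearI) (simp_all add: cross_add_right cross_mult_right)
    ultimately have "Ck k (\<lambda>x. cross3 (axis j 1) (partial_deriv j \<phi> x))" for j
      using Ck_bounded_linear[OF l[of "axis j 1"], of k "partial_deriv j \<phi>"] by simp
    then show ?thesis
      unfolding curl_eq_sum_cross[abs_def] sum_3 by (intro Ck_add)
  qed
  moreover have "compact (closure {x. curl \<phi> x \<noteq> 0})"
  proof -
    obtain K where K: "compact K" "\<And>x i. x \<notin> K \<Longrightarrow> partial_deriv i \<phi> x = 0"
      using assms by (rule test_fields_supportE) blast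
    have "{x. curl \<phi> x \<noteq> 0} \<subseteq> K"
      using K(2) by (force simp: curl_eq_sum_cross)
    then have "bounded {x. curl \<phi> x \<noteq> 0}"
      using K(1) bounded_subset compact_imp_bounded by blast
    then show ?thesis by (simp add: compact_closure)
  qed
  ultimately show ?thesis unfolding test_fields_def by blast
qed

section \<open>Gradients of radial functions are orthogonal to curls\<close>

text \<open>By translation invariance every difference quotient of \<open>F\<close> in direction
  \<open>v\<close> has integral 0, and dominated convergence passes to the derivative.\<close>

lemma integral_directional_derivative_eq_0:
  fixes F :: "'a::euclidean_space \<Rightarrow> real"
  assumes d: "\<And>x. (F has_derivative F' x) (at x)"
    and c: "continuous_on UNIV (\<lambda>x. F' x v)"
    and K: "compact K" "\<And>x. x \<notin> K \<Longrightarrow> F x = 0" "\<And>x. x \<notin> K \<Longrightarrow> F' x v = 0"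
  shows "integrable lborel (\<lambda>x. F' x v)" "(\<integral>x. F' x v \<partial>lborel) = 0"
proof -
  have int: "integrable lborel G"
    if "continuous_on UNIV G" "\<And>x. x \<notin> K \<Longrightarrow> G x = 0" for G :: "'a \<Rightarrow> real"
  proof -
    have "integrable lborel (\<lambda>x. indicator K x *\<^sub>R G x)"
      using K(1) that(1) continuous_on_subset by (intro borel_integrable_compact) auto
    also have "(\<lambda>x. indicator K x *\<^sub>R G x) = G"
      using that(2) by (fastforce simp: indicator_def)
    finally show ?thesis .
  qed
  show "integrable lborel (\<lambda>x. F' x v)"
    using int c K by blast
  have cF: "continuous_on UNIV F"
    using d by (meson continuous_at_imp_continuous_on has_derivative_continuous)
  then have iF: "integrable lborel F"
    using int K by blast
  have [measurable]: "F \<in> borel_measurable borel" "(\<lambda>x. F' x v) \<in> borel_measurable borel"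
    using cF c by (auto intro: borel_measurable_continuous_onI)
  obtain R where R: "\<And>x. x \<in> K \<Longrightarrow> norm x \<le> R"
    using K(1) compact_imp_bounded bounded_iff by metis
  obtain B where B: "\<And>x. \<bar>F' x v\<bar> \<le> B"
  proof -
    have "compact ((\<lambda>x. F' x v) ` K)"
      using K(1) c compact_continuous_image continuous_on_subset by blast
    then obtain B where "\<And>y. y \<in> (\<lambda>x. F' x v) ` K \<Longrightarrow> norm y \<le> B"
      using compact_imp_bounded bounded_iff by metis
    then have "\<bar>F' x v\<bar> \<le> max B 0" for x
      using K(3)[of x] by (cases "x \<in> K") fastforce+
    then show ?thesis by (rule that)
  qed
  have line: "((\<lambda>t. F (x + t *\<^sub>R v)) has_real_derivative F' (x + t *\<^sub>R v) v) (at t)" for x t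
  proof -
    have "((\<lambda>t. x + t *\<^sub>R v) has_derivative (\<lambda>h. h *\<^sub>R v)) (at t)"
      by (auto intro!: derivative_eq_intros)
    from has_derivative_compose[OF this d]
    have "((\<lambda>t. F (x + t *\<^sub>R v)) has_derivative (\<lambda>h. F' (x + t *\<^sub>R v) (h *\<^sub>R v))) (at t)" .
    moreover have "F' (x + t *\<^sub>R v) (h *\<^sub>R v) = F' (x + t *\<^sub>R v) v * h" for h
      using linear_cmul[OF has_derivative_linear[OF d]] by (simp add: mult.commute)
    ultimately show ?thesis
      by (simp add: has_field_derivative_def)
  qed
  define q where "q n x = real (Suc n) * (F (x + (1 / real (Suc n)) *\<^sub>R v) - F x)" for n x
  have meas[measurable]: "q n \<in> borel_measurable borel" for n
    unfolding q_def by measurable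
  have zero: "(\<integral>x. q n x \<partial>lborel) = 0" for n
  proof -
    let ?c = "(1 / real (Suc n)) *\<^sub>R v"
    have 1: "(\<integral>x. F (?c + x) \<partial>lborel) = (\<integral>x. F x \<partial>lborel)"
      by (subst (2) lborel_distr_plus[of ?c, symmetric]) (simp add: integral_distr)
    have 2: "integrable lborel (\<lambda>x. F (?c + x))"
      using iF by (subst (asm) lborel_distr_plus[of ?c, symmetric]) (simp add: integrable_distr_eq)
    show ?thesis
      using 1 2 iF by (simp add: q_def add.commute)
  qed
  have "(\<lambda>n. \<integral>x. q n x \<partial>lborel) \<longlonglongrightarrow> (\<integral>x. F' x v \<partial>lborel)"
  \<comment> \<open>Shifts of length at most \<open>norm v\<close> keep the quotients zero outside
    the ball of radius \<open>R + norm v\<close>; inside it, the mean value theorem along the line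
    bounds them by \<open>B\<close>.\<close>
  proof (rule integral_dominated_convergence[where w="\<lambda>x. B * indicator (cball 0 (R + norm v)) x"])
    show "integrable lborel (\<lambda>x. B * indicator (cball 0 (R + norm v)) x :: real)"
      by (intro integrable_mult_right integrable_real_indicator) (use emeasure_compact_finite[OF compact_cball, of 0 "R + norm v"] in auto)
    have "(\<lambda>n. q n x) \<longlonglongrightarrow> F' x v" for x
    proof -
      have "((\<lambda>t. (F (x + t *\<^sub>R v) - F x) / t) \<longlongrightarrow> F' x v) (at 0)"
        using line[of x 0] by (simp add: has_field_derivative_iff)
      moreover have "filterlim (\<lambda>n. 1 / real (Suc n)) (at 0) sequentially"
        using LIMSEQ_inverse_real_of_nat by (simp add: filterlim_at inverse_eq_divide)
      ultimately have "(\<lambda>n. (F (x + (1 / real (Suc n)) *\<^sub>R v) - F x) / (1 / real (Suc n))) \<longlonglongrightarrow> F' x v"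
        by (rule filterlim_compose)
      then show ?thesis by (simp add: q_def[abs_def] mult.commute)
    qed
    then show "AE x in lborel. (\<lambda>n. q n x) \<longlonglongrightarrow> F' x v" by simp
    have "norm (q n x) \<le> B * indicator (cball 0 (R + norm v)) x" for n x
    proof (cases "x \<in> cball 0 (R + norm v)")
      case True
      let ?c = "1 / real (Suc n)"
      obtain z where "F (x + ?c *\<^sub>R v) - F (x + 0 *\<^sub>R v) = (?c - 0) * F' (x + z *\<^sub>R v) v"
        using MVT2[of 0 ?c "\<lambda>t. F (x + t *\<^sub>R v)" "\<lambda>t. F' (x + t *\<^sub>R v) v"] line by auto
      then have "q n x = F' (x + z *\<^sub>R v) v"
        by (simp add: q_def)
      then show ?thesis using True B by simp
    next
      case False
      have "norm ((1 / real (Suc n)) *\<^sub>R v) \<le> norm v"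
        by (simp add: divide_le_eq mult_le_cancel_left1)
      then have "norm (x + (1 / real (Suc n)) *\<^sub>R v) > R" "norm x > R"
        using False norm_triangle_ineq4[of "x + (1 / real (Suc n)) *\<^sub>R v" "(1 / real (Suc n)) *\<^sub>R v"]
          norm_ge_zero[of v] by (auto simp del: norm_ge_zero)
      then have "F (x + (1 / real (Suc n)) *\<^sub>R v) = 0" "F x = 0"
        using R K(2) by (meson not_le)+
      with False show ?thesis by (simp add: q_def)
    qed
    then show "AE x in lborel. norm (q n x) \<le> B * indicator (cball 0 (R + norm v)) x" for n by simp
  qed auto
  with zero show "(\<integral>x. F' x v \<partial>lborel) = 0"
    by (simp add: LIMSEQ_const_iff)
qed

text \<open>Cyclic invariance of the scalar triple product moves the cross product from the
  derivative onto \<open>x\<close>.\<close>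

lemma inner_curl_eq_sum:
  "x \<bullet> curl \<phi> x = (\<Sum>j\<in>UNIV. cross3 x (axis j 1) \<bullet> partial_deriv j \<phi> x)"
  unfolding curl_eq_sum_cross inner_sum_right
  by (intro sum.cong refl) (simp add: cross3_def inner_vec_def sum_3 algebra_simps)

text \<open>The integrand is the divergence of the compactly supported field g(|x|^2) \<phi>
  \<times> x, because g(|x|^2) x is curl-free and so no term without a derivative of \<phi>
  survives.\<close>

lemma integral_smooth_radial_inner_curl:
  assumes \<phi>: "\<phi> \<in> test_fields"
    and g: "\<And>t. (g has_real_derivative g' t) (at t)" "continuous_on UNIV g'"
  shows "(\<integral>x. g (x \<bullet> x) * (x \<bullet> curl \<phi> x) \<partial>lborel) = 0"
proof -
  obtain K where K: "compact K" "\<And>x. x \<notin> K \<Longrightarrow> \<phi> x = 0"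
    "\<And>x i. x \<notin> K \<Longrightarrow> partial_deriv i \<phi> x = 0"
    using \<phi> by (rule test_fields_supportE) blast
  have cont: "continuous_on UNIV \<phi>" "continuous_on UNIV (partial_deriv i \<phi>)" for i
    using test_fields_Ck[OF \<phi>, of 0] test_fields_Ck[OF \<phi>, of 1] by auto
  define e where "e j = (axis j 1 :: real^3)" for j
  define F' where "F' j x h = g (x \<bullet> x) * ((cross3 h (e j)) \<bullet> \<phi> x + cross3 x (e j) \<bullet> frechet_derivative \<phi> (at x) h)
     + g' (x \<bullet> x) * (2 * (x \<bullet> h)) * (cross3 x (e j) \<bullet> \<phi> x)" for j x h
  have d: "((\<lambda>x. g (x \<bullet> x) * (cross3 x (e j) \<bullet> \<phi> x)) has_derivative F' j x) (at x)" for j x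
  proof -
    have 1: "((\<lambda>x. g (x \<bullet> x)) has_derivative (\<lambda>h. g' (x \<bullet> x) * (2 * (x \<bullet> h)))) (at x)"
    proof -
      have "(g has_derivative (*) (g' (x \<bullet> x))) (at (x \<bullet> x))"
        using g(1) by (simp add: has_field_derivative_def)
      moreover have "((\<lambda>x. x \<bullet> x) has_derivative (\<lambda>h. 2 * (x \<bullet> h))) (at x)"
        by (auto intro!: derivative_eq_intros simp: inner_commute)
      ultimately show ?thesis by (rule has_derivative_compose[rotated])
    qed
    have "linear (\<lambda>x. cross3 x (e j))"
      by (rule linearI) (simp_all add: cross_add_left cross_mult_left)
    then have 2: "((\<lambda>x. cross3 x (e j)) has_derivative (\<lambda>h. cross3 h (e j))) (at x)"
      by (simp add: linear_conv_bounded_linear bounded_linear_imp_has_derivative)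
    have 3: "(\<phi> has_derivative frechet_derivative \<phi> (at x)) (at x)"
      using Ck_Suc_has_derivative test_fields_Ck[OF \<phi>] by blast
    show ?thesis
      unfolding F'_def
      by (rule has_derivative_eq_rhs[OF has_derivative_mult[OF 1 has_derivative_inner[OF 2 3]]])
         (auto simp: algebra_simps)
  qed
  have F'e: "F' j x (e j) = g (x \<bullet> x) * (cross3 x (e j) \<bullet> partial_deriv j \<phi> x)
     + g' (x \<bullet> x) * (2 * (x \<bullet> e j)) * (cross3 x (e j) \<bullet> \<phi> x)" for j x
    by (simp add: F'_def partial_deriv_def e_def)
  have contg: "continuous_on UNIV g"
    using g(1) by (meson DERIV_isCont continuous_at_imp_continuous_on)
  have cF': "continuous_on UNIV (\<lambda>x. F' j x (e j))" for j
    unfolding F'e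
    by (intro continuous_intros cont continuous_on_cross
        continuous_on_compose2[OF contg] continuous_on_compose2[OF g(2)]) auto
  have I: "integrable lborel (\<lambda>x. F' j x (e j))" "(\<integral>x. F' j x (e j) \<partial>lborel) = 0" for j
    by (rule integral_directional_derivative_eq_0[OF d cF' K(1)]; simp add: K F'e)+
  \<comment> \<open>Summed over j, the derivative of g contributes a multiple of (x \<times> x)
    \<bullet> \<phi>, which is 0.\<close>
  have "(\<Sum>j\<in>UNIV. (x \<bullet> e j) * (cross3 x (e j) \<bullet> \<phi> x)) = 0" for x
    by (simp add: sum_3 e_def inner_axis cross3_def inner_vec_def axis_def algebra_simps)
  then have "(\<Sum>j\<in>UNIV. g' (x \<bullet> x) * (2 * (x \<bullet> e j)) * (cross3 x (e j) \<bullet> \<phi> x)) = 0" for x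
    by (simp add: mult.assoc sum_distrib_left[symmetric])
  then have "g (x \<bullet> x) * (x \<bullet> curl \<phi> x) = (\<Sum>j\<in>UNIV. F' j x (e j))" for x
    unfolding F'e sum.distrib inner_curl_eq_sum sum_distrib_left by (simp add: e_def)
  then show ?thesis
    using I by (simp add: Bochner_Integration.integral_sum)
qed

text \<open>The positive and negative parts of \<open>w\<close> have images under
  \<open>\<tau>\<close> that are finite measures agreeing on all half-lines, hence equal. Equality
  of measures then covers every Borel weight \<open>k\<close> with an integrable product, bounded or
  not.\<close>

lemma finite_signed_measure_pushforward_eq_0:
  fixes w \<tau> :: "'a \<Rightarrow> real"
  assumes w: "integrable M w" and \<tau>[measurable]: "\<tau> \<in> borel_measurable M"
    and zero: "\<And>a. (\<integral>x. indicator {a<..} (\<tau> x) * w x \<partial>M) = 0"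
    and k[measurable]: "k \<in> borel_measurable borel"
    and int: "integrable M (\<lambda>x. k (\<tau> x) * w x)"
  shows "(\<integral>x. k (\<tau> x) * w x \<partial>M) = 0"
proof -
  have [measurable]: "w \<in> borel_measurable M" using w by auto
  \<comment> \<open>\<open>\<mu> 1\<close> and \<open>\<mu> (-1)\<close> are the images of the
    positive and of the negative part of \<open>w\<close>.\<close>
  define \<mu> where "\<mu> c = distr (density M (\<lambda>x. ennreal (max 0 (c * w x)))) borel \<tau>" for c
  have wp: "integrable M (\<lambda>x. max 0 (c * w x))" for c
    using w by auto
  have em: "emeasure (\<mu> c) {a<..} = ennreal (\<integral>x. indicator {a<..} (\<tau> x) * max 0 (c * w x) \<partial>M)" for c a
  proof -
    have "emeasure (\<mu> c) {a<..} = (\<integral>\<^sup>+x. ennreal (max 0 (c * w x)) * indicator (\<tau> -` {a<..} \<inter> space M) x \<partial>M)"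
      by (simp add: \<mu>_def emeasure_distr emeasure_density)
    also have "\<dots> = (\<integral>\<^sup>+x. ennreal (indicator {a<..} (\<tau> x) * max 0 (c * w x)) \<partial>M)"
      by (intro nn_integral_cong) (auto simp: indicator_def)
    also have "\<dots> = ennreal (\<integral>x. indicator {a<..} (\<tau> x) * max 0 (c * w x) \<partial>M)"
      by (intro nn_integral_eq_integral Bochner_Integration.integrable_bound[OF wp[of c]])
         (auto simp: indicator_def)
    finally show ?thesis .
  qed
  have "\<mu> 1 = \<mu> (-1)"
  proof (rule measure_eqI_lessThan)
    fix a
    have i: "integrable M (\<lambda>x. indicator {a<..} (\<tau> x) * max 0 (c * w x))" for c
      by (intro Bochner_Integration.integrable_bound[OF wp[of c]]) (auto simp: indicator_def)
    have "(\<integral>x. indicator {a<..} (\<tau> x) * max 0 (1 * w x) \<partial>M) - (\<integral>x. indicator {a<..} (\<tau> x) * max 0 (- 1 * w x) \<partial>M)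
      = (\<integral>x. indicator {a<..} (\<tau> x) * w x \<partial>M)"
      by (subst Bochner_Integration.integral_diff[OF i i, symmetric])
         (auto intro!: Bochner_Integration.integral_cong simp: max_def indicator_def)
    with zero[of a] show "emeasure (\<mu> 1) {a<..} = emeasure (\<mu> (-1)) {a<..}"
      by (simp add: em)
    show "emeasure (\<mu> 1) {a<..} < \<infinity>"
      by (simp add: em)
  qed (auto simp: \<mu>_def)
  moreover have "(\<integral>t. k t \<partial>\<mu> c) = (\<integral>x. k (\<tau> x) * max 0 (c * w x) \<partial>M)" for c
    by (simp add: \<mu>_def integral_distr integral_density mult.commute)
  ultimately have "(\<integral>x. k (\<tau> x) * max 0 (1 * w x) \<partial>M) = (\<integral>x. k (\<tau> x) * max 0 (-1 * w x) \<partial>M)"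
    by metis
  then have eq: "(\<integral>x. k (\<tau> x) * max 0 (w x) \<partial>M) = (\<integral>x. k (\<tau> x) * max 0 (- w x) \<partial>M)"
    by simp
  have "integrable M (\<lambda>x. k (\<tau> x) * max 0 (c * w x))" if "\<bar>c\<bar> = 1" for c
  proof (rule Bochner_Integration.integrable_bound[OF int])
    have "\<bar>c * w x\<bar> = \<bar>w x\<bar>" for x
      using that by (simp add: abs_mult)
    then have "max 0 (c * w x) \<le> \<bar>w x\<bar>" for x
      by (metis abs_ge_self abs_ge_zero max.bounded_iff)
    then show "AE x in M. norm (k (\<tau> x) * max 0 (c * w x)) \<le> norm (k (\<tau> x) * w x)"
      by (intro AE_I2) (simp add: abs_mult mult_left_mono)
  qed simp
  from this[of 1] this[of "-1"] eq
  have "(\<integral>x. k (\<tau> x) * max 0 (1 * w x) - k (\<tau> x) * max 0 (-1 * w x) \<partial>M) = 0"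
    by simp
  moreover have "k (\<tau> x) * max 0 (1 * w x) - k (\<tau> x) * max 0 (-1 * w x) = k (\<tau> x) * w x" for x
    by (simp add: max_def)
  ultimately show ?thesis by simp
qed

lemma test_fields_continuous_measurable:
  assumes "\<phi> \<in> test_fields"
  shows "continuous_on UNIV \<phi>" "\<phi> \<in> borel_measurable borel"
  using test_fields_Ck[OF assms, of 0] by (auto intro: borel_measurable_continuous_onI)

lemma test_fields_boundedE:
  assumes "\<phi> \<in> test_fields"
  obtains K B where "compact K" "\<And>x. norm (\<phi> x) \<le> B * indicator K x" "B \<ge> 0"
proof -
  obtain K where K: "compact K" "\<And>x. x \<notin> K \<Longrightarrow> \<phi> x = 0"
    using assms by (rule test_fields_supportE) blast
  have "compact (\<phi> ` K)"
    using K(1) test_fields_continuous_measurable(1)[OF assms] compact_continuous_image continuous_on_subset by blast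
  then obtain B where B: "\<And>y. y \<in> \<phi> ` K \<Longrightarrow> norm y \<le> B"
    using compact_imp_bounded bounded_iff by metis
  have "norm (\<phi> x) \<le> max B 0 * indicator K x" for x
    using B K(2)[of x] by (cases "x \<in> K") (fastforce simp: le_max_iff_disj)+
  with K(1) show ?thesis by (rule that) simp
qed

text \<open>The shift by \<open>sqrt n\<close> makes the limit \<open>0\<close> also at the jump \<open>t = a\<close>.\<close>

lemma logistic_tendsto_indicator:
  "(\<lambda>n. 1 / (1 + exp (sqrt (real n) - real n * (t - a)))) \<longlonglongrightarrow> indicator {a<..} t"
proof (cases "t > a")
  case True
  have "filterlim (\<lambda>n. sqrt (real n) - real n * (t - a)) at_bot sequentially"
    using True by real_asymp
  then have "(\<lambda>n. exp (sqrt (real n) - real n * (t - a))) \<longlonglongrightarrow> 0"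
    by (rule filterlim_compose[OF exp_at_bot])
  then have "(\<lambda>n. 1 / (1 + exp (sqrt (real n) - real n * (t - a)))) \<longlonglongrightarrow> 1 / (1 + 0)"
    by (intro tendsto_intros) auto
  with True show ?thesis by simp
next
  case False
  have *: "\<bar>1 / (1 + exp (sqrt (real n) - real n * (t - a)))\<bar> \<le> exp (- sqrt (real n))" for n
  proof -
    have "real n * (t - a) \<le> 0"
      using False by (simp add: mult_nonneg_nonpos)
    then have "exp (sqrt (real n)) \<le> 1 + exp (sqrt (real n) - real n * (t - a))"
      by (intro add_increasing) auto
    then show ?thesis
      by (simp add: exp_minus inverse_eq_divide frac_le abs_of_pos add_pos_pos)
  qed
  have "(\<lambda>n. exp (- sqrt (real n))) \<longlonglongrightarrow> 0"
    by real_asymp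
  then have "(\<lambda>n. 1 / (1 + exp (sqrt (real n) - real n * (t - a)))) \<longlonglongrightarrow> 0"
    by (rule Lim_null_comparison[rotated]) (use * in auto)
  with False show ?thesis by simp
qed

text \<open>Logistic functions of |x|^2 supply the smooth weights, and their limits are the
  half-line indicators that determine a finite measure on the line.\<close>

lemma integral_radial_inner_curl_eq_0:
  fixes f :: "real \<Rightarrow> real"
  assumes \<phi>: "\<phi> \<in> test_fields" and [measurable]: "f \<in> borel_measurable borel"
    and int: "integrable lborel (\<lambda>x. (f (norm x) *\<^sub>R (x /\<^sub>R norm x)) \<bullet> curl \<phi> x)"
  shows "(\<integral>x. (f (norm x) *\<^sub>R (x /\<^sub>R norm x)) \<bullet> curl \<phi> x \<partial>lborel) = 0"
proof -
  have c[measurable]: "curl \<phi> \<in> borel_measurable borel"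
    using test_fields_continuous_measurable curl_test_fields[OF \<phi>] by auto
  obtain K B where K: "compact K" "\<And>x. norm (curl \<phi> x) \<le> B * indicator K x" "B \<ge> 0"
    using curl_test_fields[OF \<phi>] by (rule test_fields_boundedE) blast
  define w where "w x = x \<bullet> curl \<phi> x" for x
  have [measurable]: "w \<in> borel_measurable borel"
    unfolding w_def by measurable
  obtain R where R: "\<And>x. x \<in> K \<Longrightarrow> norm x \<le> R"
    using K(1) compact_imp_bounded bounded_iff by metis
  have "integrable lborel (\<lambda>x. R * B * indicator K x)"
    using emeasure_compact_finite[OF K(1)] borel_compact[OF K(1)] by simp
  moreover have wK: "norm (w x) \<le> R * B * indicator K x" for x
  proof -
    have "norm (w x) \<le> norm x * norm (curl \<phi> x)"
      unfolding w_def by (simp add: Cauchy_Schwarz_ineq2)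
    also have "\<dots> \<le> norm x * (B * indicator K x)"
      by (intro mult_left_mono K) auto
    also have "\<dots> \<le> R * B * indicator K x"
      using R[of x] K(3) by (auto simp: indicator_def mult_right_mono)
    finally show ?thesis .
  qed
  ultimately have w: "integrable lborel w"
    by (intro Bochner_Integration.integrable_bound[of _ "\<lambda>x. R * B * indicator K x" w] AE_I2)
       (auto intro: order_trans[OF _ abs_ge_self])
  have zero: "(\<integral>x. indicator {a<..} (x \<bullet> x) * w x \<partial>lborel) = 0" for a
  proof -
    define g where "g n t = 1 / (1 + exp (sqrt (real n) - real n * (t - a)))" for n t
    have dom: "0 < g n t" "g n t \<le> 1" for n t
      by (auto simp: g_def add_pos_pos)
    have [measurable]: "g n \<in> borel_measurable borel" for n
      unfolding g_def by measurable
    have "(\<integral>x. g n (x \<bullet> x) * w x \<partial>lborel) = 0" for n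
      unfolding w_def
    proof (rule integral_smooth_radial_inner_curl[OF \<phi>])
      let ?E = "\<lambda>t. exp (sqrt (real n) - real n * (t - a))"
      have nz: "1 + ?E t \<noteq> 0" for t
        using exp_gt_zero[of "sqrt (real n) - real n * (t - a)"] by linarith
      show "(g n has_real_derivative (real n * ?E t / (1 + ?E t)\<^sup>2)) (at t)" for t
        unfolding g_def using nz by (auto intro!: derivative_eq_intros simp: power2_eq_square)
      show "continuous_on UNIV (\<lambda>t. real n * ?E t / (1 + ?E t)\<^sup>2)"
        using nz by (auto intro!: continuous_intros)
    qed
    moreover have "(\<lambda>n. \<integral>x. g n (x \<bullet> x) * w x \<partial>lborel) \<longlonglongrightarrow> (\<integral>x. indicator {a<..} (x \<bullet> x) * w x \<partial>lborel)"
    proof (rule integral_dominated_convergence[where w="\<lambda>x. norm (w x)"])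
      show "AE x in lborel. (\<lambda>n. g n (x \<bullet> x) * w x) \<longlonglongrightarrow> indicator {a<..} (x \<bullet> x) * w x"
        unfolding g_def by (intro AE_I2 tendsto_mult logistic_tendsto_indicator tendsto_const)
      show "AE x in lborel. norm (g n (x \<bullet> x) * w x) \<le> norm (w x)" for n
        using dom(1)[of n] dom(2)[of n] by (intro AE_I2) (simp add: abs_mult mult_left_le_one_le less_imp_le)
    qed (use w in auto)
    ultimately show ?thesis by (simp add: LIMSEQ_const_iff)
  qed
  \<comment> \<open>The profile and the factor 1/|x| merge into one Borel function of |x|^2, which
    may be unbounded near 0.\<close>
  have *: "(f (norm x) *\<^sub>R (x /\<^sub>R norm x)) \<bullet> curl \<phi> x = (f (sqrt (x \<bullet> x)) / sqrt (x \<bullet> x)) * w x" for x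
    by (simp add: norm_eq_sqrt_inner w_def divide_inverse)
  show ?thesis
    unfolding *
    by (rule finite_signed_measure_pushforward_eq_0[OF w, of "\<lambda>x. x \<bullet> x" "\<lambda>t. f (sqrt t) / sqrt t"])
       (use zero int[unfolded *] in auto)
qed

section \<open>The fundamental lemma of the calculus of variations\<close>

lemma indicator_box_times_measurable:
  fixes u :: "'a::euclidean_space \<Rightarrow> real"
  assumes "u \<in> borel_measurable lebesgue"
  shows "(\<lambda>x. indicator (box a b) x * u x) \<in> borel_measurable lebesgue"
  by (intro borel_measurable_times borel_measurable_indicator assms) auto

text \<open>Open boxes form an intersection-stable generator of the Borel sets, so the measures
  whose densities are the positive and negative parts of the function coincide; densities are unique
  up to null sets.\<close>

lemma AE_eq_0_if_box_integrals_eq_0: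
  fixes u :: "'a::euclidean_space \<Rightarrow> real"
  assumes meas: "u \<in> borel_measurable lebesgue"
    and int: "\<And>a b. set_integrable lebesgue (cbox a b) u"
    and zero: "\<And>a b. (\<integral>x. indicator (box a b) x * u x \<partial>lebesgue) = 0"
  shows "AE x in lebesgue. u x = 0"
proof -
  \<comment> \<open>Measures on the Borel sets need a Borel density, so \<open>u\<close> is replaced
    by a Borel function that equals it almost everywhere.\<close>
  obtain v where v[measurable]: "v \<in> borel_measurable lborel" and uv: "AE x in lborel. u x = v x"
    using completion_ex_borel_measurable_real[OF meas] by auto
  have vm: "v \<in> borel_measurable lebesgue"
    using v by (rule measurable_completion)
  note ind = indicator_box_times_measurable[OF meas] indicator_box_times_measurable[OF vm]
  have uv': "AE x in lebesgue. u x = v x"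
    using uv by (rule AE_completion)
  \<comment> \<open>\<open>ennreal\<close> sends negative numbers to 0, so \<open>c = 1\<close> and
    \<open>c = -1\<close> give the positive and the negative part of \<open>v\<close> as
    densities.\<close>
  define \<mu> where "\<mu> c = density lborel (\<lambda>x. ennreal (c * v x))" for c :: real
  have ib: "integrable lborel (\<lambda>x. indicator (box a b) x * v x)" for a b
  proof -
    have "set_integrable lebesgue (box a b) u"
      by (rule set_integrable_subset[OF int[of a b]]) (auto simp: box_subset_cbox)
    moreover have "integrable lebesgue (\<lambda>x. indicator (box a b) x * v x) \<longleftrightarrow> integrable lebesgue (\<lambda>x. indicator (box a b) x * u x)"
      by (intro integrable_cong_AE ind) (use uv' in force)
    moreover have "integrable lebesgue (\<lambda>x. indicator (box a b) x * v x) \<longleftrightarrow> integrable lborel (\<lambda>x. indicator (box a b) x * v x)"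
      by (rule integrable_completion) measurable
    ultimately show ?thesis
      by (simp add: set_integrable_def)
  qed
  have zb: "(\<integral>x. indicator (box a b) x * v x \<partial>lborel) = 0" for a b
  proof -
    have "(\<integral>x. indicator (box a b) x * v x \<partial>lebesgue) = (\<integral>x. indicator (box a b) x * u x \<partial>lebesgue)"
      by (intro integral_cong_AE ind) (use uv' in force)
    moreover have "(\<integral>x. indicator (box a b) x * v x \<partial>lebesgue) = (\<integral>x. indicator (box a b) x * v x \<partial>lborel)"
      by (rule integral_completion) measurable
    ultimately show ?thesis using zero by simp
  qed
  have ic: "integrable lborel (\<lambda>x. indicator (box a b) x * max 0 (c * v x))" for a b and c :: real
    by (rule Bochner_Integration.integrable_bound[OF integrable_mult_right[OF ib[of a b], of c]])
       (auto simp: indicator_def)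
  have em: "emeasure (\<mu> c) (box a b) = ennreal (\<integral>x. indicator (box a b) x * max 0 (c * v x) \<partial>lborel)" for c a b
  proof -
    have "emeasure (\<mu> c) (box a b) = (\<integral>\<^sup>+x. ennreal (indicator (box a b) x * max 0 (c * v x)) \<partial>lborel)"
      unfolding \<mu>_def
      by (subst emeasure_density) (auto intro!: nn_integral_cong simp: indicator_def max_def ennreal_neg)
    also have "\<dots> = ennreal (\<integral>x. indicator (box a b) x * max 0 (c * v x) \<partial>lborel)"
      by (rule nn_integral_eq_integral[OF ic]) auto
    finally show ?thesis .
  qed
  have "\<mu> 1 = \<mu> (-1)"
  proof (rule measure_eqI_generator_eq)
    let ?E = "range (\<lambda>(a, b). box a b::'a set)"
    show "Int_stable ?E"
      by (auto simp: Int_stable_def box_Int_box)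
    show "?E \<subseteq> Pow UNIV" "sets (\<mu> 1) = sigma_sets UNIV ?E" "sets (\<mu> (-1)) = sigma_sets UNIV ?E"
      by (simp_all add: borel_eq_box \<mu>_def)
    let ?A = "\<lambda>n::nat. box (- (real n *\<^sub>R One)) (real n *\<^sub>R One) :: 'a set"
    show "range ?A \<subseteq> ?E" "(\<Union>i. ?A i) = UNIV"
      unfolding UN_box_eq_UNIV by auto
    show "emeasure (\<mu> 1) (?A i) \<noteq> \<infinity>" for i
      by (simp add: em)
    show "emeasure (\<mu> 1) X = emeasure (\<mu> (-1)) X" if "X \<in> ?E" for X
    proof -
      obtain a b where X: "X = box a b" using \<open>X \<in> ?E\<close> by auto
      have "(\<integral>x. indicator (box a b) x * max 0 (1 * v x) \<partial>lborel) - (\<integral>x. indicator (box a b) x * max 0 (- 1 * v x) \<partial>lborel)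
        = (\<integral>x. indicator (box a b) x * v x \<partial>lborel)"
        by (subst Bochner_Integration.integral_diff[OF ic ic, symmetric])
           (auto intro!: Bochner_Integration.integral_cong simp: max_def indicator_def)
      then show ?thesis
        unfolding X by (simp add: em zb)
    qed
  qed
  then have "AE x in lborel. ennreal (1 * v x) = ennreal (- 1 * v x)"
    unfolding \<mu>_def by (intro sigma_finite_measure.density_unique[OF sigma_finite_lborel]) auto
  \<comment> \<open>One of the two truncated values is always 0, so their equality forces
    \<open>v x = 0\<close>.\<close>
  then have "AE x in lborel. v x = 0"
  proof eventually_elim
    case (elim x)
    then show ?case
      by (cases "v x \<ge> 0") (auto simp: ennreal_neg ennreal_eq_0_iff)
  qed
  with uv have "AE x in lborel. u x = 0" by eventually_elim simp
  then show ?thesis by (rule AE_completion)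
qed

section \<open>Smooth bumps on boxes\<close>

lemma Ck_const: "Ck k (\<lambda>_::real^'n::finite. c)"
proof (induction k arbitrary: c)
  case (Suc k)
  have "partial_deriv i (\<lambda>_::real^'n. c) = (\<lambda>_. 0)" for i :: 'n
    using partial_deriv_eqI[OF has_derivative_const] by auto
  with Suc show ?case by auto
qed auto

lemma Ck_prod:
  fixes f :: "'i \<Rightarrow> real^'n::finite \<Rightarrow> real"
  assumes "\<And>i. i \<in> I \<Longrightarrow> Ck k (f i)"
  shows "Ck k (\<lambda>x. \<Prod>i\<in>I. f i x)"
  using assms
proof (induction I rule: infinite_finite_induct)
  case (insert i I)
  then have "Ck k (\<lambda>x. f i x * (\<Prod>i\<in>I. f i x))"
    by (intro Ck_bilinear[OF bounded_bilinear_mult]) auto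
  with insert show ?case by simp
qed (auto intro: Ck_const)

text \<open>Each factor is the smooth cutoff of \<open>n\<close> times the signed distance to a
  face. Stretching by \<open>n\<close> takes the place of a normalisation: exp(-1/(n t)) tends to 1
  for every t > 0, while the value off the open box stays 0.\<close>

definition box_bump :: "nat \<Rightarrow> real^'n \<Rightarrow> real^'n \<Rightarrow> real^'n::finite \<Rightarrow> real" where
  "box_bump n a b x = (\<Prod>i\<in>UNIV. exp_cutoff 1 (real n * (x $ i - a $ i)) * exp_cutoff 1 (real n * (b $ i - x $ i)))"

lemma exp_cutoff_1_bounds: "0 \<le> exp_cutoff 1 t" "exp_cutoff 1 t \<le> 1"
  by (auto simp: exp_cutoff_def)

lemma exp_cutoff_1_tendsto: "(\<lambda>n. exp_cutoff 1 (real n * t)) \<longlonglongrightarrow> indicator {0<..} t"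
proof (cases "t > 0")
  case True
  have "(\<lambda>n. exp (- (1 / (real n * t)))) \<longlonglongrightarrow> 1"
    using True by real_asymp
  moreover have "\<forall>\<^sub>F n in sequentially. exp (- (1 / (real n * t))) = exp_cutoff 1 (real n * t)"
    using eventually_gt_at_top[of 0] by eventually_elim (use True in \<open>simp add: exp_cutoff_def\<close>)
  ultimately have "(\<lambda>n. exp_cutoff 1 (real n * t)) \<longlonglongrightarrow> 1"
    by (rule Lim_transform_eventually)
  with True show ?thesis by simp
next
  case False
  then have "exp_cutoff 1 (real n * t) = 0" for n
    by (simp add: exp_cutoff_def zero_less_mult_iff not_less)
  with False show ?thesis by simp
qed

lemma box_bump_bounds: "0 \<le> box_bump n a b x" "box_bump n a b x \<le> indicator (cbox a b) x"
proof -
  show "0 \<le> box_bump n a b x"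
    unfolding box_bump_def by (intro prod_nonneg mult_nonneg_nonneg ballI exp_cutoff_1_bounds)
  show "box_bump n a b x \<le> indicator (cbox a b) x"
  proof (cases "x \<in> cbox a b")
    case True
    have "box_bump n a b x \<le> 1"
      unfolding box_bump_def
      by (intro prod_le_1 conjI mult_nonneg_nonneg mult_le_one exp_cutoff_1_bounds)
    with True show ?thesis by simp
  next
    case False
    then obtain i where "x $ i < a $ i \<or> b $ i < x $ i"
      by (auto simp: mem_box_cart not_le)
    then have "exp_cutoff 1 (real n * (x $ i - a $ i)) * exp_cutoff 1 (real n * (b $ i - x $ i)) = 0"
      by (auto simp: exp_cutoff_def zero_less_mult_iff)
    then have "box_bump n a b x = 0"
      unfolding box_bump_def by (intro prod_zero bexI[of _ i]) auto
    with False show ?thesis by simp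
  qed
qed

lemma box_bump_tendsto: "(\<lambda>n. box_bump n a b x) \<longlonglongrightarrow> indicator (box a b) x"
proof -
  have "(\<lambda>n. box_bump n a b x) \<longlonglongrightarrow> (\<Prod>i\<in>UNIV. indicator {0<..} (x $ i - a $ i) * indicator {0<..} (b $ i - x $ i))"
    unfolding box_bump_def by (intro tendsto_prod tendsto_mult exp_cutoff_1_tendsto)
  also have "(\<Prod>i\<in>UNIV. indicator {0<..} (x $ i - a $ i) * indicator {0<..} (b $ i - x $ i)) = (indicator (box a b) x :: real)"
  proof (cases "x \<in> box a b")
    case True
    then show ?thesis by (simp add: mem_box_cart)
  next
    case False
    then obtain i where "\<not> (a $ i < x $ i \<and> x $ i < b $ i)"
      by (auto simp: mem_box_cart)
    then have "indicator {0<..} (x $ i - a $ i) * indicator {0<..} (b $ i - x $ i) = (0::real)"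
      by auto
    then have "(\<Prod>i\<in>UNIV. indicator {0<..} (x $ i - a $ i) * indicator {0<..} (b $ i - x $ i)) = (0::real)"
      by (intro prod_zero bexI[of _ i]) auto
    then show ?thesis using False by simp
  qed
  finally show ?thesis .
qed

lemma Ck_box_bump: "Ck k (box_bump n a b)"
proof -
  have e: "real n * (x $ i - a $ i) = real n * x $ i + - (real n * a $ i)"
    "real n * (b $ i - x $ i) = - real n * x $ i + real n * b $ i" for x i
    by (auto simp: algebra_simps)
  show ?thesis
    unfolding box_bump_def[abs_def] e
    by (intro Ck_prod Ck_bilinear[OF bounded_bilinear_mult] Ck_exp_cutoff)
qed

lemma box_bump_test_field: "(\<lambda>x. box_bump n a b x *\<^sub>R axis j 1) \<in> test_fields"
proof -
  have "Ck k (\<lambda>x. box_bump n a b x *\<^sub>R axis j (1::real))" for k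
    by (rule Ck_bounded_linear[OF bounded_linear_scaleR_left Ck_box_bump])
  moreover have "{x. box_bump n a b x *\<^sub>R axis j (1::real) \<noteq> 0} \<subseteq> cbox a b"
  proof
    fix x assume "x \<in> {x. box_bump n a b x *\<^sub>R axis j (1::real) \<noteq> 0}"
    then show "x \<in> cbox a b"
      using box_bump_bounds[of n a b x] by (cases "x \<in> cbox a b") auto
  qed
  then have "compact (closure {x. box_bump n a b x *\<^sub>R axis j (1::real) \<noteq> 0})"
    by (simp add: bounded_subset[OF bounded_cbox])
  ultimately show ?thesis unfolding test_fields_def by blast
qed

text \<open>Testing each component with bumps that tend to the indicator of an open box makes all
  box integrals vanish; the closed box supplies the integrable bound.\<close>

lemma fundamental_lemma_test_fields:
  fixes h :: "real^3 \<Rightarrow> real^3"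
  assumes meas: "h \<in> borel_measurable lebesgue"
    and int: "\<And>K. compact K \<Longrightarrow> set_integrable lebesgue K h"
    and zero: "\<And>\<phi>. \<phi> \<in> test_fields \<Longrightarrow> (\<integral>x. h x \<bullet> \<phi> x \<partial>lebesgue) = 0"
  shows "AE x in lebesgue. h x = 0"
proof -
  have "AE x in lebesgue. h x $ j = 0" for j
  proof (rule AE_eq_0_if_box_integrals_eq_0)
    show hj[measurable]: "(\<lambda>x. h x $ j) \<in> borel_measurable lebesgue"
    proof -
      have "(\<lambda>x. h x \<bullet> axis j 1) \<in> borel_measurable lebesgue"
        using meas by measurable
      then show ?thesis by (simp add: inner_axis)
    qed
    show intj: "set_integrable lebesgue (cbox a b) (\<lambda>x. h x $ j)" for a b
    proof -
      have "integrable lebesgue (\<lambda>x. indicator (cbox a b) x *\<^sub>R h x)"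
        using int[OF compact_cbox] unfolding set_integrable_def .
      from integrable_bounded_linear[OF bounded_linear_vec_nth this, of j]
      show ?thesis unfolding set_integrable_def vector_scaleR_component .
    qed
    fix a b :: "real^3"
    have "(\<lambda>n. \<integral>x. box_bump n a b x * h x $ j \<partial>lebesgue) \<longlonglongrightarrow> (\<integral>x. indicator (box a b) x * h x $ j \<partial>lebesgue)"
    proof (rule integral_dominated_convergence[where w="\<lambda>x. norm (indicator (cbox a b) x *\<^sub>R h x $ j)"])
      show "integrable lebesgue (\<lambda>x. norm (indicator (cbox a b) x *\<^sub>R h x $ j))"
        using intj by (intro integrable_norm) (simp add: set_integrable_def)
      show "AE x in lebesgue. (\<lambda>n. box_bump n a b x * h x $ j) \<longlonglongrightarrow> indicator (box a b) x * h x $ j"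
        by (intro AE_I2 tendsto_mult box_bump_tendsto tendsto_const)
      show "AE x in lebesgue. norm (box_bump n a b x * h x $ j) \<le> norm (indicator (cbox a b) x *\<^sub>R h x $ j)" for n
        using box_bump_bounds[of n a b] by (intro AE_I2) (simp add: abs_mult mult_right_mono)
      have "continuous_on UNIV (box_bump n a b)" for n
        using Ck_box_bump[of 0] by simp
      then have [measurable]: "box_bump n a b \<in> borel_measurable lebesgue" for n
        by (intro measurable_completion) (simp add: borel_measurable_continuous_onI)
      show "(\<lambda>x. box_bump n a b x * h x $ j) \<in> borel_measurable lebesgue" for n
        by measurable
      show "(\<lambda>x. indicator (box a b) x * h x $ j) \<in> borel_measurable lebesgue"
        by (rule indicator_box_times_measurable[OF hj])
    qed
    moreover have "(\<integral>x. box_bump n a b x * h x $ j \<partial>lebesgue) = 0" for n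
      using zero[OF box_bump_test_field[of n a b j]] by (simp add: inner_axis)
    ultimately show "(\<integral>x. indicator (box a b) x * h x $ j \<partial>lebesgue) = 0"
      by (simp add: LIMSEQ_const_iff)
  qed
  then have "AE x in lebesgue. \<forall>j. h x $ j = 0"
    by (simp add: AE_all_countable)
  then show ?thesis
    by eventually_elim (simp add: vec_eq_iff)
qed

section \<open>Null sets and orthogonal maps\<close>

lemma AE_lborel_affine:
  fixes a :: "'a::euclidean_space"
  assumes "c \<noteq> 0" "AE x in lborel. P x"
  shows "AE x in lborel. P (a + c *\<^sub>R x)"
proof -
  obtain N where N: "{x. \<not> P x} \<subseteq> N" "N \<in> null_sets lborel"
    using assms(2) by (auto elim!: AE_E simp: null_sets_def)
  have [measurable]: "N \<in> sets borel"
    using N by auto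
  have "AE x in lborel. x \<notin> N"
    by (rule AE_not_in[OF N(2)])
  then have "AE x in density (distr lborel borel (\<lambda>x. a + c *\<^sub>R x)) (\<lambda>_. \<bar>c\<bar>^DIM('a)). x \<notin> N"
    by (simp only: lborel_affine[OF assms(1), of a, symmetric])
  then have "AE x in lborel. a + c *\<^sub>R x \<notin> N"
    using assms(1) by (simp add: AE_density AE_distr_iff)
  then show ?thesis
    by eventually_elim (use N in auto)
qed

text \<open>For \<open>x \<noteq> 0\<close> almost every multiple \<open>t |x|\<close> avoids a given null set; by Fubini a single \<open>t\<close>
  works for almost every \<open>x\<close>, and a dilation removes it. This replaces polar coordinates.\<close>

lemma AE_radial:
  assumes "AE r in lborel. r > 0 \<longrightarrow> P r"
  shows "AE x::'a::euclidean_space in lborel. x \<noteq> 0 \<longrightarrow> P (norm x)"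
proof -
  obtain N where N: "{r. \<not> (r > 0 \<longrightarrow> P r)} \<subseteq> N" "N \<in> null_sets lborel"
    using assms by (auto elim!: AE_E simp: null_sets_def)
  have [measurable]: "N \<in> sets borel"
    using N by auto
  have "AE t in lborel. t * norm x \<notin> N" if "x \<noteq> 0" for x :: 'a
    using AE_lborel_affine[of "norm x" "\<lambda>r. r \<notin> N" 0] AE_not_in[OF N(2)] that
    by (simp add: mult.commute)
  then have "AE t in lborel. x \<noteq> 0 \<longrightarrow> t * norm x \<notin> N" for x :: 'a
    by (cases "x = 0") simp_all
  then have "AE x in (lborel :: 'a measure). AE t in lborel. x \<noteq> 0 \<longrightarrow> t * norm x \<notin> N"
    by (rule AE_I2)
  then have "AE t in lborel. AE x in (lborel :: 'a measure). x \<noteq> 0 \<longrightarrow> t * norm x \<notin> N"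
    by (subst (asm) lborel_pair.AE_commute) measurable
  moreover have "\<not> (AE t in lborel. \<not> (0 < t \<and> t < (1::real)))"
  proof
    assume "AE t in lborel. \<not> (0 < t \<and> t < (1::real))"
    then have "emeasure lborel {t. 0 < t \<and> t < (1::real)} = 0"
      by (subst (asm) AE_iff_measurable[OF _ refl]) auto
    moreover have "{t. 0 < t \<and> t < (1::real)} = {0<..<1}" by auto
    ultimately show False by simp
  qed
  ultimately obtain t :: real where t: "0 < t" "AE x in (lborel :: 'a measure). x \<noteq> 0 \<longrightarrow> t * norm x \<notin> N"
    by (metis (mono_tags, lifting) eventually_mono)
  have "AE x in (lborel :: 'a measure). 0 + (1 / t) *\<^sub>R x \<noteq> 0 \<longrightarrow> t * norm (0 + (1 / t) *\<^sub>R x) \<notin> N"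
    by (rule AE_lborel_affine[OF _ t(2)]) (use t in auto)
  then show ?thesis
  proof eventually_elim
    case (elim x)
    then have "x \<noteq> 0 \<longrightarrow> norm x \<notin> N" using t by auto
    then show ?case using subsetD[OF N(1), of "norm x"] by auto
  qed
qed

text \<open>Boxes determine Lebesgue measure, and the preimage of a box under \<open>T\<close> is
  its image under the inverse map, which is again orthogonal and preserves volume.\<close>

lemma distr_lborel_orthogonal:
  fixes T :: "real^'n::{finite,wellorder} \<Rightarrow> real^'n::{finite,wellorder}"
  assumes T: "orthogonal_transformation T"
  shows "distr lborel borel T = lborel"
proof (rule lborel_eqI[symmetric])
  have bij: "bij T"
    using T by (rule orthogonal_transformation_bij)
  have lin: "linear T"
    using T by (rule orthogonal_transformation_linear)
  have [measurable]: "T \<in> borel_measurable borel"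
    using lin by (intro borel_measurable_continuous_onI) (simp add: linear_continuous_on linear_conv_bounded_linear)
  have inv: "orthogonal_transformation (inv T)"
    using T by (rule orthogonal_transformation_inv)
  fix l u :: "real^'n::{finite,wellorder}"
  assume lu: "\<And>b. b \<in> Basis \<Longrightarrow> l \<bullet> b \<le> u \<bullet> b"
  have im: "T -` box l u = inv T ` box l u"
    using bij by (simp add: bij_vimage_eq_inv_image)
  have m: "inv T ` box l u \<in> lmeasurable" "measure lebesgue (inv T ` box l u) = measure lebesgue (box l u)"
    using measurable_orthogonal_image[OF inv] measure_orthogonal_image[OF inv] by auto
  have "emeasure (distr lborel borel T) (box l u) = emeasure lborel (T -` box l u)"
    by (simp add: emeasure_distr)
  also have "\<dots> = emeasure lebesgue (inv T ` box l u)"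
    unfolding im[symmetric] using measurable_sets_borel[of T borel "box l u"] by simp
  also have "\<dots> = ennreal (measure lebesgue (box l u))"
    using m fmeasurableD2[OF m(1)] by (simp add: emeasure_eq_ennreal_measure)
  also have "\<dots> = emeasure lebesgue (box l u)"
    using fmeasurableD2[OF lmeasurable_box[of l u]] by (rule emeasure_eq_ennreal_measure[symmetric])
  also have "\<dots> = (\<Prod>b\<in>Basis. (u - l) \<bullet> b)"
    using emeasure_lborel_box[OF lu] by simp
  finally show "emeasure (distr lborel borel T) (box l u) = (\<Prod>b\<in>Basis. (u - l) \<bullet> b)" .
qed simp

lemma AE_orthogonal:
  fixes T :: "real^'n::{finite,wellorder} \<Rightarrow> real^'n::{finite,wellorder}"
  assumes T: "orthogonal_transformation T" and P: "AE x in lborel. P x"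
  shows "AE x in lborel. P (T x)"
proof -
  obtain N where N: "{x. \<not> P x} \<subseteq> N" "N \<in> null_sets lborel"
    using P by (auto elim!: AE_E simp: null_sets_def)
  have [measurable]: "T \<in> borel_measurable borel"
    using orthogonal_transformation_linear[OF T]
    by (intro borel_measurable_continuous_onI) (simp add: linear_continuous_on linear_conv_bounded_linear)
  have [measurable]: "N \<in> sets borel"
    using N by auto
  have "AE x in distr lborel borel T. x \<notin> N"
    unfolding distr_lborel_orthogonal[OF T] by (rule AE_not_in[OF N(2)])
  then have "AE x in lborel. T x \<notin> N"
    by (simp add: AE_distr_iff)
  then show ?thesis
    by eventually_elim (use N in auto)
qed

lemma equivariant_imp_radial:
  fixes F :: "real^'n \<Rightarrow> real^'n"
  assumes F: "\<And>T x. orthogonal_transformation T \<Longrightarrow> F (T x) = T (F x)"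
    and e: "norm e = 1"
  shows "F x = (F (norm x *\<^sub>R e) \<bullet> e) *\<^sub>R (x /\<^sub>R norm x) \<or> x = 0"
proof (cases "x = 0")
  case False
  have ee: "e \<bullet> e = 1" using e by (simp add: norm_eq_1)
  \<comment> \<open>\<open>S\<close> is the identity on the line of \<open>e\<close> and minus the
    identity on its orthogonal complement, so its fixed vectors are exactly the multiples of
    \<open>e\<close>.\<close>
  define S where "S v = (2 * (v \<bullet> e)) *\<^sub>R e - v" for v
  have "linear S"
    by (rule linearI) (simp_all add: S_def inner_add_left scaleR_add_left scaleR_diff_right distrib_left)
  moreover have "S v \<bullet> S w = v \<bullet> w" for v w
    by (simp add: S_def inner_diff_left inner_diff_right ee inner_commute)
  ultimately have S: "orthogonal_transformation S"
    unfolding orthogonal_transformation_def by blast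
  have "S (norm x *\<^sub>R e) = norm x *\<^sub>R e"
    by (simp add: S_def ee flip: scaleR_diff_left)
  then have "F (norm x *\<^sub>R e) = S (F (norm x *\<^sub>R e))"
    using F[OF S, of "norm x *\<^sub>R e"] by simp
  then have "F (norm x *\<^sub>R e) + F (norm x *\<^sub>R e) = 2 *\<^sub>R ((F (norm x *\<^sub>R e) \<bullet> e) *\<^sub>R e)"
    by (simp add: S_def eq_diff_eq)
  then have "2 *\<^sub>R (F (norm x *\<^sub>R e) - (F (norm x *\<^sub>R e) \<bullet> e) *\<^sub>R e) = 0"
    unfolding scaleR_2[symmetric] scaleR_diff_right by simp
  then have Fe: "F (norm x *\<^sub>R e) = (F (norm x *\<^sub>R e) \<bullet> e) *\<^sub>R e"
    by simp
  \<comment> \<open>Orthogonal maps act transitively on spheres, so the value on the axis of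
    \<open>e\<close> determines the value at \<open>x\<close>.\<close>
  obtain T where T: "orthogonal_transformation T" "T (norm x *\<^sub>R e) = x"
    using orthogonal_transformation_exists[of "norm x *\<^sub>R e" x] e by auto
  have lin: "linear T" using T by (simp add: orthogonal_transformation_linear)
  have Te: "T e = x /\<^sub>R norm x"
  proof -
    have "inverse (norm x) *\<^sub>R (norm x *\<^sub>R T e) = inverse (norm x) *\<^sub>R x"
      using T(2) linear_cmul[OF lin, of "norm x" e] by simp
    then show ?thesis using False by simp
  qed
  have "F x = T (F (norm x *\<^sub>R e))"
    using F[OF T(1), of "norm x *\<^sub>R e"] T(2) by simp
  also have "\<dots> = (F (norm x *\<^sub>R e) \<bullet> e) *\<^sub>R (x /\<^sub>R norm x)"
    using arg_cong[OF Fe, of T] by (simp only: linear_cmul[OF lin] Te)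
  finally show ?thesis by simp
qed simp

section \<open>Ball averages of equivariant fields\<close>

text \<open>The ball around \<open>x\<close> is parametrised by the unit ball so that one fixed
  probability measure serves all \<open>x\<close> and \<open>\<epsilon>\<close>; its invariance
  under orthogonal maps is then all that a change of variables needs.\<close>

definition ball_average :: "real \<Rightarrow> ('a::euclidean_space \<Rightarrow> 'b::euclidean_space) \<Rightarrow> 'a \<Rightarrow> 'b" where
  "ball_average \<epsilon> W x = (\<integral>y. W (x + \<epsilon> *\<^sub>R y) \<partial>uniform_measure lborel (cball 0 1))"

lemma unit_cball_emeasure:
  "emeasure lborel (cball (0::'a::euclidean_space) 1) \<noteq> 0" "emeasure lborel (cball (0::'a::euclidean_space) 1) \<noteq> \<infinity>"
proof -
  have "emeasure lborel (ball (0::'a) 1) \<noteq> 0"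
    using open_not_negligible[of "ball (0::'a) 1"] 
    by (auto simp: negligible_iff_null_sets null_sets_def)
  then show "emeasure lborel (cball (0::'a) 1) \<noteq> 0"
    using emeasure_mono[of "ball (0::'a) 1" "cball 0 1" lborel] by (auto simp: ball_subset_cball)
  show "emeasure lborel (cball (0::'a) 1) \<noteq> \<infinity>"
    using emeasure_compact_finite[OF compact_cball, of "0::'a" 1] by simp
qed

lemma unit_cball_uniform_finite: 
  "finite_measure (uniform_measure lborel (cball (0::'a::euclidean_space) 1))"
  "emeasure (uniform_measure lborel (cball (0::'a) 1)) UNIV = 1"
  "measure (uniform_measure lborel (cball (0::'a) 1)) UNIV = 1"
proof -
  show e: "emeasure (uniform_measure lborel (cball (0::'a) 1)) UNIV = 1"
    using unit_cball_emeasure[where 'a='a] by (simp add: ennreal_divide_self zero_less_iff_neq_zero less_top)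
  then show "finite_measure (uniform_measure lborel (cball (0::'a) 1))"
    by (intro finite_measureI) simp
  show "measure (uniform_measure lborel (cball (0::'a) 1)) UNIV = 1"
    using e by (simp add: measure_def)
qed

lemma bounded_integrable_unit_cball:
  fixes W :: "'a::euclidean_space \<Rightarrow> 'b::euclidean_space"
  assumes "W \<in> borel_measurable borel" "\<And>x. norm (W x) \<le> B"
  shows "integrable (uniform_measure lborel (cball 0 1)) (\<lambda>y. W (x + \<epsilon> *\<^sub>R y))"
proof -
  interpret finite_measure "uniform_measure lborel (cball (0::'a) 1)"
    by (rule unit_cball_uniform_finite)
  show ?thesis
    using assms by (intro integrable_const_bound[of _ B]) auto
qed

text \<open>Here almost everywhere equivariance becomes equivariance at every point: once the
  uniform measure on the ball has been moved by \<open>T\<close>, the exceptional null set is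
  invisible to the integral.\<close>

lemma ball_average_equivariant:
  fixes W :: "real^'n::{finite,wellorder} \<Rightarrow> real^'n::{finite,wellorder}"
  assumes T: "orthogonal_transformation T"
    and W[measurable]: "W \<in> borel_measurable borel" and "\<epsilon> > 0"
    and bd: "\<And>x. norm (W x) \<le> B"
    and eq: "AE x in lborel. W (T x) = T (W x)"
  shows "ball_average \<epsilon> W (T x) = T (ball_average \<epsilon> W x)"
proof -
  let ?\<mu> = "uniform_measure lborel (cball (0::real^'n::{finite,wellorder}) 1)"
  have lin: "linear T" using T by (simp add: orthogonal_transformation_linear)
  have Tm[measurable]: "T \<in> borel_measurable borel"
    using lin by (intro borel_measurable_continuous_onI) (simp add: linear_continuous_on linear_conv_bounded_linear)
  have nT: "norm (T y) = norm y" for y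
    using T by (simp add: orthogonal_transformation_norm)
  have "distr ?\<mu> borel T = ?\<mu>"
  proof (rule measure_eqI)
    fix A assume "A \<in> sets (distr ?\<mu> borel T)"
    then have [measurable]: "A \<in> sets borel" by simp
    have "emeasure lborel (cball 0 1 \<inter> T -` A) = emeasure lborel (T -` (cball 0 1 \<inter> A))"
      by (intro arg_cong[of _ _ "emeasure lborel"]) (auto simp: nT)
    also have "\<dots> = emeasure (distr lborel borel T) (cball 0 1 \<inter> A)"
      by (simp add: emeasure_distr)
    also have "\<dots> = emeasure lborel (cball 0 1 \<inter> A)"
      by (simp only: distr_lborel_orthogonal[OF T])
    finally show "emeasure (distr ?\<mu> borel T) A = emeasure ?\<mu> A"
      using measurable_sets_borel[OF Tm, of A] by (simp add: emeasure_distr)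
  qed simp
  then have "ball_average \<epsilon> W (T x) = (\<integral>y. W (T x + \<epsilon> *\<^sub>R y) \<partial>distr ?\<mu> borel T)"
    by (simp add: ball_average_def)
  also have "\<dots> = (\<integral>y. W (T x + \<epsilon> *\<^sub>R T y) \<partial>?\<mu>)"
    by (rule integral_distr) auto
  also have "\<dots> = (\<integral>y. W (T (x + \<epsilon> *\<^sub>R y)) \<partial>?\<mu>)"
    by (simp add: linear_add[OF lin] linear_cmul[OF lin])
  also have "\<dots> = (\<integral>y. T (W (x + \<epsilon> *\<^sub>R y)) \<partial>?\<mu>)"
  proof (rule integral_cong_AE)
    \<comment> \<open>As \<open>\<epsilon>\<close> is not 0, the affine map taking y to x +
      \<epsilon> y pulls null sets back to null sets.\<close>
    have "AE y in lborel. W (T (x + \<epsilon> *\<^sub>R y)) = T (W (x + \<epsilon> *\<^sub>R y))"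
      using AE_lborel_affine[OF _ eq, of \<epsilon> x] \<open>\<epsilon> > 0\<close> by simp
    then show "AE y in ?\<mu>. W (T (x + \<epsilon> *\<^sub>R y)) = T (W (x + \<epsilon> *\<^sub>R y))"
      by (intro AE_uniform_measureI) auto
  qed auto
  also have "\<dots> = T (ball_average \<epsilon> W x)"
    unfolding ball_average_def
    using lin W bd by (intro integral_bounded_linear bounded_integrable_unit_cball)
      (auto simp: linear_conv_bounded_linear)
  finally show ?thesis .
qed

lemma ball_average_measurable:
  assumes [measurable]: "W \<in> borel_measurable borel"
  shows "ball_average \<epsilon> W \<in> borel_measurable borel"
proof -
  interpret finite_measure "uniform_measure lborel (cball (0::'a) 1)"
    by (rule unit_cball_uniform_finite)
  show ?thesis
    unfolding ball_average_def[abs_def] by measurable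
qed

text \<open>A three-term estimate. \<open>G m\<close> is close to \<open>W\<close> in the mean on a
  ball and uniformly continuous there, so averaging moves it little; the error
  \<open>W - G m\<close> enters once averaged and once directly, and \<open>D m\<close> controls
  both.\<close>

lemma ball_average_L1_approx:
  fixes W :: "'a::euclidean_space \<Rightarrow> 'b::euclidean_space"
  assumes W[measurable]: "W \<in> borel_measurable borel" and bd: "\<And>x. norm (W x) \<le> 1"
    and G: "\<And>m. continuous_on UNIV (G m)" "\<And>m x. norm (G m x) \<le> 1"
      "AE x in lborel. (\<lambda>m. G m x) \<longlonglongrightarrow> W x"
    and "R \<ge> 0" "\<eta> > 0"
  obtains \<epsilon> where "0 < \<epsilon>"
    "(\<integral>\<^sup>+x. indicator (cball 0 R) x * norm (ball_average \<epsilon> W x - W x) \<partial>lborel) \<le> ennreal \<eta>"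
proof -
  define \<mu> where "\<mu> = uniform_measure lborel (cball (0::'a) 1)"
  interpret finite_measure \<mu>
    unfolding \<mu>_def by (rule unit_cball_uniform_finite)
  have \<mu>1: "emeasure \<mu> UNIV = 1" "measure \<mu> UNIV = 1"
    unfolding \<mu>_def by (rule unit_cball_uniform_finite)+
  have s\<mu>[measurable_cong, simp]: "sets \<mu> = sets borel" and sp[simp]: "space \<mu> = UNIV"
    by (auto simp: \<mu>_def)
  have [measurable]: "G m \<in> borel_measurable borel" for m
    using G(1) by (rule borel_measurable_continuous_onI)
  \<comment> \<open>Radius \<open>R + 1\<close> instead of \<open>R\<close> leaves room for shifts
    by \<open>\<epsilon> *\<^sub>R y\<close>, which will have length at most 1.\<close>
  define D where "D m = (\<integral>x. indicator (cball 0 (R + 1)) x * norm (W x - G m x) \<partial>lborel)" for m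
  define v where "v = measure lborel (cball (0::'a) R)"
  have iB: "integrable lborel (\<lambda>x. indicator (cball (0::'a) r) x * c)" for r c :: real
    by (intro integrable_mult_left integrable_real_indicator)
       (use emeasure_compact_finite[OF compact_cball, of 0 r] in auto)
  have n2: "norm (W x - G m x) \<le> 2" for m x
    using norm_triangle_ineq4[of "W x" "G m x"] bd[of x] G(2)[of m x] by linarith
  have iD: "integrable lborel (\<lambda>x. indicator (cball (0::'a) r) x * norm (W x - G m x))" for r m
    by (rule Bochner_Integration.integrable_bound[OF iB[of r 2]])
       (auto intro!: AE_I2 mult_left_mono n2 simp: indicator_def)
  have "D \<longlonglongrightarrow> (\<integral>x. 0 \<partial>(lborel :: 'a measure))"
    unfolding D_def
  proof (rule integral_dominated_convergence[OF _ _ iB[of "R + 1" 2]])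
    show "AE x in lborel. (\<lambda>m. indicator (cball 0 (R + 1)) x * norm (W x - G m x)) \<longlonglongrightarrow> 0"
      using G(3)
    proof eventually_elim
      case (elim x)
      have "(\<lambda>m. indicator (cball 0 (R + 1)) x * norm (W x - G m x)) \<longlonglongrightarrow> indicator (cball 0 (R + 1)) x * norm (W x - W x)"
        by (intro tendsto_intros elim)
      then show ?case by simp
    qed
    show "AE x in lborel. norm (indicator (cball 0 (R + 1)) x * norm (W x - G m x)) \<le> indicator (cball 0 (R + 1)) x * 2" for m
      by (auto intro!: AE_I2 mult_left_mono n2 simp: indicator_def)
  qed (use borel_measurable_integrable[OF iD] in auto)
  then have "\<forall>\<^sub>F m in sequentially. D m < \<eta> / 3"
    using \<open>\<eta> > 0\<close> by (intro order_tendstoD(2)[of _ 0]) auto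
  then obtain m where m: "D m < \<eta> / 3"
    by (auto simp: eventually_sequentially)
  \<comment> \<open>\<open>v\<close> is the volume of the ball of radius \<open>R\<close>; the
    choice makes the total contribution of the oscillation at most \<open>\<eta> / 3\<close>, and
    the summand 1 keeps the denominator positive when \<open>v = 0\<close>.\<close>
  define \<gamma> where "\<gamma> = \<eta> / (3 * (v + 1))"
  have v0: "v \<ge> 0" by (simp add: v_def)
  have "\<gamma> > 0" using \<open>\<eta> > 0\<close> v0 by (simp add: \<gamma>_def)
  have "uniformly_continuous_on (cball 0 (R + 1)) (G m)"
    using G(1) by (intro compact_uniformly_continuous continuous_on_subset[OF G(1)]) auto
  then obtain d where d: "d > 0" "\<And>x y. x \<in> cball 0 (R + 1) \<Longrightarrow> y \<in> cball 0 (R + 1) \<Longrightarrow> dist y x < d \<Longrightarrow> dist (G m y) (G m x) < \<gamma>"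
    using \<open>\<gamma> > 0\<close> unfolding uniformly_continuous_on_def by metis
  define \<epsilon> where "\<epsilon> = min 1 (d / 2)"
  have \<epsilon>: "0 < \<epsilon>" "\<epsilon> \<le> 1" "\<epsilon> < d" using d(1) by (auto simp: \<epsilon>_def)
  define H where "H x = norm (W x - G m x)" for x
  have [measurable]: "H \<in> borel_measurable borel"
    unfolding H_def by measurable
  have H: "0 \<le> H x" "H x \<le> 2" for x
    using n2 by (auto simp: H_def)
  have iH: "integrable \<mu> (\<lambda>y. H (x + \<epsilon> *\<^sub>R y))" for x
    by (rule integrable_const_bound[of _ 2]) (use H in auto)
  have iW: "integrable \<mu> (\<lambda>y. W (x + \<epsilon> *\<^sub>R y))" for x
    using bounded_integrable_unit_cball[OF W bd] by (simp add: \<mu>_def)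
  have AE\<mu>: "AE y in \<mu>. norm y \<le> 1"
    unfolding \<mu>_def by (intro AE_uniform_measureI) auto
  have pt: "norm (ball_average \<epsilon> W x - W x) \<le> (\<integral>y. H (x + \<epsilon> *\<^sub>R y) \<partial>\<mu>) + \<gamma> + H x" if "norm x \<le> R" for x
  proof -
    have "ball_average \<epsilon> W x - W x = (\<integral>y. W (x + \<epsilon> *\<^sub>R y) - W x \<partial>\<mu>)"
      using iW[of x] \<mu>1 by (simp add: ball_average_def \<mu>_def[symmetric])
    also have "norm \<dots> \<le> (\<integral>y. norm (W (x + \<epsilon> *\<^sub>R y) - W x) \<partial>\<mu>)"
      by (rule integral_norm_bound)
    also have "\<dots> \<le> (\<integral>y. H (x + \<epsilon> *\<^sub>R y) + (\<gamma> + H x) \<partial>\<mu>)"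
    proof (rule integral_mono_AE)
      show "integrable \<mu> (\<lambda>y. norm (W (x + \<epsilon> *\<^sub>R y) - W x))"
        using iW[of x] by (intro integrable_norm Bochner_Integration.integrable_diff) auto
      show "integrable \<mu> (\<lambda>y. H (x + \<epsilon> *\<^sub>R y) + (\<gamma> + H x))"
        using iH by auto
      show "AE y in \<mu>. norm (W (x + \<epsilon> *\<^sub>R y) - W x) \<le> H (x + \<epsilon> *\<^sub>R y) + (\<gamma> + H x)"
        using AE\<mu>
      proof eventually_elim
        case (elim y)
        have ey: "norm (\<epsilon> *\<^sub>R y) \<le> \<epsilon>"
          using elim \<epsilon> by (simp add: mult_left_le)
        have "norm (x + \<epsilon> *\<^sub>R y) \<le> R + 1"
          using norm_triangle_ineq[of x "\<epsilon> *\<^sub>R y"] that ey \<epsilon> by linarith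
        then have "x + \<epsilon> *\<^sub>R y \<in> cball 0 (R + 1)" "x \<in> cball 0 (R + 1)"
          using that by (simp_all add: mem_cball_0)
        moreover have "dist (x + \<epsilon> *\<^sub>R y) x < d"
          using ey \<epsilon> by (simp add: dist_norm del: norm_scaleR)
        ultimately have "dist (G m (x + \<epsilon> *\<^sub>R y)) (G m x) < \<gamma>"
          by (intro d(2))
        moreover have "norm (W (x + \<epsilon> *\<^sub>R y) - W x) \<le> norm (W (x + \<epsilon> *\<^sub>R y) - G m (x + \<epsilon> *\<^sub>R y)) + norm (G m (x + \<epsilon> *\<^sub>R y) - G m x) + norm (G m x - W x)"
          using norm_triangle_ineq[of "W (x + \<epsilon> *\<^sub>R y) - G m (x + \<epsilon> *\<^sub>R y)" "G m (x + \<epsilon> *\<^sub>R y) - G m x"]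
            norm_triangle_ineq[of "W (x + \<epsilon> *\<^sub>R y) - G m x" "G m x - W x"] by simp
        ultimately show ?case
          by (simp add: H_def dist_norm norm_minus_commute)
      qed
    qed
    also have "\<dots> = (\<integral>y. H (x + \<epsilon> *\<^sub>R y) \<partial>\<mu>) + \<gamma> + H x"
      using iH[of x] \<mu>1 by simp
    finally show ?thesis .
  qed
  have em: "ennreal (\<integral>y. H (x + \<epsilon> *\<^sub>R y) \<partial>\<mu>) = (\<integral>\<^sup>+y. H (x + \<epsilon> *\<^sub>R y) \<partial>\<mu>)" for x
    by (rule nn_integral_eq_integral[symmetric, OF iH]) (use H in auto)
  have D: "(\<integral>\<^sup>+x. indicator (cball 0 (R + 1)) x * ennreal (H x) \<partial>lborel) = ennreal (D m)"
    unfolding D_def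
    by (subst nn_integral_eq_integral[OF iD, symmetric])
       (auto simp: H_def indicator_def intro!: nn_integral_cong)
  interpret P: pair_sigma_finite lborel \<mu>
    by (intro pair_sigma_finite.intro sigma_finite_lborel sigma_finite_measure_axioms)
  have mI: "(\<lambda>z::'a \<times> 'a. indicator (cball 0 R) (fst z) :: ennreal) \<in> borel_measurable (borel \<Otimes>\<^sub>M borel)"
    by (rule measurable_compose[OF measurable_fst]) (rule borel_measurable_indicator, simp)
  have "(\<lambda>z. fst z + \<epsilon> *\<^sub>R snd z) \<in> measurable (borel \<Otimes>\<^sub>M borel) (borel :: 'a measure)"
    by measurable
  then have "(\<lambda>z. ennreal (H (fst z + \<epsilon> *\<^sub>R snd z))) \<in> borel_measurable (borel \<Otimes>\<^sub>M borel)"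
    by (rule measurable_compose[OF measurable_compose[OF _ \<open>H \<in> borel_measurable borel\<close>] measurable_ennreal])
  note mH = this
  have sP: "sets (lborel \<Otimes>\<^sub>M \<mu>) = sets (borel \<Otimes>\<^sub>M borel)"
    by (intro sets_pair_measure_cong) auto
  have Hm: "(\<lambda>(x, y). indicator (cball 0 R) x * ennreal (H (x + \<epsilon> *\<^sub>R y))) \<in> borel_measurable (lborel \<Otimes>\<^sub>M \<mu>)"
    using borel_measurable_times_ennreal[OF mI mH] by (simp add: case_prod_beta' measurable_cong_sets[OF sP refl])
  have "(\<lambda>(x, y). ennreal (H (x + \<epsilon> *\<^sub>R y))) \<in> borel_measurable (lborel \<Otimes>\<^sub>M \<mu>)"
    using mH by (simp add: case_prod_beta' measurable_cong_sets[OF sP refl])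
  then have Nm: "(\<lambda>x. \<integral>\<^sup>+y. H (x + \<epsilon> *\<^sub>R y) \<partial>\<mu>) \<in> borel_measurable lborel"
    by (rule sigma_finite_measure.borel_measurable_nn_integral[OF sigma_finite_measure_axioms])
  have m1: "(\<lambda>x. indicator (cball 0 R) x * (\<integral>\<^sup>+y. H (x + \<epsilon> *\<^sub>R y) \<partial>\<mu>)) \<in> borel_measurable lborel"
    by (intro borel_measurable_times_ennreal borel_measurable_indicator Nm) auto
  have m2: "(\<lambda>x::'a. ennreal \<gamma> * indicator (cball 0 R) x) \<in> borel_measurable lborel"
    by (intro borel_measurable_times_ennreal borel_measurable_indicator) auto
  have m3: "(\<lambda>x. indicator (cball 0 (R + 1)) x * ennreal (H x)) \<in> borel_measurable lborel"
    by (intro borel_measurable_times_ennreal borel_measurable_indicator) auto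
  \<comment> \<open>After exchanging the integrals, translation by
    \<open>\<epsilon> *\<^sub>R y\<close> carries the ball of radius \<open>R\<close> into that of
    radius \<open>R + 1\<close> for each fixed \<open>y\<close>, so the inner integral is at most
    \<open>D m\<close>.\<close>
  have t1: "(\<integral>\<^sup>+x. indicator (cball 0 R) x * (\<integral>\<^sup>+y. H (x + \<epsilon> *\<^sub>R y) \<partial>\<mu>) \<partial>lborel) \<le> ennreal (D m)"
  proof -
    have "(\<integral>\<^sup>+x. indicator (cball 0 R) x * (\<integral>\<^sup>+y. H (x + \<epsilon> *\<^sub>R y) \<partial>\<mu>) \<partial>lborel)
      = (\<integral>\<^sup>+x. (\<integral>\<^sup>+y. indicator (cball 0 R) x * ennreal (H (x + \<epsilon> *\<^sub>R y)) \<partial>\<mu>) \<partial>lborel)"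
      by (intro nn_integral_cong nn_integral_cmult[symmetric]) auto
    also have "\<dots> = (\<integral>\<^sup>+y. (\<integral>\<^sup>+x. indicator (cball 0 R) x * ennreal (H (x + \<epsilon> *\<^sub>R y)) \<partial>lborel) \<partial>\<mu>)"
      by (rule P.Fubini'[symmetric, OF Hm])
    also have "\<dots> \<le> (\<integral>\<^sup>+y. ennreal (D m) \<partial>\<mu>)"
    proof (rule nn_integral_mono_AE)
      show "AE y in \<mu>. (\<integral>\<^sup>+x. indicator (cball 0 R) x * ennreal (H (x + \<epsilon> *\<^sub>R y)) \<partial>lborel) \<le> ennreal (D m)"
        using AE\<mu>
      proof eventually_elim
        case (elim y)
        have ey: "norm (\<epsilon> *\<^sub>R y) \<le> \<epsilon>"
          using elim \<epsilon> by (simp add: mult_left_le)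
        have "norm (\<epsilon> *\<^sub>R y + x) \<le> R + 1" if "norm x \<le> R" for x
          using norm_triangle_ineq[of "\<epsilon> *\<^sub>R y" x] that ey \<epsilon> by linarith
        then have "(\<integral>\<^sup>+x. indicator (cball 0 R) x * ennreal (H (x + \<epsilon> *\<^sub>R y)) \<partial>lborel)
          \<le> (\<integral>\<^sup>+x. indicator (cball 0 (R + 1)) (\<epsilon> *\<^sub>R y + x) * ennreal (H (\<epsilon> *\<^sub>R y + x)) \<partial>lborel)"
          by (intro nn_integral_mono) (auto simp: indicator_def add.commute)
        also have "\<dots> = (\<integral>\<^sup>+x. indicator (cball 0 (R + 1)) x * ennreal (H x) \<partial>distr lborel borel ((+) (\<epsilon> *\<^sub>R y)))"
          by (subst nn_integral_distr) (auto intro!: borel_measurable_times_ennreal borel_measurable_indicator)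
        also have "\<dots> = ennreal (D m)"
          by (simp only: lborel_distr_plus D)
        finally show ?case .
      qed
    qed
    also have "\<dots> = ennreal (D m)" by (simp add: \<mu>1)
    finally show ?thesis .
  qed
  have D0: "D m \<ge> 0" unfolding D_def by (intro integral_nonneg_AE) auto
  have "(\<integral>\<^sup>+x. indicator (cball 0 R) x * norm (ball_average \<epsilon> W x - W x) \<partial>lborel)
    \<le> (\<integral>\<^sup>+x. indicator (cball 0 R) x * (\<integral>\<^sup>+y. H (x + \<epsilon> *\<^sub>R y) \<partial>\<mu>) + (ennreal \<gamma> * indicator (cball 0 R) x + indicator (cball 0 (R + 1)) x * ennreal (H x)) \<partial>lborel)"
  proof (rule nn_integral_mono)
    fix x :: 'a
    show "ennreal (indicator (cball 0 R) x * norm (ball_average \<epsilon> W x - W x))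
      \<le> indicator (cball 0 R) x * (\<integral>\<^sup>+y. H (x + \<epsilon> *\<^sub>R y) \<partial>\<mu>) + (ennreal \<gamma> * indicator (cball 0 R) x + indicator (cball 0 (R + 1)) x * ennreal (H x))"
    proof (cases "norm x \<le> R")
      case True
      have "0 \<le> (\<integral>y. H (x + \<epsilon> *\<^sub>R y) \<partial>\<mu>)" using H by simp
      then have "(\<integral>\<^sup>+y. H (x + \<epsilon> *\<^sub>R y) \<partial>\<mu>) + (ennreal \<gamma> + ennreal (H x)) = ennreal ((\<integral>y. H (x + \<epsilon> *\<^sub>R y) \<partial>\<mu>) + \<gamma> + H x)"
        using \<open>\<gamma> > 0\<close> H(1)[of x] by (simp add: em[symmetric] add.assoc)
      then show ?thesis
        using True pt[OF True] by (simp add: ennreal_leI)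
    qed simp
  qed
  also have "\<dots> = (\<integral>\<^sup>+x. indicator (cball 0 R) x * (\<integral>\<^sup>+y. H (x + \<epsilon> *\<^sub>R y) \<partial>\<mu>) \<partial>lborel) + (ennreal \<gamma> * emeasure lborel (cball (0::'a) R) + ennreal (D m))"
    by (simp only: nn_integral_add[OF m1 borel_measurable_add[OF m2 m3]] nn_integral_add[OF m2 m3] D)
       (simp add: nn_integral_cmult_indicator)
  also have "\<dots> \<le> ennreal (D m) + (ennreal \<gamma> * ennreal v + ennreal (D m))"
    using t1 emeasure_compact_finite[OF compact_cball, of "0::'a" R]
    by (intro add_mono) (auto simp: v_def emeasure_eq_ennreal_measure less_top)
  also have "\<dots> = ennreal (D m + (\<gamma> * v + D m))"
    using D0 v0 \<open>\<gamma> > 0\<close>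
    by (simp only: ennreal_plus ennreal_mult mult_nonneg_nonneg add_nonneg_nonneg less_imp_le)
  also have "\<dots> \<le> ennreal \<eta>"
  proof (rule ennreal_leI)
    have "\<gamma> * v \<le> \<eta> / 3"
      using \<open>\<eta> > 0\<close> v0 by (simp add: \<gamma>_def field_simps)
    then show "D m + (\<gamma> * v + D m) \<le> \<eta>" using m by linarith
  qed
  finally show ?thesis using \<epsilon>(1) that by blast
qed

text \<open>Choosing the averaging radius so that the mean error on the ball of radius
  \<open>n\<close> is at most 1/(n+1) gives convergence almost everywhere along a subsequence, and
  the radial form survives the limit.\<close>

lemma equivariant_bounded_field_radial:
  fixes W :: "real^'n::{finite,wellorder} \<Rightarrow> real^'n::{finite,wellorder}"
  assumes W[measurable]: "W \<in> borel_measurable borel" and bd: "\<And>x. norm (W x) \<le> 1"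
    and G: "\<And>m. continuous_on UNIV (G m)" "\<And>m x. norm (G m x) \<le> 1"
      "AE x in lborel. (\<lambda>m. G m x) \<longlonglongrightarrow> W x"
    and eq: "\<And>T. orthogonal_transformation T \<Longrightarrow> AE x in lborel. W (T x) = T (W x)"
  obtains f :: "real \<Rightarrow> real" where "f \<in> borel_measurable borel"
    "AE x in lborel. W x = f (norm x) *\<^sub>R (x /\<^sub>R norm x)"
proof -
  have ex: "\<exists>\<epsilon>>0. (\<integral>\<^sup>+x. indicator (cball 0 (real n)) x * norm (ball_average \<epsilon> W x - W x) \<partial>lborel) \<le> ennreal (inverse (Suc n))" for n
    by (rule ball_average_L1_approx[OF W bd G, of "real n" "inverse (Suc n)"]) (simp, simp, blast)
  define \<epsilon> where "\<epsilon> n = (SOME \<epsilon>. \<epsilon> > 0 \<and> (\<integral>\<^sup>+x. indicator (cball 0 (real n)) x * norm (ball_average \<epsilon> W x - W x) \<partial>lborel) \<le> ennreal (inverse (Suc n)))" for n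
  have \<epsilon>: "\<epsilon> n > 0" "(\<integral>\<^sup>+x. indicator (cball 0 (real n)) x * norm (ball_average (\<epsilon> n) W x - W x) \<partial>lborel) \<le> ennreal (inverse (Suc n))" for n
    using someI_ex[OF ex[of n]] unfolding \<epsilon>_def by simp_all
  define A where "A n = ball_average (\<epsilon> n) W" for n
  have [measurable]: "A n \<in> borel_measurable borel" for n
    unfolding A_def by (rule ball_average_measurable[OF W])
  define u where "u n x = indicator (cball 0 (real n)) x * norm (A n x - W x)" for n and x :: "real^'n::{finite,wellorder}"
  have [measurable]: "u n \<in> borel_measurable borel" for n
    unfolding u_def
    by (intro borel_measurable_times borel_measurable_indicator borel_measurable_norm borel_measurable_diff) auto
  have u0: "u n x \<ge> 0" for n x
    by (simp add: u_def)
  have ub: "(\<integral>\<^sup>+x. u n x \<partial>lborel) \<le> ennreal (inverse (Suc n))" for n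
    using \<epsilon>(2)[of n] by (simp only: u_def A_def)
  have iu: "integrable lborel (u n)" for n
    by (rule integrableI_nonneg) (use u0 le_less_trans[OF ub ennreal_less_top] in auto)
  have "(\<integral>x. norm (u n x) \<partial>lborel) \<le> inverse (Suc n)" for n
  proof -
    have "ennreal (\<integral>x. u n x \<partial>lborel) \<le> ennreal (inverse (Suc n))"
      using ub[of n] nn_integral_eq_integral[OF iu, of n] u0 by simp
    then show ?thesis using u0 by (simp add: ennreal_le_iff)
  qed
  then have "(\<lambda>n. \<integral>x. norm (u n x) \<partial>lborel) \<longlonglongrightarrow> 0"
    by (intro tendsto_sandwich[OF _ _ tendsto_const LIMSEQ_inverse_real_of_nat]) auto
  then obtain r where r: "strict_mono r" "AE x in lborel. (\<lambda>n. u (r n) x) \<longlonglongrightarrow> 0"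
    using tendsto_L1_AE_subseq[of lborel u, OF iu] by blast
  define e :: "real^'n::{finite,wellorder}" where "e = axis undefined 1"
  have e: "norm e = 1" by (simp add: e_def)
  \<comment> \<open>A pointwise \<open>lim\<close> of measurable functions is measurable whether or
    not the limit exists, so the profile is Borel by construction; its value is identified only at
    radii of points where the averages converge.\<close>
  define f where "f t = lim (\<lambda>n. A (r n) (t *\<^sub>R e) \<bullet> e)" for t
  have "f \<in> borel_measurable borel"
    unfolding f_def by measurable
  moreover have "AE x in lborel. W x = f (norm x) *\<^sub>R (x /\<^sub>R norm x)"
    using r(2) AE_lborel_singleton[of 0]
  proof eventually_elim
    case (elim x)
    \<comment> \<open>A strictly increasing \<open>r\<close> satisfies \<open>r n \<ge> n\<close>,
      so the truncating ball eventually contains \<open>x\<close>.\<close>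
    have "\<forall>\<^sub>F n in sequentially. u (r n) x = norm (A (r n) x - W x)"
    proof (rule eventually_sequentiallyI)
      fix n assume "nat \<lceil>norm x\<rceil> \<le> n"
      then have "norm x \<le> real (r n)"
        using seq_suble[OF r(1), of n] by linarith
      then show "u (r n) x = norm (A (r n) x - W x)"
        by (simp add: u_def)
    qed
    with elim(1) have "(\<lambda>n. norm (A (r n) x - W x)) \<longlonglongrightarrow> 0"
      by (rule Lim_transform_eventually)
    then have lim: "(\<lambda>n. A (r n) x) \<longlonglongrightarrow> W x"
      by (simp add: tendsto_norm_zero_iff LIM_zero_iff)
    define k where "k n = A (r n) (norm x *\<^sub>R e) \<bullet> e" for n
    have Ak: "A (r n) x = k n *\<^sub>R (x /\<^sub>R norm x)" for n
      using equivariant_imp_radial[of "A (r n)" e x] elim(2) e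
        ball_average_equivariant[OF _ W \<epsilon>(1) bd eq] by (auto simp: A_def k_def)
    have "(\<lambda>n. A (r n) x \<bullet> (x /\<^sub>R norm x)) \<longlonglongrightarrow> W x \<bullet> (x /\<^sub>R norm x)"
      by (intro tendsto_intros lim)
    moreover have "(x /\<^sub>R norm x) \<bullet> (x /\<^sub>R norm x) = 1"
      using elim(2) by (simp add: dot_square_norm power2_eq_square)
    ultimately have kl: "k \<longlonglongrightarrow> W x \<bullet> (x /\<^sub>R norm x)"
      unfolding Ak inner_scaleR_left by simp
    then have fx: "f (norm x) = W x \<bullet> (x /\<^sub>R norm x)"
      unfolding f_def k_def[symmetric] by (rule limI)
    have "(\<lambda>n. A (r n) x) \<longlonglongrightarrow> (W x \<bullet> (x /\<^sub>R norm x)) *\<^sub>R (x /\<^sub>R norm x)"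
      unfolding Ak by (intro tendsto_scaleR tendsto_const kl)
    then show ?case
      unfolding fx by (rule LIMSEQ_unique[OF lim])
  qed
  ultimately show ?thesis by (rule that)
qed

text \<open>Reduction to bounded Borel fields: a map that rescales each vector by a function of its
  norm commutes with orthogonal maps, and it can be inverted at the end.\<close>

lemma equivariant_field_radial:
  fixes U :: "real^'n::{finite,wellorder} \<Rightarrow> real^'n::{finite,wellorder}"
  assumes U: "U \<in> borel_measurable lebesgue"
    and eq: "\<And>T. orthogonal_transformation T \<Longrightarrow> AE x in lebesgue. U (T x) = T (U x)"
  obtains f :: "real \<Rightarrow> real" where "f \<in> borel_measurable borel"
    "AE x in lebesgue. U x = f (norm x) *\<^sub>R (x /\<^sub>R norm x)"
proof -
  \<comment> \<open>A Lebesgue measurable field is a limit of continuous ones off a null set. They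
    yield both the Borel representative \<open>W\<close> and the approximants \<open>G\<close> that
    the averaging argument requires.\<close>
  have "U measurable_on UNIV"
    using U by (simp add: lebesgue_measurable_imp_measurable_on)
  then obtain N g where N: "negligible N" "\<And>n. continuous_on UNIV (g n)"
    "\<And>x. x \<notin> N \<Longrightarrow> (\<lambda>n. g n x) \<longlonglongrightarrow> U x"
    unfolding measurable_on_def by auto
  have g: "AE x in lebesgue. (\<lambda>n. g n x) \<longlonglongrightarrow> U x"
    using N(1) by (intro AE_I'[of N]) (auto simp: negligible_iff_null_sets intro: N(3))
  \<comment> \<open>\<open>b\<close> compresses the field into the unit ball, so that no integrability is needed for averaging.\<close>
  define b where "b v = v /\<^sub>R (1 + norm v)" for v :: "real^'n::{finite,wellorder}"
  have b1: "norm (b v) < 1" for v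
    by (simp add: b_def divide_inverse[symmetric] mult.commute[of "inverse _"] add_pos_nonneg)
  have binv: "v = b v /\<^sub>R (1 - norm (b v))" for v
  proof -
    have p: "1 + norm v > 0" by (simp add: add_pos_nonneg)
    then have "norm (b v) = norm v / (1 + norm v)"
      by (simp add: b_def divide_inverse mult.commute)
    then have "1 - norm (b v) = inverse (1 + norm v)"
      using p by (simp add: field_simps)
    then show ?thesis using p by (simp add: b_def)
  qed
  have bc: "continuous_on UNIV b"
    unfolding b_def by (intro continuous_intros) (metis add_pos_nonneg less_irrefl norm_ge_zero zero_less_one)
  define G where "G n x = b (g n x)" for n x
  have Gc: "continuous_on UNIV (G n)" for n
    unfolding G_def by (rule continuous_on_compose2[OF bc N(2)]) auto
  have [measurable]: "G n \<in> borel_measurable borel" for n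
    by (rule borel_measurable_continuous_onI[OF Gc])
  define L where "L x = lim (\<lambda>n. G n x)" for x
  \<comment> \<open>Where the sequence diverges the value of \<open>lim\<close> is unspecified; the
    case distinction makes the bound by 1 hold everywhere.\<close>
  define W where "W x = (if norm (L x) \<le> 1 then L x else 0)" for x
  have [measurable]: "L \<in> borel_measurable borel"
    unfolding L_def by measurable
  have Wm: "W \<in> borel_measurable borel"
    unfolding W_def by measurable
  have GU: "AE x in lebesgue. (\<lambda>n. G n x) \<longlonglongrightarrow> b (U x)"
    using g by eventually_elim
      (use bc in \<open>auto simp: G_def continuous_on_eq_continuous_at intro: isCont_tendsto_compose\<close>)
  then have WU: "AE x in lebesgue. W x = b (U x)"
    by eventually_elim (auto simp: W_def L_def limI b1 less_imp_le)
  have GW: "AE x in lebesgue. (\<lambda>n. G n x) \<longlonglongrightarrow> W x"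
    using GU WU by eventually_elim simp
  have Weq: "AE x in lborel. W (T x) = T (W x)" if T: "orthogonal_transformation T" for T
  proof -
    have lin: "linear T" using T by (simp add: orthogonal_transformation_linear)
    have "AE x in lborel. W (T x) = b (U (T x))"
      using AE_orthogonal[OF T] WU by (simp add: AE_completion_iff)
    moreover have "AE x in lborel. W x = b (U x)" "AE x in lborel. U (T x) = T (U x)"
      using WU eq[OF T] by (simp_all add: AE_completion_iff)
    ultimately show ?thesis
      by eventually_elim (simp add: b_def linear_cmul[OF lin] orthogonal_transformation_norm[OF T])
  qed
  obtain k :: "real \<Rightarrow> real" where k[measurable]: "k \<in> borel_measurable borel"
    "AE x in lborel. W x = k (norm x) *\<^sub>R (x /\<^sub>R norm x)"
  proof (rule equivariant_bounded_field_radial[OF Wm _ Gc _ _ Weq])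
    show "norm (W x) \<le> 1" for x by (simp add: W_def)
    show "norm (G m x) \<le> 1" for m x by (simp add: G_def b1 less_imp_le)
    show "AE x in lborel. (\<lambda>m. G m x) \<longlonglongrightarrow> W x" using GW by (simp add: AE_completion_iff)
  qed
  \<comment> \<open>The inverse of the compression is v / (1 - |v|), which turns the profile k into
    k / (1 - |k|).\<close>
  have "AE x in lebesgue. U x = (k (norm x) / (1 - \<bar>k (norm x)\<bar>)) *\<^sub>R (x /\<^sub>R norm x)"
    using AE_completion[OF k(2)] WU AE_completion[OF AE_lborel_singleton[of 0]]
  proof eventually_elim
    case (elim x)
    then have "b (U x) = k (norm x) *\<^sub>R (x /\<^sub>R norm x)" by simp
    moreover from this have "norm (b (U x)) = \<bar>k (norm x)\<bar>"
      using elim(3) by (simp add: abs_mult)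
    ultimately show ?case
      using binv[of "U x"] by (simp add: divide_inverse mult.commute)
  qed
  then show ?thesis
    by (rule that[rotated]) measurable
qed

section \<open>Local integrability and weak curls\<close>

text \<open>A Lebesgue measurable function composed with a Borel map need not be measurable. So
  \<open>s\<close> is changed on a null set of radii to a Borel function; by
  \<open>AE_radial\<close> this alters the composition only on a null set.\<close>

lemma radial_profile_measurable:
  fixes s :: "real \<Rightarrow> real"
  assumes "s \<in> borel_measurable (lebesgue_on {0<..})"
  shows "(\<lambda>x::'a::euclidean_space. s (norm x)) \<in> borel_measurable lebesgue"
proof -
  have "(\<lambda>r. indicator {0<..} r *\<^sub>R s r) \<in> borel_measurable lebesgue"
    using assms by (subst (asm) borel_measurable_restrict_space_iff) auto
  then obtain s' where s': "s' \<in> borel_measurable lborel" "AE r in lborel. indicator {0<..} r *\<^sub>R s r = s' r"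
    using completion_ex_borel_measurable_real by blast
  have "AE r in lborel. r > 0 \<longrightarrow> s' r = s r"
    using s'(2) by eventually_elim auto
  from AE_radial[OF this]
  have "AE x::'a in lborel. x \<noteq> 0 \<longrightarrow> s' (norm x) = s (norm x)" .
  with AE_lborel_singleton[of "0::'a"] have "AE x::'a in lborel. s' (norm x) = s (norm x)"
    by eventually_elim simp
  then have "AE x::'a in lebesgue. s' (norm x) = s (norm x)"
    by (rule AE_completion)
  moreover have "(\<lambda>x::'a. s' (norm x)) \<in> borel_measurable borel"
    using s'(1) by measurable
  then have "(\<lambda>x::'a. s' (norm x)) \<in> borel_measurable lebesgue"
    by (simp add: measurable_completion)
  ultimately show ?thesis
    by (rule borel_measurable_AE[rotated])
qed

lemma compact_emeasure_lebesgue: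
  assumes "compact K"
  shows "K \<in> sets lebesgue" "emeasure lebesgue K < \<infinity>"
  using fmeasurableD[OF lmeasurable_compact[OF assms]] fmeasurableD2[OF lmeasurable_compact[OF assms]]
  by (simp_all only: less_top infinity_ennreal_def not_False_eq_True)

lemma integrable_lebesgue_on_compact:
  fixes f :: "'a::euclidean_space \<Rightarrow> 'b::euclidean_space"
  assumes "compact K"
  shows "integrable (lebesgue_on K) f \<longleftrightarrow> set_integrable lebesgue K f"
  unfolding set_integrable_def
  by (rule integrable_restrict_space) (use compact_emeasure_lebesgue(1)[OF assms] in simp)

lemma set_integrable_compact_bound:
  fixes f :: "'a::euclidean_space \<Rightarrow> 'b::euclidean_space" and g :: "'a \<Rightarrow> real"
  assumes "compact K" "set_integrable lebesgue K g" "f \<in> borel_measurable lebesgue"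
    and "AE x in lebesgue. x \<in> K \<longrightarrow> norm (f x) \<le> g x"
  shows "set_integrable lebesgue K f"
  unfolding set_integrable_def
proof (rule Bochner_Integration.integrable_bound)
  show "integrable lebesgue (\<lambda>x. indicator K x *\<^sub>R g x)"
    using assms(2) by (simp add: set_integrable_def)
  show "(\<lambda>x. indicator K x *\<^sub>R f x) \<in> borel_measurable lebesgue"
    using assms(3) compact_emeasure_lebesgue[OF assms(1)]
    by (intro borel_measurable_scaleR borel_measurable_indicator) auto
  show "AE x in lebesgue. norm (indicator K x *\<^sub>R f x) \<le> norm (indicator K x *\<^sub>R g x)"
    using assms(4) by eventually_elim (auto simp: indicator_def)
qed

lemma set_integrable_const_compact:
  "compact K \<Longrightarrow> set_integrable lebesgue K (\<lambda>_. c :: real)"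
  unfolding set_integrable_def
  by (intro integrable_scaleR_left integrable_real_indicator compact_emeasure_lebesgue)

lemma Lp_locD:
  assumes "U \<in> Lp_loc q" "compact K"
  shows "U \<in> borel_measurable lebesgue" "set_integrable lebesgue K (\<lambda>x. norm (U x) powr q)"
  unfolding integrable_lebesgue_on_compact[OF assms(2), symmetric]
  using assms unfolding Lp_loc_def by blast+

lemma Lp_loc_set_integrable:
  assumes "U \<in> Lp_loc q" "q \<ge> 1" "compact K"
  shows "set_integrable lebesgue K U"
proof (rule set_integrable_compact_bound[OF assms(3)])
  show "set_integrable lebesgue K (\<lambda>x. 1 + norm (U x) powr q)"
    using Lp_locD[OF assms(1,3)] set_integrable_const_compact[OF assms(3)] by (intro set_integral_add)
  have "norm (U x) \<le> 1 + norm (U x) powr q" for x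
  proof (cases "norm (U x) \<le> 1")
    case True
    then show ?thesis using powr_ge_zero[of "norm (U x)" q] by linarith
  next
    case False
    then have "norm (U x) powr 1 \<le> norm (U x) powr q"
      using assms(2) by (intro powr_mono) auto
    then show ?thesis using False by simp
  qed
  then show "AE x in lebesgue. x \<in> K \<longrightarrow> norm (U x) \<le> 1 + norm (U x) powr q"
    by simp
qed (rule Lp_locD[OF assms(1,3)])

lemma Lp_loc_1I:
  fixes U :: "'a::euclidean_space \<Rightarrow> 'b::euclidean_space"
  assumes "U \<in> borel_measurable lebesgue" "\<And>K. compact K \<Longrightarrow> set_integrable lebesgue K U"
  shows "U \<in> Lp_loc 1"
proof -
  have "integrable (lebesgue_on K) (\<lambda>x. norm (U x) powr 1)" if "compact K" for K
    using assms(2)[OF that] integrable_norm[of "lebesgue_on K" U]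
    by (simp add: integrable_lebesgue_on_compact[OF that, symmetric])
  with assms(1) show ?thesis by (simp add: Lp_loc_def)
qed

lemma Lp_loc_imp_Lp_loc_1: "U \<in> Lp_loc q \<Longrightarrow> q \<ge> 1 \<Longrightarrow> U \<in> Lp_loc 1"
  by (rule Lp_loc_1I[OF Lp_locD(1)[OF _ compact_empty]]) (assumption, rule Lp_loc_set_integrable)

lemma integrable_inner_test_field:
  assumes U: "U \<in> borel_measurable lebesgue" "\<And>K. compact K \<Longrightarrow> set_integrable lebesgue K U"
    and \<phi>: "\<phi> \<in> test_fields"
  shows "integrable lebesgue (\<lambda>x. U x \<bullet> \<phi> x)"
proof -
  obtain K B where K: "compact K" "\<And>x. norm (\<phi> x) \<le> B * indicator K x" "B \<ge> 0"
    using \<phi> by (rule test_fields_boundedE) blast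
  have [measurable]: "\<phi> \<in> borel_measurable lebesgue" "U \<in> borel_measurable lebesgue"
    using test_fields_continuous_measurable(2)[OF \<phi>] U by (auto intro: measurable_completion)
  show ?thesis
  proof (rule Bochner_Integration.integrable_bound)
    show "integrable lebesgue (\<lambda>x. B * norm (indicator K x *\<^sub>R U x))"
      using U(2)[OF K(1)] by (intro integrable_mult_right integrable_norm) (simp add: set_integrable_def)
    show "AE x in lebesgue. norm (U x \<bullet> \<phi> x) \<le> norm (B * norm (indicator K x *\<^sub>R U x))"
    proof (rule AE_I2)
      fix x
      have "norm (U x \<bullet> \<phi> x) \<le> norm (U x) * norm (\<phi> x)"
        by (simp add: Cauchy_Schwarz_ineq2)
      also have "\<dots> \<le> norm (U x) * (B * indicator K x)"
        by (intro mult_left_mono K) auto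
      finally show "norm (U x \<bullet> \<phi> x) \<le> norm (B * norm (indicator K x *\<^sub>R U x))"
        using K(3) by (simp add: mult_ac)
    qed
  qed measurable
qed

section \<open>Uniqueness and linearity of weak curls\<close>

lemma weak_curl_unique:
  assumes "has_weak_curl U W" "has_weak_curl U W'"
  shows "AE x in lebesgue. W x = W' x"
proof -
  have W: "W \<in> Lp_loc 1" "W' \<in> Lp_loc 1" 
    using assms by (auto simp: has_weak_curl_def)
  note m = Lp_locD(1)[OF W(1) compact_empty] Lp_locD(1)[OF W(2) compact_empty]
  note i = Lp_loc_set_integrable[OF W(1) order_refl] Lp_loc_set_integrable[OF W(2) order_refl]
  have "AE x in lebesgue. W x - W' x = 0"
  proof (rule fundamental_lemma_test_fields)
    show "(\<lambda>x. W x - W' x) \<in> borel_measurable lebesgue"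
      using m by (rule borel_measurable_diff)
    show "set_integrable lebesgue K (\<lambda>x. W x - W' x)" if "compact K" for K
      using i[OF that] by (rule set_integral_diff)
    show "(\<integral>x. (W x - W' x) \<bullet> \<phi> x \<partial>lebesgue) = 0" if "\<phi> \<in> test_fields" for \<phi>
      using assms that integrable_inner_test_field[OF m(1) i(1) that] integrable_inner_test_field[OF m(2) i(2) that]
      by (simp add: inner_diff_left has_weak_curl_def)
  qed
  then show ?thesis by eventually_elim simp
qed

lemma has_weak_curl_add_scaleR:
  assumes "has_weak_curl U W" "has_weak_curl \<phi> C"
  shows "has_weak_curl (\<lambda>x. U x + t *\<^sub>R \<phi> x) (\<lambda>x. W x + t *\<^sub>R C x)"
proof -
  have L: "U \<in> Lp_loc 1" "W \<in> Lp_loc 1" "\<phi> \<in> Lp_loc 1" "C \<in> Lp_loc 1" 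
    using assms by (auto simp: has_weak_curl_def)
  note m = L[THEN Lp_locD(1)[OF _ compact_empty]]
  note i = L[THEN Lp_loc_set_integrable[OF _ order_refl]]
  have lin: "(\<lambda>x. A x + t *\<^sub>R B x) \<in> Lp_loc 1" if "A \<in> Lp_loc 1" "B \<in> Lp_loc 1" for A B :: "real^3 \<Rightarrow> real^3"
  proof (rule Lp_loc_1I)
    show "(\<lambda>x. A x + t *\<^sub>R B x) \<in> borel_measurable lebesgue"
      using that[THEN Lp_locD(1)[OF _ compact_empty]] by measurable
    show "set_integrable lebesgue K (\<lambda>x. A x + t *\<^sub>R B x)" if "compact K" for K
      using Lp_loc_set_integrable[OF \<open>A \<in> Lp_loc 1\<close> order_refl that] Lp_loc_set_integrable[OF \<open>B \<in> Lp_loc 1\<close> order_refl that]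
      by (intro set_integral_add set_integrable_scaleR_right)
  qed
  show ?thesis
    unfolding has_weak_curl_def
  proof (intro conjI lin L ballI)
    fix \<psi> assume \<psi>: "\<psi> \<in> test_fields"
    note \<psi>' = curl_test_fields[OF \<psi>]
    show "(\<integral>x. (U x + t *\<^sub>R \<phi> x) \<bullet> curl \<psi> x \<partial>lebesgue) = (\<integral>x. (W x + t *\<^sub>R C x) \<bullet> \<psi> x \<partial>lebesgue)"
      using assms \<psi> integrable_inner_test_field[OF m(1) i(1) \<psi>'] integrable_inner_test_field[OF m(3) i(3) \<psi>']
        integrable_inner_test_field[OF m(2) i(2) \<psi>] integrable_inner_test_field[OF m(4) i(4) \<psi>]
      by (simp add: inner_add_left has_weak_curl_def)
  qed
qed

lemma weak_curl_AE_eq: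
  assumes "has_weak_curl U W" "W \<in> L2"
  shows "AE x in lebesgue. weak_curl U x = W x" "weak_curl U \<in> L2" "has_weak_curl U (weak_curl U)"
proof -
  have "weak_curl U \<in> L2 \<and> has_weak_curl U (weak_curl U)"
    unfolding weak_curl_def by (rule someI[of _ W]) (use assms in simp)
  then show "weak_curl U \<in> L2" "has_weak_curl U (weak_curl U)" by auto
  then show "AE x in lebesgue. weak_curl U x = W x"
    using weak_curl_unique assms(1) by blast
qed

lemma radial_field_weak_curl_0:
  fixes f :: "real \<Rightarrow> real"
  assumes U: "U \<in> Lp_loc 1" and f: "f \<in> borel_measurable borel"
    and eq: "AE x in lebesgue. U x = f (norm x) *\<^sub>R (x /\<^sub>R norm x)"
  shows "has_weak_curl U (\<lambda>x. 0)"
  unfolding has_weak_curl_def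
proof (intro conjI ballI U)
  show "(\<lambda>x::real^3. 0::real^3) \<in> Lp_loc 1"
    by (simp add: Lp_loc_def)
  fix \<phi> assume \<phi>: "\<phi> \<in> test_fields"
  define R where "R x = (f (norm x) *\<^sub>R (x /\<^sub>R norm x)) \<bullet> curl \<phi> x" for x
  have [measurable]: "curl \<phi> \<in> borel_measurable borel"
    using test_fields_continuous_measurable(2) curl_test_fields[OF \<phi>] by auto
  have Rm: "R \<in> borel_measurable lborel"
    unfolding R_def using f by measurable
  note Rm' = measurable_completion[OF Rm]
  have "curl \<phi> \<in> borel_measurable lebesgue"
    by (rule measurable_completion) simp
  then have Um: "(\<lambda>x. U x \<bullet> curl \<phi> x) \<in> borel_measurable lebesgue"
    by (rule borel_measurable_inner[OF Lp_locD(1)[OF U compact_empty]])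
  have eq': "AE x in lebesgue. U x \<bullet> curl \<phi> x = R x"
    using eq by eventually_elim (simp only: R_def)
  have "integrable lebesgue (\<lambda>x. U x \<bullet> curl \<phi> x)"
    by (rule integrable_inner_test_field[OF Lp_locD(1)[OF U compact_empty] Lp_loc_set_integrable[OF U order_refl] curl_test_fields[OF \<phi>]])
  then have "integrable lebesgue R"
    by (rule integrable_cong_AE[OF Um Rm' eq', THEN iffD1])
  then have "integrable lborel R"
    by (rule integrable_completion[OF Rm, THEN iffD1])
  then have "(\<integral>x. R x \<partial>lborel) = 0"
    unfolding R_def by (rule integral_radial_inner_curl_eq_0[OF \<phi> f])
  then show "(\<integral>x. U x \<bullet> curl \<phi> x \<partial>lebesgue) = (\<integral>x. 0 \<bullet> \<phi> x \<partial>lebesgue)"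
    using integral_cong_AE[OF Um Rm' eq'] integral_completion[OF Rm] by simp
qed

text \<open>Moving the transposed matrix to the other side gives equivariance, the form suited to
  changes of variables and averages.\<close>

lemma O3_symmetric_iff:
  "O3_symmetric U \<longleftrightarrow> (\<forall>T. orthogonal_transformation T \<longrightarrow> (AE x in lebesgue. U (T x) = T (U x)))"
proof -
  have *: "u = transpose M *v w \<longleftrightarrow> w = M *v u" if "orthogonal_matrix M" for M :: "real^3^3" and u w
  proof -
    have "transpose M ** M = mat 1" "M ** transpose M = mat 1"
      using that by (auto simp: orthogonal_matrix_def)
    then show ?thesis
      by (metis matrix_vector_mul_assoc matrix_vector_mul_lid)
  qed
  show ?thesis
  proof
    assume U: "O3_symmetric U"
    show "\<forall>T. orthogonal_transformation T \<longrightarrow> (AE x in lebesgue. U (T x) = T (U x))"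
    proof (intro allI impI)
      fix T :: "real^3 \<Rightarrow> real^3" assume T: "orthogonal_transformation T"
      then have M: "orthogonal_matrix (matrix T)" and l: "linear T"
        by (auto simp: orthogonal_transformation_matrix)
      have "AE x in lebesgue. U x = transpose (matrix T) *v U (matrix T *v x)"
        using U M by (simp add: O3_symmetric_def)
      then show "AE x in lebesgue. U (T x) = T (U x)"
        by eventually_elim (simp only: *[OF M] matrix_works[OF l[folded linear_matrix_vector_mul_eq]])
    qed
  next
    assume U: "\<forall>T. orthogonal_transformation T \<longrightarrow> (AE x in lebesgue. U (T x) = T (U x))"
    show "O3_symmetric U"
      unfolding O3_symmetric_def
    proof (intro allI impI)
      fix M :: "real^3^3" assume M: "orthogonal_matrix M"
      then have "orthogonal_transformation ((*v) M)"
        unfolding orthogonal_transformation_matrix by simp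
      with U have "AE x in lebesgue. U (M *v x) = M *v U x" by blast
      then show "AE x in lebesgue. U x = transpose M *v U (M *v x)"
        by eventually_elim (simp only: *[OF M])
    qed
  qed
qed

section \<open>Differentiating the power nonlinearity\<close>

text \<open>The mean value theorem, with the derivative at the intermediate point bounded by
  monotonicity; for \<open>a = 0\<close> the estimate is read off from b^q = b^(q-1) b
  instead.\<close>

lemma powr_diff_le:
  fixes a b q :: real
  assumes "0 \<le> a" "a \<le> b" "q \<ge> 1"
  shows "b powr q - a powr q \<le> q * b powr (q - 1) * (b - a)"
proof -
  consider "a = b" | "a = 0" "b > 0" | "0 < a" "a < b" using assms by linarith
  then show ?thesis
  proof cases
    case 2
    then have "b powr q = b powr (q - 1) * b"
      by (simp add: powr_mult_base mult.commute)
    also have "\<dots> \<le> q * (b powr (q - 1) * b)"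
      using mult_right_mono[of 1 q "b powr (q - 1) * b"] assms 2 by simp
    finally show ?thesis using 2 by (simp add: mult.assoc)
  next
    case 3
    have "((\<lambda>x. x powr q) has_real_derivative q * x powr (q - 1)) (at x)" if "a \<le> x" for x
      using that 3 by (intro has_real_derivative_powr) auto
    then obtain z where z: "a < z" "z < b" "b powr q - a powr q = (b - a) * (q * z powr (q - 1))"
      using MVT2[of a b "\<lambda>x. x powr q" "\<lambda>x. q * x powr (q - 1)"] 3 by auto
    have "z powr (q - 1) \<le> b powr (q - 1)"
      using z 3 assms by (intro powr_mono2) auto
    then have "(b - a) * (q * z powr (q - 1)) \<le> (b - a) * (q * b powr (q - 1))"
      using 3 assms by (intro mult_left_mono) auto
    with z show ?thesis by (simp add: mult_ac)
  qed auto
qed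

text \<open>Provides the dominating function for difference quotients: the bound is linear in |t|
  and its other factors do not depend on t.\<close>

lemma norm_powr_lipschitz:
  fixes u v :: "'a::real_normed_vector"
  assumes "q \<ge> 1" "\<bar>t\<bar> \<le> 1"
  shows "\<bar>norm (u + t *\<^sub>R v) powr q - norm u powr q\<bar> \<le> q * (norm u + norm v) powr (q - 1) * (\<bar>t\<bar> * norm v)"
proof -
  have tv: "\<bar>t\<bar> * norm v \<le> norm v"
    using assms(2) by (simp add: mult_left_le_one_le)
  have d: "\<bar>norm (u + t *\<^sub>R v) - norm u\<bar> \<le> \<bar>t\<bar> * norm v"
    using norm_triangle_ineq3[of "u + t *\<^sub>R v" u] by simp
  have gen: "b powr q - a powr q \<le> q * (norm u + norm v) powr (q - 1) * (\<bar>t\<bar> * norm v)"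
    if "0 \<le> a" "a \<le> b" "b \<le> norm u + norm v" "b - a \<le> \<bar>t\<bar> * norm v" for a b
  proof -
    have "b powr q - a powr q \<le> q * b powr (q - 1) * (b - a)"
      by (rule powr_diff_le) (use that assms in auto)
    also have "\<dots> \<le> q * (norm u + norm v) powr (q - 1) * (\<bar>t\<bar> * norm v)"
      using that assms by (intro mult_mono powr_mono2) auto
    finally show ?thesis .
  qed
  have pm: "a powr q \<le> b powr q" if "0 \<le> a" "a \<le> b" for a b
    using that assms by (intro powr_mono2) auto
  show ?thesis
  proof (cases "norm u \<le> norm (u + t *\<^sub>R v)")
    case True
    then show ?thesis
      using gen[of "norm u" "norm (u + t *\<^sub>R v)"] pm[of "norm u" "norm (u + t *\<^sub>R v)"] d tv by simp
  next
    case False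
    then show ?thesis
      using gen[of "norm (u + t *\<^sub>R v)" "norm u"] pm[of "norm (u + t *\<^sub>R v)" "norm u"] d tv by simp
  qed
qed

text \<open>For u \<noteq> 0 the power is a smooth function of the polynomial \<open>N t\<close>,
  which is positive at 0. For u = 0 the quotient is bounded by |t|^(q-1) |v|^q, which tends to 0 as
  q > 1 and agrees with the formula because u \<bullet> v = 0.\<close>

lemma norm_powr_line_derivative:
  fixes u v :: "'a::real_inner"
  assumes "q > 1"
  shows "((\<lambda>t. (norm (u + t *\<^sub>R v) powr q - norm u powr q) / t) \<longlongrightarrow> q * norm u powr (q - 2) * (u \<bullet> v)) (at 0)"
proof (cases "u = 0")
  case True
  have "((\<lambda>t. \<bar>t\<bar> powr (q - 1) * norm v powr q) \<longlongrightarrow> \<bar>0\<bar> powr (q - 1) * norm v powr q) (at 0)"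
    using assms by (intro tendsto_mult tendsto_powr2 tendsto_rabs tendsto_const tendsto_ident_at) auto
  then have l: "((\<lambda>t. \<bar>t\<bar> powr (q - 1) * norm v powr q) \<longlongrightarrow> 0) (at 0)"
    using assms by simp
  have "\<forall>\<^sub>F t in at 0. norm (norm (t *\<^sub>R v) powr q / t) \<le> \<bar>t\<bar> powr (q - 1) * norm v powr q"
  proof (rule eventually_at_topological[THEN iffD2], intro exI[of _ UNIV] conjI ballI impI)
    fix t :: real assume "t \<noteq> 0"
    then have "\<bar>t\<bar> powr q = \<bar>t\<bar> powr (q - 1) * \<bar>t\<bar>"
      by (simp add: powr_mult_base mult.commute)
    then show "norm (norm (t *\<^sub>R v) powr q / t) \<le> \<bar>t\<bar> powr (q - 1) * norm v powr q"
      using \<open>t \<noteq> 0\<close> by (simp add: powr_mult)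
  qed auto
  from Lim_null_comparison[OF this l] show ?thesis
    using True by simp
next
  case False
  define N where "N t = (u + t *\<^sub>R v) \<bullet> (u + t *\<^sub>R v)" for t
  have N0: "N 0 > 0" using False by (simp add: N_def)
  have nq: "norm w powr r = (w \<bullet> w) powr (r / 2)" for w :: 'a and r
    by (simp add: norm_eq_sqrt_inner powr_half_sqrt[symmetric] powr_powr)
  have "(N has_real_derivative 2 * (u \<bullet> v)) (at 0)"
    unfolding N_def by (auto intro!: derivative_eq_intros simp: has_field_derivative_def inner_commute)
  then have "((\<lambda>t. N t powr (q / 2)) has_real_derivative (q / 2) * N 0 powr (q / 2 - 1) * (2 * (u \<bullet> v))) (at 0)"
    using N0 by (auto intro!: derivative_eq_intros DERIV_fun_powr)
  moreover have "(q / 2) * N 0 powr (q / 2 - 1) * (2 * (u \<bullet> v)) = q * norm u powr (q - 2) * (u \<bullet> v)"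
  proof -
    have e: "(q - 2) / 2 = q / 2 - 1" by simp
    show ?thesis unfolding N_def nq e by simp
  qed
  ultimately have "((\<lambda>t. (N t powr (q / 2) - N 0 powr (q / 2)) / t) \<longlongrightarrow> q * norm u powr (q - 2) * (u \<bullet> v)) (at 0)"
    by (simp only: has_field_derivative_iff diff_0_right add_0)
  then show ?thesis
    by (simp add: nq[of _ q] N_def)
qed

lemma norm_add_powr_le:
  fixes u v :: "'a::real_normed_vector"
  assumes "q \<ge> 0"
  shows "(norm u + norm v) powr q \<le> 2 powr q * (norm u powr q + norm v powr q)"
proof -
  have "(norm u + norm v) powr q \<le> (2 * max (norm u) (norm v)) powr q"
    using assms by (intro powr_mono2) auto
  also have "\<dots> = 2 powr q * max (norm u) (norm v) powr q"
    by (simp add: powr_mult)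
  also have "max (norm u) (norm v) powr q \<le> norm u powr q + norm v powr q"
    by (simp add: max_def)
  finally show ?thesis by simp
qed

text \<open>Dominated convergence applied to difference quotients. Their bound needs |t| \<le> 1, so
  the limit is first taken within \<open>{-1..1}\<close>, a neighbourhood of 0.\<close>

lemma integral_norm_powr_has_derivative:
  fixes U \<phi> :: "'a \<Rightarrow> 'b::euclidean_space" and w :: "'a \<Rightarrow> real"
  assumes [measurable]: "U \<in> borel_measurable M" "\<phi> \<in> borel_measurable M" "w \<in> borel_measurable M"
    and q: "q > 1"
    and int: "integrable M (\<lambda>x. \<bar>w x\<bar> * norm (U x) powr q)" "integrable M (\<lambda>x. \<bar>w x\<bar> * norm (\<phi> x) powr q)"
  shows "((\<lambda>t. \<integral>x. w x * norm (U x + t *\<^sub>R \<phi> x) powr q \<partial>M) has_real_derivative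
      (\<integral>x. w x * (q * norm (U x) powr (q - 2) * (U x \<bullet> \<phi> x)) \<partial>M)) (at 0)"
proof -
  \<comment> \<open>The factor \<open>2 powr q\<close> comes from (a + b)^q \<le> 2^q (a^q + b^q),
    which makes |w| (|U| + |\<phi>|)^q integrable.\<close>
  define D where "D x = 2 powr q * (\<bar>w x\<bar> * norm (U x) powr q + \<bar>w x\<bar> * norm (\<phi> x) powr q)" for x
  have iD: "integrable M D"
    unfolding D_def using int by auto
  have D0: "\<bar>w x\<bar> * (norm (U x) + norm (\<phi> x)) powr q \<le> D x" for x
    using mult_left_mono[OF norm_add_powr_le[of q "U x" "\<phi> x"], of "\<bar>w x\<bar>"] q
    by (simp add: D_def algebra_simps)
  have i: "integrable M (\<lambda>x. w x * norm (U x + t *\<^sub>R \<phi> x) powr q)" if "\<bar>t\<bar> \<le> 1" for t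
  proof (rule Bochner_Integration.integrable_bound[OF iD])
    have "\<bar>w x\<bar> * norm (U x + t *\<^sub>R \<phi> x) powr q \<le> \<bar>D x\<bar>" for x
    proof -
      have "norm (U x + t *\<^sub>R \<phi> x) \<le> norm (U x) + norm (\<phi> x)"
        using norm_triangle_ineq[of "U x" "t *\<^sub>R \<phi> x"] mult_left_le_one_le[of "norm (\<phi> x)" "\<bar>t\<bar>"] that by simp
      then have "\<bar>w x\<bar> * norm (U x + t *\<^sub>R \<phi> x) powr q \<le> \<bar>w x\<bar> * (norm (U x) + norm (\<phi> x)) powr q"
        using q by (intro mult_left_mono powr_mono2) auto
      then show ?thesis using D0[of x] by linarith
    qed
    then show "AE x in M. norm (w x * norm (U x + t *\<^sub>R \<phi> x) powr q) \<le> norm (D x)"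
      by (intro AE_I2) (simp add: abs_mult)
  qed measurable
  have "((\<lambda>t. ((\<integral>x. w x * norm (U x + t *\<^sub>R \<phi> x) powr q \<partial>M) - (\<integral>x. w x * norm (U x) powr q \<partial>M)) / t) \<longlongrightarrow>
      (\<integral>x. w x * (q * norm (U x) powr (q - 2) * (U x \<bullet> \<phi> x)) \<partial>M)) (at 0 within {-1..1})"
    unfolding tendsto_at_iff_sequentially comp_def
  proof (intro allI impI)
    fix X :: "nat \<Rightarrow> real" assume X: "\<forall>i. X i \<in> {-1..1} - {0}" "X \<longlonglongrightarrow> 0"
    have X1: "\<bar>X n\<bar> \<le> 1" "X n \<noteq> 0" for n using X(1) by (auto simp: abs_le_iff)
    have "(\<lambda>n. \<integral>x. w x * ((norm (U x + X n *\<^sub>R \<phi> x) powr q - norm (U x) powr q) / X n) \<partial>M)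
      \<longlonglongrightarrow> (\<integral>x. w x * (q * norm (U x) powr (q - 2) * (U x \<bullet> \<phi> x)) \<partial>M)"
    proof (rule integral_dominated_convergence[where w="\<lambda>x. q * D x"])
      show "integrable M (\<lambda>x. q * D x)" using iD by simp
      have "filterlim X (at 0) sequentially"
        using X by (auto simp: filterlim_at)
      then have "(\<lambda>n. (norm (U x + X n *\<^sub>R \<phi> x) powr q - norm (U x) powr q) / X n) \<longlonglongrightarrow> q * norm (U x) powr (q - 2) * (U x \<bullet> \<phi> x)" for x
        by (rule filterlim_compose[OF norm_powr_line_derivative[OF q]])
      then show "AE x in M. (\<lambda>n. w x * ((norm (U x + X n *\<^sub>R \<phi> x) powr q - norm (U x) powr q) / X n)) \<longlonglongrightarrow> w x * (q * norm (U x) powr (q - 2) * (U x \<bullet> \<phi> x))"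
        by (intro AE_I2 tendsto_mult tendsto_const)
      show "AE x in M. norm (w x * ((norm (U x + X n *\<^sub>R \<phi> x) powr q - norm (U x) powr q) / X n)) \<le> q * D x" for n
      proof (rule AE_I2)
        fix x
        let ?s = "norm (U x) + norm (\<phi> x)"
        have "\<bar>norm (U x + X n *\<^sub>R \<phi> x) powr q - norm (U x) powr q\<bar> / \<bar>X n\<bar> \<le> q * ?s powr (q - 1) * (\<bar>X n\<bar> * norm (\<phi> x)) / \<bar>X n\<bar>"
          by (intro divide_right_mono norm_powr_lipschitz) (use q X1 in auto)
        also have "\<dots> = q * (?s powr (q - 1) * norm (\<phi> x))"
          using X1(2)[of n] by simp
        also have "\<dots> \<le> q * (?s powr (q - 1) * ?s)"
          using q by (intro mult_left_mono) auto
        also have "?s powr (q - 1) * ?s = ?s powr q"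
          by (cases "?s = 0") (simp_all add: powr_mult_base mult.commute add_nonneg_eq_0_iff)
        finally have "\<bar>w x\<bar> * (\<bar>norm (U x + X n *\<^sub>R \<phi> x) powr q - norm (U x) powr q\<bar> / \<bar>X n\<bar>) \<le> \<bar>w x\<bar> * (q * ?s powr q)"
          by (intro mult_left_mono) auto
        also have "\<dots> = q * (\<bar>w x\<bar> * ?s powr q)" by simp
        also have "\<dots> \<le> q * D x"
          using q D0 by (intro mult_left_mono) auto
        finally show "norm (w x * ((norm (U x + X n *\<^sub>R \<phi> x) powr q - norm (U x) powr q) / X n)) \<le> q * D x"
          by (simp add: abs_mult)
      qed
    qed measurable
    moreover have "(\<integral>x. w x * ((norm (U x + X n *\<^sub>R \<phi> x) powr q - norm (U x) powr q) / X n) \<partial>M)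
      = ((\<integral>x. w x * norm (U x + X n *\<^sub>R \<phi> x) powr q \<partial>M) - (\<integral>x. w x * norm (U x) powr q \<partial>M)) / X n" for n
    proof -
      have "(\<integral>x. w x * norm (U x + X n *\<^sub>R \<phi> x) powr q \<partial>M) - (\<integral>x. w x * norm (U x) powr q \<partial>M)
        = (\<integral>x. w x * norm (U x + X n *\<^sub>R \<phi> x) powr q - w x * norm (U x) powr q \<partial>M)"
        using i[OF X1(1)[of n]] i[of 0] by simp
      also have "\<dots> / X n = (\<integral>x. (w x * norm (U x + X n *\<^sub>R \<phi> x) powr q - w x * norm (U x) powr q) / X n \<partial>M)"
        by simp
      finally show ?thesis
        by (simp only: right_diff_distrib times_divide_eq_right)
    qed
    ultimately show "(\<lambda>n. ((\<integral>x. w x * norm (U x + X n *\<^sub>R \<phi> x) powr q \<partial>M) - (\<integral>x. w x * norm (U x) powr q \<partial>M)) / X n)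
      \<longlonglongrightarrow> (\<integral>x. w x * (q * norm (U x) powr (q - 2) * (U x \<bullet> \<phi> x)) \<partial>M)"
      by (simp only:)
  qed
  moreover have "at 0 within {-1..1} = at (0::real)"
    by (rule at_within_Icc_at) auto
  ultimately show ?thesis
    by (simp add: has_field_derivative_iff)
qed

section \<open>Stationarity of the functional\<close>

lemma norm_add_scaleR_power2:
  fixes u v :: "'a::real_inner"
  shows "(norm (u + t *\<^sub>R v))\<^sup>2 = (norm u)\<^sup>2 + 2 * t * (u \<bullet> v) + t\<^sup>2 * (norm v)\<^sup>2"
  unfolding power2_norm_eq_inner
  by (simp add: inner_add_left inner_add_right inner_commute[of v u] power2_eq_square[of t] algebra_simps)

text \<open>Along a line through \<open>U\<close> the functional is a quadratic polynomial in t
  minus 1/q times a power integral. This splitting requires every coefficient to be an integral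
  converging on its own, which is extracted from the whole line lying in the domain.\<close>

lemma critical_point_J_if_pointwise:
  assumes p: "p > 1" and m: "V \<in> borel_measurable lebesgue" "\<Gamma> \<in> borel_measurable lebesgue"
    and UX: "U \<in> X_space p \<Gamma>" and wc: "has_weak_curl U (\<lambda>x. 0)"
    and pt: "AE x in lebesgue. V x *\<^sub>R U x = (\<Gamma> x * norm (U x) powr (p - 1)) *\<^sub>R U x"
  shows "critical_point_J p V \<Gamma> U"
proof -
  have z: "(\<lambda>x. 0) \<in> L2" by (simp add: L2_def)
  define q where "q = p + 1"
  have q: "q > 1" "q \<noteq> 0" using p by (auto simp: q_def)
  note wU = weak_curl_AE_eq[OF wc z]
  have Um[measurable]: "U \<in> borel_measurable lebesgue"
    using UX by (simp add: X_space_def Hcurl_def L2_def)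
  note m[measurable]
  have signed: "integrable lebesgue (\<lambda>x. \<Gamma> x * norm (F x) powr q)"
    if "F \<in> X_space p \<Gamma>" for F
  proof (rule Bochner_Integration.integrable_bound)
    show "integrable lebesgue (\<lambda>x. \<bar>\<Gamma> x\<bar> * norm (F x) powr q)"
      using that by (simp add: X_space_def Lp_weighted_def q_def)
    have "F \<in> borel_measurable lebesgue"
      using that by (simp add: X_space_def Hcurl_def L2_def)
    then show "(\<lambda>x. \<Gamma> x * norm (F x) powr q) \<in> borel_measurable lebesgue"
      by measurable
  qed (simp add: abs_mult)
  have powr_split: "norm u powr q = norm u powr (p - 1) * (norm u)\<^sup>2" for u :: "real^3"
    by (cases "u = 0") (simp_all add: q_def powr_add[symmetric] add.commute flip: powr_numeral)
  have VU: "AE x in lebesgue. V x * (norm (U x))\<^sup>2 = \<Gamma> x * norm (U x) powr q"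
    using pt
  proof eventually_elim
    case (elim x)
    then have "(V x *\<^sub>R U x) \<bullet> U x = ((\<Gamma> x * norm (U x) powr (p - 1)) *\<^sub>R U x) \<bullet> U x"
      by (simp only:)
    then show ?case by (simp only: inner_scaleR_left power2_norm_eq_inner powr_split mult.assoc)
  qed
  \<comment> \<open>No bound on \<open>V\<close> is at hand: integrability comes from the identity
    with \<Gamma> |U|^(p+1), which the weighted space controls.\<close>
  have iVU: "integrable lebesgue (\<lambda>x. V x * (norm (U x))\<^sup>2)"
    by (rule integrable_cong_AE_imp[OF signed[OF UX]]) (use VU in \<open>auto elim: eventually_mono\<close>)
  have UJ: "U \<in> J_domain p V \<Gamma>"
  proof -
    have "weak_curl U \<in> L2" by (rule wU)
    then have "integrable lebesgue (\<lambda>x. (norm (weak_curl U x))\<^sup>2)" by (simp add: L2_def)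
    with iVU signed[OF UX] have "integrable lebesgue (J_density p V \<Gamma> U)"
      unfolding J_density_def[abs_def] q_def by auto
    with UX show ?thesis by (simp add: J_domain_def)
  qed
  moreover have "((\<lambda>t. J_functional p V \<Gamma> (\<lambda>x. U x + t *\<^sub>R \<phi> x)) has_real_derivative 0) (at 0)"
    if \<phi>: "\<phi> \<in> X_space p \<Gamma>" and dom: "\<And>t. (\<lambda>x. U x + t *\<^sub>R \<phi> x) \<in> J_domain p V \<Gamma>" for \<phi>
  proof -
    have \<phi>m[measurable]: "\<phi> \<in> borel_measurable lebesgue"
      using \<phi> by (simp add: X_space_def Hcurl_def L2_def)
    obtain C0 where "C0 \<in> L2" "has_weak_curl \<phi> C0"
      using \<phi> by (auto simp: X_space_def Hcurl_def)
    note w\<phi> = weak_curl_AE_eq[OF this(2,1)]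
    define C where "C = weak_curl \<phi>"
    have iC: "integrable lebesgue (\<lambda>x. (norm (C x))\<^sup>2)"
      using w\<phi>(2) by (simp add: L2_def C_def)
    have Cm[measurable]: "C \<in> borel_measurable lebesgue"
      using w\<phi>(2) by (simp add: L2_def C_def)
    have wt: "AE x in lebesgue. weak_curl (\<lambda>x. U x + t *\<^sub>R \<phi> x) x = t *\<^sub>R C x"
      and wtm: "weak_curl (\<lambda>x. U x + t *\<^sub>R \<phi> x) \<in> borel_measurable lebesgue" for t
    proof -
      have "(\<lambda>x. t *\<^sub>R C x) \<in> L2"
        using iC by (simp add: L2_def power_mult_distrib)
      moreover have "has_weak_curl (\<lambda>x. U x + t *\<^sub>R \<phi> x) (\<lambda>x. t *\<^sub>R C x)"
        using has_weak_curl_add_scaleR[OF wc w\<phi>(3), of t] by (simp add: C_def)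
      ultimately show "AE x in lebesgue. weak_curl (\<lambda>x. U x + t *\<^sub>R \<phi> x) x = t *\<^sub>R C x"
        "weak_curl (\<lambda>x. U x + t *\<^sub>R \<phi> x) \<in> borel_measurable lebesgue"
        using weak_curl_AE_eq[of "\<lambda>x. U x + t *\<^sub>R \<phi> x" "\<lambda>x. t *\<^sub>R C x"] by (auto simp: L2_def)
    qed
    have dens: "AE x in lebesgue. J_density p V \<Gamma> (\<lambda>x. U x + t *\<^sub>R \<phi> x) x =
      1/2 * (t\<^sup>2 * (norm (C x))\<^sup>2 + V x * (norm (U x + t *\<^sub>R \<phi> x))\<^sup>2) - 1/q * (\<Gamma> x * norm (U x + t *\<^sub>R \<phi> x) powr q)" for t
      using wt[of t] by eventually_elim (simp add: J_density_def q_def power_mult_distrib)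
    have dm: "J_density p V \<Gamma> (\<lambda>x. U x + t *\<^sub>R \<phi> x) \<in> borel_measurable lebesgue" for t
      using wtm[of t] unfolding J_density_def[abs_def] by measurable
    have iG: "integrable lebesgue (\<lambda>x. \<Gamma> x * norm (U x + t *\<^sub>R \<phi> x) powr q)" for t
      using signed dom[of t] by (simp add: J_domain_def)
    \<comment> \<open>\<open>V\<close> may be unbounded: integrability comes from that of the density, not from \<open>L\<^sup>2\<close> bounds.\<close>
    have iV: "integrable lebesgue (\<lambda>x. V x * (norm (U x + t *\<^sub>R \<phi> x))\<^sup>2)" for t
    proof -
      define G where "G x = 1/2 * (t\<^sup>2 * (norm (C x))\<^sup>2 + V x * (norm (U x + t *\<^sub>R \<phi> x))\<^sup>2) - 1/q * (\<Gamma> x * norm (U x + t *\<^sub>R \<phi> x) powr q)" for x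
      have "integrable lebesgue (J_density p V \<Gamma> (\<lambda>x. U x + t *\<^sub>R \<phi> x))"
        using dom[of t] by (simp add: J_domain_def)
      moreover have "G \<in> borel_measurable lebesgue"
        unfolding G_def by measurable
      ultimately have "integrable lebesgue G"
        by (rule integrable_cong_AE_imp) (use dens[of t] in \<open>auto simp: G_def elim: eventually_mono\<close>)
      then have "integrable lebesgue (\<lambda>x. 2 * (G x + 1/q * (\<Gamma> x * norm (U x + t *\<^sub>R \<phi> x) powr q)) - t\<^sup>2 * (norm (C x))\<^sup>2)"
        using iG[of t] iC by (intro Bochner_Integration.integrable_diff Bochner_Integration.integrable_add integrable_mult_right)
      moreover have "2 * (G x + 1/q * (\<Gamma> x * norm (U x + t *\<^sub>R \<phi> x) powr q)) - t\<^sup>2 * (norm (C x))\<^sup>2 = V x * (norm (U x + t *\<^sub>R \<phi> x))\<^sup>2" for x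
        by (simp add: G_def add_divide_distrib)
      ultimately show ?thesis by (simp only:)
    qed
    have exp2: "(norm (U x + t *\<^sub>R \<phi> x))\<^sup>2 = (norm (U x))\<^sup>2 + 2 * t * (U x \<bullet> \<phi> x) + t\<^sup>2 * (norm (\<phi> x))\<^sup>2" for t x
      by (rule norm_add_scaleR_power2)
    \<comment> \<open>Parallelogram identity: the mean of the squares at t = 1 and t = -1 is |U|^2 +
      |\<phi>|^2.\<close>
    have iV\<phi>: "integrable lebesgue (\<lambda>x. V x * (norm (\<phi> x))\<^sup>2)"
    proof -
      have "integrable lebesgue (\<lambda>x. 1/2 * (V x * (norm (U x + 1 *\<^sub>R \<phi> x))\<^sup>2 + V x * (norm (U x + (-1) *\<^sub>R \<phi> x))\<^sup>2) - V x * (norm (U x))\<^sup>2)"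
        by (intro Bochner_Integration.integrable_diff Bochner_Integration.integrable_add integrable_mult_right iV iVU)
      moreover have "1/2 * (V x * (norm (U x + 1 *\<^sub>R \<phi> x))\<^sup>2 + V x * (norm (U x + (-1) *\<^sub>R \<phi> x))\<^sup>2) - V x * (norm (U x))\<^sup>2 = V x * (norm (\<phi> x))\<^sup>2" for x
        unfolding exp2 by (simp add: field_simps)
      ultimately show ?thesis by (simp only:)
    qed
    \<comment> \<open>Polarisation: a quarter of the difference of the squares at t = 1 and t = -1
      is the inner product.\<close>
    have iVU\<phi>: "integrable lebesgue (\<lambda>x. V x * (U x \<bullet> \<phi> x))"
    proof -
      have "integrable lebesgue (\<lambda>x. 1/4 * (V x * (norm (U x + 1 *\<^sub>R \<phi> x))\<^sup>2 - V x * (norm (U x + (-1) *\<^sub>R \<phi> x))\<^sup>2))"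
        by (intro Bochner_Integration.integrable_diff integrable_mult_right iV)
      moreover have "1/4 * (V x * (norm (U x + 1 *\<^sub>R \<phi> x))\<^sup>2 - V x * (norm (U x + (-1) *\<^sub>R \<phi> x))\<^sup>2) = V x * (U x \<bullet> \<phi> x)" for x
        unfolding exp2 by (simp add: field_simps)
      ultimately show ?thesis by (simp only:)
    qed
    define a where "a = (\<integral>x. (norm (C x))\<^sup>2 \<partial>lebesgue)"
    define b0 where "b0 = (\<integral>x. V x * (norm (U x))\<^sup>2 \<partial>lebesgue)"
    define b1 where "b1 = (\<integral>x. V x * (U x \<bullet> \<phi> x) \<partial>lebesgue)"
    define b2 where "b2 = (\<integral>x. V x * (norm (\<phi> x))\<^sup>2 \<partial>lebesgue)"
    define N where "N t = (\<integral>x. \<Gamma> x * norm (U x + t *\<^sub>R \<phi> x) powr q \<partial>lebesgue)" for t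
    have J: "J_functional p V \<Gamma> (\<lambda>x. U x + t *\<^sub>R \<phi> x) = 1/2 * (t\<^sup>2 * a + (b0 + 2 * t * b1 + t\<^sup>2 * b2)) - 1/q * N t" for t
    proof -
      have "J_functional p V \<Gamma> (\<lambda>x. U x + t *\<^sub>R \<phi> x) = (\<integral>x. 1/2 * (t\<^sup>2 * (norm (C x))\<^sup>2 + V x * (norm (U x + t *\<^sub>R \<phi> x))\<^sup>2) - 1/q * (\<Gamma> x * norm (U x + t *\<^sub>R \<phi> x) powr q) \<partial>lebesgue)"
        unfolding J_functional_def by (rule integral_cong_AE[OF dm _ dens]) measurable
      also have "\<dots> = 1/2 * (t\<^sup>2 * a + (\<integral>x. V x * (norm (U x + t *\<^sub>R \<phi> x))\<^sup>2 \<partial>lebesgue)) - 1/q * N t"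
        using iC iV[of t] iG[of t] by (simp add: a_def N_def)
      also have "(\<integral>x. V x * (norm (U x + t *\<^sub>R \<phi> x))\<^sup>2 \<partial>lebesgue) = (\<integral>x. V x * (norm (U x))\<^sup>2 + (2 * t) * (V x * (U x \<bullet> \<phi> x)) + t\<^sup>2 * (V x * (norm (\<phi> x))\<^sup>2) \<partial>lebesgue)"
        unfolding exp2 by (intro Bochner_Integration.integral_cong refl) (simp add: algebra_simps)
      also have "\<dots> = b0 + 2 * t * b1 + t\<^sup>2 * b2"
        using iVU iVU\<phi> iV\<phi> by (simp add: b0_def b1_def b2_def)
      finally show ?thesis .
    qed
    have "(N has_real_derivative (\<integral>x. \<Gamma> x * (q * norm (U x) powr (q - 2) * (U x \<bullet> \<phi> x)) \<partial>lebesgue)) (at 0)"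
      unfolding N_def
      by (rule integral_norm_powr_has_derivative)
         (use UX \<phi> q in \<open>auto simp: X_space_def Lp_weighted_def q_def\<close>)
    \<comment> \<open>Since q - 2 = p - 1, this is the pointwise equation paired with \<phi>; it
      identifies the derivative of the power integral with q times the linear coefficient
      \<open>b1\<close> of the quadratic part.\<close>
    also have "(\<integral>x. \<Gamma> x * (q * norm (U x) powr (q - 2) * (U x \<bullet> \<phi> x)) \<partial>lebesgue) = (\<integral>x. q * (V x * (U x \<bullet> \<phi> x)) \<partial>lebesgue)"
    proof (rule integral_cong_AE)
      show "AE x in lebesgue. \<Gamma> x * (q * norm (U x) powr (q - 2) * (U x \<bullet> \<phi> x)) = q * (V x * (U x \<bullet> \<phi> x))"
        using pt
      proof eventually_elim
        case (elim x)
        have "(V x *\<^sub>R U x) \<bullet> \<phi> x = ((\<Gamma> x * norm (U x) powr (p - 1)) *\<^sub>R U x) \<bullet> \<phi> x"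
          by (simp only: elim)
        then have e: "V x * (U x \<bullet> \<phi> x) = \<Gamma> x * norm (U x) powr (p - 1) * (U x \<bullet> \<phi> x)"
          by (simp only: inner_scaleR_left)
        have "q - 2 = p - 1" by (simp add: q_def)
        then show ?case by (simp only: e) (simp only: mult_ac)
      qed
    qed measurable
    also have "\<dots> = q * b1" by (simp add: b1_def)
    finally have N: "(N has_real_derivative q * b1) (at 0)" .
    have "((\<lambda>t. 1/2 * (t\<^sup>2 * a + (b0 + 2 * t * b1 + t\<^sup>2 * b2)) - 1/q * N t) has_real_derivative b1 - 1/q * (q * b1)) (at 0)"
      by (auto intro!: derivative_eq_intros N)
    then show ?thesis
      using q by (simp add: J)
  qed
  ultimately show ?thesis
    unfolding critical_point_J_def by blast
qed

section \<open>Radial solutions\<close>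

lemma AE_lebesgue_orthogonal:
  fixes T :: "real^'n::{finite,wellorder} \<Rightarrow> real^'n::{finite,wellorder}"
  assumes "orthogonal_transformation T" "AE x in lebesgue. P x"
  shows "AE x in lebesgue. P (T x)"
  using AE_orthogonal[OF assms(1)] assms(2) by (simp add: AE_completion_iff)

text \<open>\<open>\<Gamma>_nz\<close> spells out what writing 1/\<Gamma> presupposes: division by
  zero yields 0 in HOL, so the conditions on the quotient would not by themselves exclude zeros of
  \<Gamma>.\<close>

locale radial_coefficients =
  fixes p :: real and V \<Gamma> :: "real^3 \<Rightarrow> real" and V\<^sub>0 \<Gamma>\<^sub>0 :: "real \<Rightarrow> real"
  assumes p: "p > 1"
    and V: "V \<in> Linf_loc UNIV" and \<Gamma>: "\<Gamma> \<in> Linf_loc UNIV"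
    and \<Gamma>_nz: "AE x in lebesgue. \<Gamma> x \<noteq> 0"
    and quot_nonneg: "AE x in lebesgue. 0 \<le> V x / \<Gamma> x"
    and quot_Lp: "(\<lambda>x. V x / \<Gamma> x) \<in> Lp_loc (p / (p - 1))"
    and V_radial: "AE x in lebesgue. V x = V\<^sub>0 (norm x)"
    and \<Gamma>_radial: "AE x in lebesgue. \<Gamma> x = \<Gamma>\<^sub>0 (norm x)"
begin

text \<open>The only modulus that a nonzero value of a symmetric solution can have: the root a \<ge>
  0 of a^(p-1) = V/\<Gamma>.\<close>

definition amplitude :: "real^3 \<Rightarrow> real" where
  "amplitude x = (V x / \<Gamma> x) powr (1 / (p - 1))"

lemma V_measurable [measurable]: "V \<in> borel_measurable lebesgue"
  and \<Gamma>_measurable [measurable]: "\<Gamma> \<in> borel_measurable lebesgue"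
  using V \<Gamma> by (simp_all add: Linf_loc_def measurable_cong_sets[OF sets_restrict_UNIV refl])

lemma amplitude_measurable [measurable]: "amplitude \<in> borel_measurable lebesgue"
  unfolding amplitude_def by measurable

lemma amplitude_nonneg: "0 \<le> amplitude x"
  by (simp add: amplitude_def)

lemma amplitude_powr: "amplitude x powr r = (V x / \<Gamma> x) powr (r / (p - 1))"
  by (simp add: amplitude_def powr_powr)

lemma Linf_loc_UNIV_bound:
  assumes "f \<in> Linf_loc UNIV" "compact K"
  obtains C where "AE x in lebesgue. x \<in> K \<longrightarrow> norm (f x) \<le> C" "C \<ge> 0"
proof -
  obtain C where "AE x in lebesgue_on K. norm (f x) \<le> C"
    using assms by (auto simp: Linf_loc_def)
  then have "AE x in lebesgue. x \<in> K \<longrightarrow> norm (f x) \<le> C"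
    using compact_emeasure_lebesgue(1)[OF assms(2)] by (subst (asm) AE_restrict_space_iff) auto
  then have "AE x in lebesgue. x \<in> K \<longrightarrow> norm (f x) \<le> max C 0"
    by eventually_elim auto
  then show ?thesis by (rule that) simp
qed

lemma norm_radial_field:
  assumes "s \<in> measurable_profiles {-1, 0, 1}" "x \<noteq> 0"
  shows "norm (radial_field p V \<Gamma> s x) = \<bar>s (norm x)\<bar> * amplitude x"
  using assms amplitude_nonneg[of x]
  by (simp add: radial_field_def amplitude_def[symmetric] abs_mult)

lemma profile_cases:
  assumes "s \<in> measurable_profiles {-1, 0, 1}" "x \<noteq> (0::real^3)"
  shows "s (norm x) = -1 \<or> s (norm x) = 0 \<or> s (norm x) = 1"
  using assms unfolding measurable_profiles_def by auto

lemma radial_field_measurable: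
  assumes "s \<in> measurable_profiles {-1, 0, 1}"
  shows "radial_field p V \<Gamma> s \<in> borel_measurable lebesgue"
proof -
  have [measurable]: "(\<lambda>x::real^3. s (norm x)) \<in> borel_measurable lebesgue"
    using assms by (intro radial_profile_measurable) (simp add: measurable_profiles_def)
  have [measurable]: "(\<lambda>x::real^3. x /\<^sub>R norm x) \<in> borel_measurable lebesgue"
    by (intro measurable_completion) measurable
  show ?thesis
    unfolding radial_field_def[abs_def] amplitude_def[symmetric] by measurable
qed

text \<open>This accounts for the exponent in the hypothesis on V/\<Gamma>: the p-th power of the
  amplitude is (V/\<Gamma>)^(p/(p-1)).\<close>

lemma radial_field_Lp_loc:
  assumes s: "s \<in> measurable_profiles {-1, 0, 1}"
  shows "radial_field p V \<Gamma> s \<in> Lp_loc p"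
proof -
  note m = radial_field_measurable[OF s]
  have "integrable (lebesgue_on K) (\<lambda>x. norm (radial_field p V \<Gamma> s x) powr p)" if K: "compact K" for K
    unfolding integrable_lebesgue_on_compact[OF K]
  proof (rule set_integrable_compact_bound[OF K])
    show "set_integrable lebesgue K (\<lambda>x. norm (V x / \<Gamma> x) powr (p / (p - 1)))"
      by (rule Lp_locD[OF quot_Lp K])
    show "(\<lambda>x. norm (radial_field p V \<Gamma> s x) powr p) \<in> borel_measurable lebesgue"
      using m by measurable
    show "AE x in lebesgue. x \<in> K \<longrightarrow> norm (norm (radial_field p V \<Gamma> s x) powr p) \<le> norm (V x / \<Gamma> x) powr (p / (p - 1))"
      using quot_nonneg AE_completion[OF AE_lborel_singleton[of 0]]
    proof eventually_elim
      case (elim x)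
      have "norm (radial_field p V \<Gamma> s x) \<le> amplitude x"
        using norm_radial_field[OF s elim(2)] profile_cases[OF s elim(2)] amplitude_nonneg[of x] by auto
      then have "norm (radial_field p V \<Gamma> s x) powr p \<le> amplitude x powr p"
        using p by (intro powr_mono2) auto
      moreover have "\<bar>V x / \<Gamma> x\<bar> = V x / \<Gamma> x"
        using elim(1) by (rule abs_of_nonneg)
      ultimately show ?case by (simp add: amplitude_powr del: abs_divide)
    qed
  qed
  with m show ?thesis by (simp add: Lp_loc_def)
qed

lemma radial_field_O3_symmetric:
  "O3_symmetric (radial_field p V \<Gamma> s)"
  unfolding O3_symmetric_iff
proof (intro allI impI)
  fix T :: "real^3 \<Rightarrow> real^3" assume T: "orthogonal_transformation T"
  show "AE x in lebesgue. radial_field p V \<Gamma> s (T x) = T (radial_field p V \<Gamma> s x)"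
    using V_radial \<Gamma>_radial AE_lebesgue_orthogonal[OF T V_radial] AE_lebesgue_orthogonal[OF T \<Gamma>_radial]
    by eventually_elim
      (simp add: radial_field_def orthogonal_transformation_norm[OF T] linear_cmul[OF orthogonal_transformation_linear[OF T]])
qed

lemma norm_powr_imp_pointwise:
  assumes "\<Gamma> x \<noteq> 0" "0 \<le> V x / \<Gamma> x" "norm u = amplitude x \<or> u = 0"
  shows "V x *\<^sub>R u = (\<Gamma> x * norm u powr (p - 1)) *\<^sub>R u"
proof (cases "u = 0")
  case False
  moreover have "amplitude x powr (p - 1) = V x / \<Gamma> x"
    using assms p abs_of_nonneg[OF assms(2)] by (simp add: amplitude_powr del: abs_divide)
  ultimately have "norm u powr (p - 1) = V x / \<Gamma> x"
    using assms(3) by simp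
  then show ?thesis using assms(1) by simp
qed simp

text \<open>For u \<noteq> 0 the vector cancels and a root is taken. The alternative u = 0 remains
  possible even where V does not vanish, which is the source of the value 0 among the
  profiles.\<close>

lemma pointwise_imp_norm:
  assumes "\<Gamma> x \<noteq> 0" "V x *\<^sub>R u = (\<Gamma> x * norm u powr (p - 1)) *\<^sub>R u"
  shows "norm u = amplitude x \<or> u = 0"
proof (cases "u = 0")
  case False
  then have "V x = \<Gamma> x * norm u powr (p - 1)"
    using assms(2) by simp
  then have "V x / \<Gamma> x = norm u powr (p - 1)"
    using assms(1) by simp
  then show ?thesis using p by (simp add: amplitude_def powr_powr)
qed simp

text \<open>Local boundedness of the coefficients reduces the two terms to |U| and |U|^p, both
  locally integrable; this is what makes the fundamental lemma applicable.\<close>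

lemma nonlinear_terms_set_integrable:
  assumes U: "U \<in> Lp_loc p" and K: "compact K"
  shows "set_integrable lebesgue K (\<lambda>x. V x *\<^sub>R U x - (\<Gamma> x * norm (U x) powr (p - 1)) *\<^sub>R U x)"
proof -
  have [measurable]: "U \<in> borel_measurable lebesgue" by (rule Lp_locD(1)[OF U K])
  obtain C where C: "AE x in lebesgue. x \<in> K \<longrightarrow> norm (V x) \<le> C" "C \<ge> 0"
    using Linf_loc_UNIV_bound[OF V K] by blast
  obtain D where D: "AE x in lebesgue. x \<in> K \<longrightarrow> norm (\<Gamma> x) \<le> D" "D \<ge> 0"
    using Linf_loc_UNIV_bound[OF \<Gamma> K] by blast
  have iU: "set_integrable lebesgue K U"
    using Lp_loc_set_integrable[OF U _ K] p by simp
  have iP: "set_integrable lebesgue K (\<lambda>x. norm (U x) powr p)"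
    by (rule Lp_locD[OF U K])
  have 1: "set_integrable lebesgue K (\<lambda>x. V x *\<^sub>R U x)"
  proof (rule set_integrable_compact_bound[OF K])
    show "set_integrable lebesgue K (\<lambda>x. C * norm (U x))"
      using iU by (intro set_integrable_mult_right set_integrable_norm)
    show "AE x in lebesgue. x \<in> K \<longrightarrow> norm (V x *\<^sub>R U x) \<le> C * norm (U x)"
      using C(1) by eventually_elim (auto intro: mult_right_mono)
  qed measurable
  have 2: "set_integrable lebesgue K (\<lambda>x. (\<Gamma> x * norm (U x) powr (p - 1)) *\<^sub>R U x)"
  proof (rule set_integrable_compact_bound[OF K])
    show "set_integrable lebesgue K (\<lambda>x. D * norm (U x) powr p)"
      using iP by (rule set_integrable_mult_right)
    show "AE x in lebesgue. x \<in> K \<longrightarrow> norm ((\<Gamma> x * norm (U x) powr (p - 1)) *\<^sub>R U x) \<le> D * norm (U x) powr p"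
      using D(1)
    proof eventually_elim
      case (elim x)
      have "norm (U x) powr (p - 1) * norm (U x) = norm (U x) powr p"
        by (cases "U x = 0") (simp_all add: powr_mult_base mult.commute)
      then have "norm ((\<Gamma> x * norm (U x) powr (p - 1)) *\<^sub>R U x) = \<bar>\<Gamma> x\<bar> * norm (U x) powr p"
        by (simp add: abs_mult mult.assoc)
      with elim show ?case by (auto intro: mult_right_mono)
    qed
  qed measurable
  show ?thesis by (rule set_integral_diff(1)[OF 1 2])
qed

lemma nonlinear_terms_measurable:
  fixes U :: "real^3 \<Rightarrow> real^3"
  assumes "U \<in> borel_measurable lebesgue"
  shows "(\<lambda>x. V x *\<^sub>R U x - (\<Gamma> x * norm (U x) powr (p - 1)) *\<^sub>R U x) \<in> borel_measurable lebesgue"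
  using assms by measurable

text \<open>The curl of a test field is again a test field, so testing the vanishing weak curl with
  \<open>curl \<phi>\<close> removes the second-order term; the fundamental lemma applies to the
  remaining field \<open>h\<close>.\<close>

lemma distributional_solution_iff_pointwise:
  assumes U: "U \<in> Lp_loc p" and wc: "has_weak_curl U (\<lambda>x. 0)"
  shows "distributional_solution p V \<Gamma> U \<longleftrightarrow>
    (AE x in lebesgue. V x *\<^sub>R U x = (\<Gamma> x * norm (U x) powr (p - 1)) *\<^sub>R U x)"
proof -
  define h where "h x = V x *\<^sub>R U x - (\<Gamma> x * norm (U x) powr (p - 1)) *\<^sub>R U x" for x
  have Um: "U \<in> borel_measurable lebesgue" by (rule Lp_locD(1)[OF U compact_empty])
  have hm: "h \<in> borel_measurable lebesgue"
    unfolding h_def by (rule nonlinear_terms_measurable[OF Um])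
  have hi: "set_integrable lebesgue K h" if "compact K" for K
    unfolding h_def by (rule nonlinear_terms_set_integrable[OF U that])
  have Ui: "set_integrable lebesgue K U" if "compact K" for K
    using Lp_loc_set_integrable[OF U _ that] p by simp
  have split: "(\<lambda>x. U x \<bullet> (curl (curl \<phi>) x + V x *\<^sub>R \<phi> x) - \<Gamma> x * norm (U x) powr (p - 1) * (U x \<bullet> \<phi> x))
    = (\<lambda>x. U x \<bullet> curl (curl \<phi>) x + h x \<bullet> \<phi> x)" for \<phi>
    by (simp add: h_def inner_add_right inner_diff_left add_diff_eq)
  have "has_bochner_integral lebesgue (\<lambda>x. U x \<bullet> curl (curl \<phi>) x + h x \<bullet> \<phi> x) (0 + (\<integral>x. h x \<bullet> \<phi> x \<partial>lebesgue))"
    if \<phi>: "\<phi> \<in> test_fields" for \<phi>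
  proof (rule has_bochner_integral_add)
    have "(\<integral>x. U x \<bullet> curl (curl \<phi>) x \<partial>lebesgue) = 0"
      using wc curl_test_fields[OF \<phi>] by (simp add: has_weak_curl_def)
    then show "has_bochner_integral lebesgue (\<lambda>x. U x \<bullet> curl (curl \<phi>) x) 0"
      using integrable_inner_test_field[OF Um Ui curl_test_fields[OF curl_test_fields[OF \<phi>]]]
      by (simp add: has_bochner_integral_iff)
    show "has_bochner_integral lebesgue (\<lambda>x. h x \<bullet> \<phi> x) (\<integral>x. h x \<bullet> \<phi> x \<partial>lebesgue)"
      using integrable_inner_test_field[OF hm hi \<phi>] by (simp add: has_bochner_integral_iff)
  qed
  then have "has_bochner_integral lebesgue (\<lambda>x. U x \<bullet> curl (curl \<phi>) x + h x \<bullet> \<phi> x) 0 \<longleftrightarrow> (\<integral>x. h x \<bullet> \<phi> x \<partial>lebesgue) = 0"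
    if "\<phi> \<in> test_fields" for \<phi>
    using that has_bochner_integral_eq by fastforce
  then have "distributional_solution p V \<Gamma> U \<longleftrightarrow> (\<forall>\<phi>\<in>test_fields. (\<integral>x. h x \<bullet> \<phi> x \<partial>lebesgue) = 0)"
    unfolding distributional_solution_def split using U by blast
  also have "\<dots> \<longleftrightarrow> (AE x in lebesgue. h x = 0)"
  proof
    assume "\<forall>\<phi>\<in>test_fields. (\<integral>x. h x \<bullet> \<phi> x \<partial>lebesgue) = 0"
    then show "AE x in lebesgue. h x = 0"
      by (intro fundamental_lemma_test_fields hm hi) auto
  next
    assume "AE x in lebesgue. h x = 0"
    then have "(\<integral>x. h x \<bullet> \<phi> x \<partial>lebesgue) = 0" for \<phi>
      by (intro integral_eq_zero_AE) (auto elim: eventually_mono)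
    then show "\<forall>\<phi>\<in>test_fields. (\<integral>x. h x \<bullet> \<phi> x \<partial>lebesgue) = 0" by blast
  qed
  finally show ?thesis by (simp add: h_def)
qed

lemma radial_weak_curl_0:
  assumes U: "U \<in> Lp_loc p" and sym: "O3_symmetric U"
  obtains f :: "real \<Rightarrow> real" where "f \<in> borel_measurable borel"
    "AE x in lebesgue. U x = f (norm x) *\<^sub>R (x /\<^sub>R norm x)" "has_weak_curl U (\<lambda>x. 0)"
proof -
  obtain f :: "real \<Rightarrow> real" where f: "f \<in> borel_measurable borel"
    "AE x in lebesgue. U x = f (norm x) *\<^sub>R (x /\<^sub>R norm x)"
    using equivariant_field_radial[OF Lp_locD(1)[OF U compact_empty]] sym
    unfolding O3_symmetric_iff by blast
  have "U \<in> Lp_loc 1"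
    using Lp_loc_imp_Lp_loc_1[OF U] p by simp
  from that[OF f radial_field_weak_curl_0[OF this f]] show ?thesis .
qed

text \<open>The vanishing weak curl is deduced from the symmetry of the field, as for any other
  solution, so no Borel profile for V/\<Gamma> has to be constructed.\<close>

lemma radial_field_solution:
  assumes s: "s \<in> measurable_profiles {-1, 0, 1}"
  shows "distributional_solution p V \<Gamma> (radial_field p V \<Gamma> s)"
proof -
  note U = radial_field_Lp_loc[OF s]
  obtain f :: "real \<Rightarrow> real" where "has_weak_curl (radial_field p V \<Gamma> s) (\<lambda>x. 0)"
    using radial_weak_curl_0[OF U radial_field_O3_symmetric] by blast
  moreover have "AE x in lebesgue. V x *\<^sub>R radial_field p V \<Gamma> s x =
      (\<Gamma> x * norm (radial_field p V \<Gamma> s x) powr (p - 1)) *\<^sub>R radial_field p V \<Gamma> s x"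
    using \<Gamma>_nz quot_nonneg AE_completion[OF AE_lborel_singleton[of 0]]
  proof eventually_elim
    case (elim x)
    have "norm (radial_field p V \<Gamma> s x) = amplitude x \<or> radial_field p V \<Gamma> s x = 0"
      using norm_radial_field[OF s elim(3)] profile_cases[OF s elim(3)] by auto
    with elim show ?case by (intro norm_powr_imp_pointwise)
  qed
  ultimately show ?thesis
    by (simp add: distributional_solution_iff_pointwise[OF U])
qed

lemma borel_measurable_profile:
  assumes "s \<in> borel_measurable borel" "\<And>r. s r \<in> A"
  shows "s \<in> measurable_profiles A"
proof -
  have "s \<in> borel_measurable (lebesgue_on {0<..})"
    using assms(1) by (intro measurable_restrict_space1 measurable_completion) simp
  with assms(2) show ?thesis by (simp add: measurable_profiles_def)
qed

lemma solution_structure: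
  assumes sym: "O3_symmetric U" and sol: "distributional_solution p V \<Gamma> U"
  shows "has_weak_curl U (\<lambda>x. 0)"
    and "\<exists>s\<in>measurable_profiles {-1, 0, 1}. AE x in lebesgue. U x = radial_field p V \<Gamma> s x"
    and "(AE x in lebesgue. V x \<noteq> 0 \<longrightarrow> U x \<noteq> 0) \<Longrightarrow>
      \<exists>s\<in>measurable_profiles {-1, 1}. AE x in lebesgue. U x = radial_field p V \<Gamma> s x"
    and "AE x in lebesgue. norm (U x) = amplitude x \<or> U x = 0"
    and "AE x in lebesgue. V x *\<^sub>R U x = (\<Gamma> x * norm (U x) powr (p - 1)) *\<^sub>R U x"
proof -
  have U: "U \<in> Lp_loc p" using sol by (simp add: distributional_solution_def)
  obtain f :: "real \<Rightarrow> real" where f[measurable]: "f \<in> borel_measurable borel"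
    and Uf: "AE x in lebesgue. U x = f (norm x) *\<^sub>R (x /\<^sub>R norm x)" and wc: "has_weak_curl U (\<lambda>x. 0)"
    using radial_weak_curl_0[OF U sym] .
  show "has_weak_curl U (\<lambda>x. 0)" by (rule wc)
  show pt: "AE x in lebesgue. V x *\<^sub>R U x = (\<Gamma> x * norm (U x) powr (p - 1)) *\<^sub>R U x"
    using sol by (simp add: distributional_solution_iff_pointwise[OF U wc])
  with \<Gamma>_nz show amp: "AE x in lebesgue. norm (U x) = amplitude x \<or> U x = 0"
    by eventually_elim (rule pointwise_imp_norm)
  note AE0 = AE_completion[OF AE_lborel_singleton[of "0::real^3"]]
  have fabs: "AE x in lebesgue. x \<noteq> 0 \<longrightarrow> \<bar>f (norm x)\<bar> = amplitude x \<or> f (norm x) = 0"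
    using Uf amp
  proof eventually_elim
    case (elim x)
    have "norm (U x) = \<bar>f (norm x)\<bar>" if "x \<noteq> 0"
      using that by (simp add: elim(1) abs_mult)
    with elim(2) show ?case by auto
  qed
  show "\<exists>s\<in>measurable_profiles {-1, 0, 1}. AE x in lebesgue. U x = radial_field p V \<Gamma> s x"
  \<comment> \<open>|f| is the amplitude wherever f is nonzero; at the zeros of f the factor sgn f =
    0 makes the amplitude irrelevant.\<close>
  proof (intro bexI[of _ "\<lambda>r. sgn (f r)"] borel_measurable_profile)
    show "AE x in lebesgue. U x = radial_field p V \<Gamma> (\<lambda>r. sgn (f r)) x"
      using Uf AE0 fabs
    proof eventually_elim
      case (elim x)
      then have "f (norm x) = sgn (f (norm x)) * amplitude x"
        by (metis sgn_0 mult_zero_left sgn_mult_abs)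
      with elim(1) show ?case
        unfolding radial_field_def amplitude_def[symmetric] by simp
    qed
    show "(\<lambda>r. sgn (f r)) \<in> borel_measurable borel"
      by measurable
    show "sgn (f r) \<in> {-1, 0, 1}" for r by (auto simp: sgn_if)
  qed
  assume nz: "AE x in lebesgue. V x \<noteq> 0 \<longrightarrow> U x \<noteq> 0"
  show "\<exists>s\<in>measurable_profiles {-1, 1}. AE x in lebesgue. U x = radial_field p V \<Gamma> s x"
  \<comment> \<open>The sign 1 at the zeros of f is harmless: there U = 0, so the extra hypothesis
    gives V = 0 and the amplitude is 0 as well.\<close>
  proof (intro bexI[of _ "\<lambda>r. if f r < 0 then -1 else 1"] borel_measurable_profile)
    show "AE x in lebesgue. U x = radial_field p V \<Gamma> (\<lambda>r. if f r < 0 then -1 else 1) x"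
      using Uf AE0 fabs nz
    proof eventually_elim
      case (elim x)
      have "f (norm x) = 0 \<Longrightarrow> amplitude x = 0"
        using elim(1,4) by (auto simp: amplitude_def)
      then have "f (norm x) = (if f (norm x) < 0 then -1 else 1) * amplitude x"
        using elim(2,3) by auto
      with elim(1) show ?case
        unfolding radial_field_def amplitude_def[symmetric] by simp
    qed
    show "(\<lambda>r. if f r < 0 then -1 else 1) \<in> borel_measurable borel"
      by measurable
  qed auto
qed

text \<open>The r-th power of the amplitude is (V/\<Gamma>)^(r/(p-1)), so the two integrability
  hypotheses concern its square and its (p+1)-th power weighted by \<Gamma>; almost everywhere the
  modulus of U is at most the amplitude.\<close>

lemma solution_critical_point:
  assumes sym: "O3_symmetric U" and sol: "distributional_solution p V \<Gamma> U"
    and i1: "integrable lebesgue (\<lambda>x. (V x / \<Gamma> x) powr (2 / (p - 1)))"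
    and i2: "integrable lebesgue (\<lambda>x. (V x / \<Gamma> x) powr ((p + 1) / (p - 1)) * \<Gamma> x)"
  shows "U \<in> X_space p \<Gamma>" "critical_point_J p V \<Gamma> U"
proof -
  have U: "U \<in> Lp_loc p" using sol by (simp add: distributional_solution_def)
  have Um[measurable]: "U \<in> borel_measurable lebesgue" by (rule Lp_locD(1)[OF U compact_empty])
  note st = solution_structure[OF sym sol]
  have "integrable lebesgue (\<lambda>x. (norm (U x))\<^sup>2)"
  proof (rule Bochner_Integration.integrable_bound[OF i1])
    show "AE x in lebesgue. norm ((norm (U x))\<^sup>2) \<le> norm ((V x / \<Gamma> x) powr (2 / (p - 1)))"
      using st(4)
    proof eventually_elim
      case (elim x)
      have "norm (U x) powr 2 \<le> amplitude x powr 2"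
        using elim amplitude_nonneg[of x] by auto
      then show ?case by (simp add: amplitude_powr)
    qed
  qed measurable
  then have L2: "U \<in> L2" using Um by (simp add: L2_def)
  have "integrable lebesgue (\<lambda>x. \<bar>\<Gamma> x\<bar> * norm (U x) powr (p + 1))"
  proof (rule Bochner_Integration.integrable_bound[OF i2])
    show "AE x in lebesgue. norm (\<bar>\<Gamma> x\<bar> * norm (U x) powr (p + 1)) \<le> norm ((V x / \<Gamma> x) powr ((p + 1) / (p - 1)) * \<Gamma> x)"
      using st(4)
    proof eventually_elim
      case (elim x)
      have "norm (U x) powr (p + 1) \<le> amplitude x powr (p + 1)"
        using elim by auto
      then show ?case
        by (simp add: amplitude_powr abs_mult mult.commute mult_left_mono)
    qed
  qed measurable
  then have "U \<in> Lp_weighted (p + 1) (\<lambda>x. \<bar>\<Gamma> x\<bar>)"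
    using Um by (simp add: Lp_weighted_def)
  moreover have "(\<lambda>x. 0) \<in> L2" by (simp add: L2_def)
  ultimately show X: "U \<in> X_space p \<Gamma>"
    using L2 st(1) by (auto simp: X_space_def Hcurl_def)
  show "critical_point_J p V \<Gamma> U"
    by (rule critical_point_J_if_pointwise[OF p V_measurable \<Gamma>_measurable X st(1,5)])
qed

end

text \<open>Switching a radial solution off on a measurable set of radii leaves a symmetric
  solution, and the zero field is one; hence the three-valued profiles, with the signs alone
  recovered when U is nonzero wherever V is. The second conjunct makes the profile genuinely
  arbitrary.\<close>

theorem theorem1:
  fixes p :: real and V \<Gamma> :: "real^3 \<Rightarrow> real" and V\<^sub>0 \<Gamma>\<^sub>0 :: "real \<Rightarrow> real"
  assumes "p > 1"
    and "V \<in> Linf_loc UNIV" and "\<Gamma> \<in> Linf_loc UNIV"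
    and "AE x in lebesgue. \<Gamma> x \<noteq> 0"
    and "AE x in lebesgue. 0 \<le> V x / \<Gamma> x"
    and "(\<lambda>x. V x / \<Gamma> x) \<in> Lp_loc (p / (p - 1))"
    and "V\<^sub>0 \<in> Linf_loc {0..}" and "\<Gamma>\<^sub>0 \<in> Linf_loc {0..}"
    and "AE x in lebesgue. V x = V\<^sub>0 (norm x)"
    and "AE x in lebesgue. \<Gamma> x = \<Gamma>\<^sub>0 (norm x)"
  shows
    "(\<forall>U. O3_symmetric U \<and> distributional_solution p V \<Gamma> U \<longrightarrow>
        has_weak_curl U (\<lambda>x. 0) \<and>
        (\<exists>s\<in>measurable_profiles {-1, 0, 1}. AE x in lebesgue. U x = radial_field p V \<Gamma> s x) \<and>
        ((AE x in lebesgue. V x \<noteq> 0 \<longrightarrow> U x \<noteq> 0) \<longrightarrow>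
           (\<exists>s\<in>measurable_profiles {-1, 1}. AE x in lebesgue. U x = radial_field p V \<Gamma> s x)) \<and>
        (integrable lebesgue (\<lambda>x. (V x / \<Gamma> x) powr (2 / (p - 1))) \<and>
         integrable lebesgue (\<lambda>x. (V x / \<Gamma> x) powr ((p + 1) / (p - 1)) * \<Gamma> x) \<longrightarrow>
           U \<in> X_space p \<Gamma> \<and> critical_point_J p V \<Gamma> U)) \<and>
     (\<forall>s\<in>measurable_profiles {-1, 0, 1}.
        O3_symmetric (radial_field p V \<Gamma> s) \<and>
        distributional_solution p V \<Gamma> (radial_field p V \<Gamma> s))"
proof -
  interpret radial_coefficients p V \<Gamma> V\<^sub>0 \<Gamma>\<^sub>0
    using assms by unfold_locales
  show ?thesis
  proof (rule conjI; intro allI impI ballI)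
    fix U assume "O3_symmetric U \<and> distributional_solution p V \<Gamma> U"
    then have U: "O3_symmetric U" "distributional_solution p V \<Gamma> U" by blast+
    note solution_structure(1-3)[OF U] solution_critical_point[OF U]
    then show "has_weak_curl U (\<lambda>x. 0) \<and>
        (\<exists>s\<in>measurable_profiles {-1, 0, 1}. AE x in lebesgue. U x = radial_field p V \<Gamma> s x) \<and>
        ((AE x in lebesgue. V x \<noteq> 0 \<longrightarrow> U x \<noteq> 0) \<longrightarrow>
           (\<exists>s\<in>measurable_profiles {-1, 1}. AE x in lebesgue. U x = radial_field p V \<Gamma> s x)) \<and>
        (integrable lebesgue (\<lambda>x. (V x / \<Gamma> x) powr (2 / (p - 1))) \<and>
         integrable lebesgue (\<lambda>x. (V x / \<Gamma> x) powr ((p + 1) / (p - 1)) * \<Gamma> x) \<longrightarrow>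
           U \<in> X_space p \<Gamma> \<and> critical_point_J p V \<Gamma> U)"
      by (intro conjI impI; (elim conjE)?)
  next
    fix s assume "s \<in> measurable_profiles {-1, 0, 1}"
    then show "O3_symmetric (radial_field p V \<Gamma> s) \<and>
        distributional_solution p V \<Gamma> (radial_field p V \<Gamma> s)"
      by (intro conjI radial_field_O3_symmetric radial_field_solution)
  qed
qed

end
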